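(* Let $(X,g)$ be a $2$-dimensional smooth connected Riemannian manifold without boundary. Let $Y_1\subset X$ be a $2$-dimensional compact connected $C^0$-submanifold with nonempty boundary $\partial Y_1$ such that $\rho_{Y_1}(x,y)<\infty$ for all $x,y\in Y_1$ and such that $Y_1$ is strictly convex in the metric $\rho_{Y_1}$. Let $Y_2\subset X$ also be a $2$-dimensional compact connected $C^0$-submanifold with $\partial Y_2\neq\varnothing$ such that $\rho_{Y_2}(x,y)<\infty$ for all $x,y\in Y_2$. Suppose that $\partial Y_1$ and $\partial Y_2$ are isometric in the metrics $\rho_{Y_j}$, $j=1,2$, i.e. there is a bijection $f:\partial Y_1\to\partial Y_2$ with $\rho_{Y_2}(f(x),f(y))=\rho_{Y_1}(x,y)$ for all $x,y\in\partial Y_1$. Then $Y_2$ is strictly convex with respect to $\rho_{Y_2}$.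
   Context: A $C^0$-submanifold with boundary of dimension $n=\dim X$ in $X$ is a subset of $X$ which, with the subspace topology, is a topological $n$-manifold with boundary. $\mathrm{Int}\,Y$ and $\partial Y$ denote its interior and boundary. For such $Y$ and $x,y\in Y$, $$\rho_Y(x,y)=\liminf_{x'\to x,\; y'\to y;\; x',y'\in \mathrm{Int}\,Y}\ \inf\{\, l(\gamma)\,\},$$ the infimum being over all smooth paths $\gamma:[0,1]\to\mathrm{Int}\,Y$ joining $x'$ to $y'$, where $l$ is length with respect to $g$. (In dimension $2$, for compact connected $Y$ with nonempty boundary, if $\rho_Y$ is finite then it is a metric on $Y$.) All paths are assumed continuous and non-constant. A shortest path in the metric $\rho_Y$ between points $\alpha\ne\beta$ of $Y$ is a path $\gamma:[0,1]\to Y$ with $\gamma(0)=\alpha$, $\gamma(1)=\beta$ for which there is a strictly increasing continuous function $\varphi:[0,1]\to[0,\infty)$ with $\varphi(0)=0$ such that $\rho_Y(\gamma(s),\gamma(t))=\varphi(t)-\varphi(s)$ for all $0\le s\le t\le 1$. $Y$ is called strictly convex in the metric $\rho_Y$ if, for any $\alpha,\beta\in Y$, any shortest path $\gamma:[0,1]\to Y$ between $\alpha$ and $\beta$ (in the metric $\rho_Y$) satisfies $\gamma(]0,1[)\subset\mathrm{Int}\,Y$. *)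

theory Defs
  imports "HOL-Analysis.Analysis"
begin

section \<open>Smooth maps on open subsets of Euclidean spaces\<close>

text \<open>To be used with open \<open>S\<close> and finite-dimensional \<open>'a\<close>; there the
  successor case (all directional derivatives are of class \<open>C\<^sup>k\<close>) is the usual
  condition for class \<open>C\<^sup>k\<^sup>+\<^sup>1\<close>.\<close>

primrec Ck_on :: "nat \<Rightarrow> ('a::euclidean_space \<Rightarrow> 'b::real_normed_vector) \<Rightarrow> 'a set \<Rightarrow> bool" where
  "Ck_on 0 f S \<longleftrightarrow> continuous_on S f"
| "Ck_on (Suc k) f S \<longleftrightarrow>
     (\<forall>x\<in>S. f differentiable (at x)) \<and> (\<forall>v. Ck_on k (\<lambda>x. frechet_derivative f (at x) v) S)"

definition smooth_on :: "('a::euclidean_space \<Rightarrow> 'b::real_normed_vector) \<Rightarrow> 'a set \<Rightarrow> bool" where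
  "smooth_on f S \<longleftrightarrow> (\<forall>k. Ck_on k f S)"

section \<open>Smooth surfaces and Riemannian metrics\<close>

text \<open>A chart is a pair of its domain and its coordinate map; values of the coordinate map
  outside the domain are irrelevant.\<close>

type_synonym 'a chart = "'a set \<times> ('a \<Rightarrow> real^2)"

definition chart_on :: "'a topology \<Rightarrow> 'a chart \<Rightarrow> bool" where
  "chart_on X = (\<lambda>(U, \<phi>). openin X U \<and> open (\<phi> ` U) \<and>
     homeomorphic_map (subtopology X U) (top_of_set (\<phi> ` U)) \<phi>)"

definition transition :: "'a chart \<Rightarrow> 'a chart \<Rightarrow> real^2 \<Rightarrow> real^2" where
  "transition c d = snd d \<circ> inv_into (fst c) (snd c)"

text \<open>The atlas \<open>A\<close> need not be maximal: the notions below do not change when \<open>A\<close> is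
  replaced by another atlas of the same smooth structure.\<close>

definition smooth_surface :: "'a topology \<Rightarrow> 'a chart set \<Rightarrow> bool" where
  "smooth_surface X A \<longleftrightarrow>
     Hausdorff_space X \<and> second_countable X \<and>
     (\<forall>c\<in>A. chart_on X c) \<and> (\<Union>c\<in>A. fst c) = topspace X \<and>
     (\<forall>c\<in>A. \<forall>d\<in>A. smooth_on (transition c d) (snd c ` (fst c \<inter> fst d)))"

text \<open>A Riemannian metric is given by its components: \<open>g c p v w\<close> is the inner product of the
  tangent vectors at \<open>p\<close> whose coordinate vectors with respect to the chart \<open>c\<close> are \<open>v\<close> and
  \<open>w\<close>. The last clause is the transformation law under a change of charts.\<close>

type_synonym 'a metric_components = "'a chart \<Rightarrow> 'a \<Rightarrow> real^2 \<Rightarrow> real^2 \<Rightarrow> real"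

definition riemannian_metric :: "'a chart set \<Rightarrow> 'a metric_components \<Rightarrow> bool" where
  "riemannian_metric A g \<longleftrightarrow>
     (\<forall>c\<in>A. \<forall>p\<in>fst c. bilinear (g c p) \<and> (\<forall>v w. g c p v w = g c p w v) \<and>
        (\<forall>v. v \<noteq> 0 \<longrightarrow> 0 < g c p v v)) \<and>
     (\<forall>c\<in>A. \<forall>v w. smooth_on (\<lambda>x. g c (inv_into (fst c) (snd c) x) v w) (snd c ` fst c)) \<and>
     (\<forall>c\<in>A. \<forall>d\<in>A. \<forall>p\<in>fst c \<inter> fst d. \<forall>v w.
        g c p v w =
        g d p (frechet_derivative (transition c d) (at (snd c p)) v)
              (frechet_derivative (transition c d) (at (snd c p)) w))"

definition riemannian_surface :: "'a topology \<Rightarrow> 'a chart set \<Rightarrow> 'a metric_components \<Rightarrow> bool" where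
  "riemannian_surface X A g \<longleftrightarrow> smooth_surface X A \<and> riemannian_metric A g"

section \<open>Smooth paths and their length\<close>

text \<open>Paths have the parameter interval \<open>[0,1]\<close> and are non-constant. Smoothness on the closed
  interval means that locally the coordinate representation extends smoothly to an open set of
  parameters.\<close>

definition smooth_path :: "'a topology \<Rightarrow> 'a chart set \<Rightarrow> (real \<Rightarrow> 'a) \<Rightarrow> bool" where
  "smooth_path X A \<gamma> \<longleftrightarrow>
     pathin X \<gamma> \<and> \<not> \<gamma> constant_on {0..1} \<and>
     (\<forall>c\<in>A. \<forall>t\<in>{0..1}. \<gamma> t \<in> fst c \<longrightarrow>
        (\<exists>N h. open N \<and> t \<in> N \<and> smooth_on h N \<and>
           (\<forall>s\<in>N \<inter> {0..1}. \<gamma> s \<in> fst c \<and> snd c (\<gamma> s) = h s)))"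

text \<open>By the transformation law the speed does not depend on the chosen chart.\<close>

definition speed :: "'a chart set \<Rightarrow> 'a metric_components \<Rightarrow> (real \<Rightarrow> 'a) \<Rightarrow> real \<Rightarrow> real" where
  "speed A g \<gamma> t =
     (let c = (SOME c. c \<in> A \<and> \<gamma> t \<in> fst c);
          v = vector_derivative (snd c \<circ> \<gamma>) (at t within {0..1})
      in sqrt (g c (\<gamma> t) v v))"

definition path_len :: "'a chart set \<Rightarrow> 'a metric_components \<Rightarrow> (real \<Rightarrow> 'a) \<Rightarrow> real" where
  "path_len A g \<gamma> = integral {0..1} (speed A g \<gamma>)"

section \<open>Two-dimensional submanifolds with boundary\<close>

definition half_plane :: "(real^2) set" where
  "half_plane = {p. 0 \<le> p $ 2}"

text \<open>The Hausdorff property and second countability are inherited from \<open>X\<close>.\<close>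

definition C0_submanifold_bd :: "'a topology \<Rightarrow> 'a set \<Rightarrow> bool" where
  "C0_submanifold_bd X Y \<longleftrightarrow> Y \<subseteq> topspace X \<and>
     (\<forall>y\<in>Y. \<exists>U V. openin (subtopology X Y) U \<and> y \<in> U \<and> openin (top_of_set half_plane) V \<and>
        subtopology X U homeomorphic_space top_of_set V)"

text \<open>Manifold interior and boundary of \<open>Y\<close>, not the topological ones relative to \<open>X\<close>.\<close>

definition mf_interior :: "'a topology \<Rightarrow> 'a set \<Rightarrow> 'a set" where
  "mf_interior X Y = {y\<in>Y. \<exists>U V. openin (subtopology X Y) U \<and> y \<in> U \<and> open (V :: (real^2) set) \<and>
     subtopology X U homeomorphic_space top_of_set V}"

definition mf_boundary :: "'a topology \<Rightarrow> 'a set \<Rightarrow> 'a set" where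
  "mf_boundary X Y = Y - mf_interior X Y"

section \<open>The intrinsic metric, shortest paths and strict convexity\<close>

definition interior_dist ::
  "'a topology \<Rightarrow> 'a chart set \<Rightarrow> 'a metric_components \<Rightarrow> 'a set \<Rightarrow> 'a \<Rightarrow> 'a \<Rightarrow> ennreal" where
  "interior_dist X A g Y x y =
     (INF \<gamma> \<in> {\<gamma>. smooth_path X A \<gamma> \<and> \<gamma> ` {0..1} \<subseteq> mf_interior X Y \<and> \<gamma> 0 = x \<and> \<gamma> 1 = y}.
        ennreal (path_len A g \<gamma>))"

definition rho ::
  "'a topology \<Rightarrow> 'a chart set \<Rightarrow> 'a metric_components \<Rightarrow> 'a set \<Rightarrow> 'a \<Rightarrow> 'a \<Rightarrow> ennreal" where
  "rho X A g Y x y =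
     Liminf (inf (nhdsin X x \<times>\<^sub>F nhdsin X y) (principal (mf_interior X Y \<times> mf_interior X Y)))
       (\<lambda>(x', y'). interior_dist X A g Y x' y')"

definition shortest_path ::
  "'a topology \<Rightarrow> 'a chart set \<Rightarrow> 'a metric_components \<Rightarrow> 'a set \<Rightarrow> 'a \<Rightarrow> 'a \<Rightarrow> (real \<Rightarrow> 'a) \<Rightarrow> bool" where
  "shortest_path X A g Y \<alpha> \<beta> \<gamma> \<longleftrightarrow>
     \<alpha> \<noteq> \<beta> \<and> pathin (subtopology X Y) \<gamma> \<and> \<gamma> 0 = \<alpha> \<and> \<gamma> 1 = \<beta> \<and>
     (\<exists>\<phi> :: real \<Rightarrow> real. strict_mono_on {0..1} \<phi> \<and> continuous_on {0..1} \<phi> \<and> \<phi> 0 = 0 \<and>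
        (\<forall>s t. 0 \<le> s \<and> s \<le> t \<and> t \<le> 1 \<longrightarrow> rho X A g Y (\<gamma> s) (\<gamma> t) = ennreal (\<phi> t - \<phi> s)))"

definition strictly_convex ::
  "'a topology \<Rightarrow> 'a chart set \<Rightarrow> 'a metric_components \<Rightarrow> 'a set \<Rightarrow> bool" where
  "strictly_convex X A g Y \<longleftrightarrow>
     (\<forall>\<alpha>\<in>Y. \<forall>\<beta>\<in>Y. \<forall>\<gamma>. shortest_path X A g Y \<alpha> \<beta> \<gamma> \<longrightarrow> \<gamma> ` {0<..<1} \<subseteq> mf_interior X Y)"

end

theory Submission
  imports Defs
begin

text \<open>For three distinct boundary points \<open>b\<close>, \<open>a\<close>, \<open>c\<close> of the strictly convex \<open>Y\<^sub>1\<close> the triangle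
  inequality \<open>\<rho>(b,c) < \<rho>(b,a) + \<rho>(a,c)\<close> is strict, since otherwise shortest paths from \<open>b\<close> to \<open>a\<close>
  and from \<open>a\<close> to \<open>c\<close> would join to a shortest path through the boundary point \<open>a\<close>. Hence it is
  enough to find a triple with equality on \<open>\<partial>Y\<^sub>2\<close> whenever a shortest path \<open>\<gamma>\<close> of \<open>Y\<^sub>2\<close> meets
  the boundary at an inner parameter, say at the point \<open>a\<close>. A small coordinate circle around \<open>a\<close>
  contains an open arc in \<open>Int Y\<^sub>2\<close> whose end points \<open>b\<close> and \<open>c\<close> lie on \<open>\<partial>Y\<^sub>2\<close> on different sides
  of \<open>a\<close> (Janiszewski's theorem). So \<open>\<rho>(b,c)\<close> is small, a shortest path from \<open>b\<close> to \<open>c\<close> stays near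
  \<open>a\<close>, and there it has to cross \<open>\<gamma>\<close> both before and after \<open>a\<close> (Fashoda's theorem). Replacing its
  part between the two crossings by the part of \<open>\<gamma>\<close> yields a shortest path from \<open>b\<close> to \<open>c\<close>
  through \<open>a\<close>. The same crosscuts give the triangle inequality for \<open>\<rho>\<close> at a boundary point.\<close>

section \<open>Separation in the plane\<close>

text \<open>The isometry \<open>f\<close> only knows distances between boundary points, so strict
  convexity has to be read off from them alone. The boundary is merely a topological curve: a small
  circle may meet it in a Cantor set, and the interior part of the circle may have infinitely many
  components. Hence one component has to be singled out that separates in a half-disc chart, where
  the interior is the upper half and the boundary is the axis. Both plane theorems are applied in
  such a chart, whereas lengths are estimated in a smooth chart of \<open>X\<close>; the circle is
  round only in the latter. A second obstacle is that \<open>rho\<close> is a lower limit over pairs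
  of interior points. It is lower semicontinuous by construction, but subadditivity at a boundary
  point is not obvious, since two interior paths approaching that point need not come close to each
  other inside the interior. Crosscuts overcome this: an interior path that starts close enough to
  the point and leaves the chart has to pass through their open arc, any two points of which are
  joined inside the interior by a short arc.\<close>

lemma norm_vector_2: "norm (vector [a, b] :: real^2) = sqrt (a\<^sup>2 + b\<^sup>2)"
  by (simp add: norm_vec_def L2_set_def sum_2)

lemma vec2_eq_iff: "v = w \<longleftrightarrow> v $ 1 = w $ 1 \<and> v $ 2 = w $ 2" for v w :: "real^2"
  by (simp add: vec_eq_iff forall_2)

lemma vec2_eta: "vector [v $ 1, v $ 2] = v" for v :: "real^2"
  by (simp add: vec2_eq_iff)

lemma norm_vec2: "norm v = sqrt ((v $ 1)\<^sup>2 + (v $ 2)\<^sup>2)" for v :: "real^2"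
  by (metis norm_vector_2 vec2_eta)

lemma continuous_on_vector_2 [continuous_intros]:
  assumes "continuous_on S f" "continuous_on S g"
  shows "continuous_on S (\<lambda>x. vector [f x, g x] :: real^2)"
proof -
  have "(\<lambda>x. vector [f x, g x] :: real^2) = (\<lambda>x. \<chi> i. if i = 1 then f x else g x)"
    by (rule ext) (simp add: vec2_eq_iff)
  moreover have "continuous_on S (\<lambda>x. if i = 1 then f x else g x)" for i :: 2
    using assms by (cases "i = 1") auto
  then have "continuous_on S (\<lambda>x. (\<chi> i. if i = 1 then f x else g x) :: real^2)"
    by (rule continuous_on_vec_lambda)
  ultimately show ?thesis
    by (simp only:)
qed

text \<open>Janiszewski's theorem for \<open>complex\<close>, carried over by the coordinate
  bijection \<open>e\<close> with inverse \<open>e'\<close>; both are continuous, so connected sets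
  correspond.\<close>

lemma janiszewski_plane:
  fixes a b :: "real^2"
  assumes "compact S" "closed T" "connected (S \<inter> T)"
    and "connected_component (- S) a b" "connected_component (- T) a b"
  shows "connected_component (- (S \<union> T)) a b"
proof -
  define e :: "complex \<Rightarrow> real^2" where "e z = vector [Re z, Im z]" for z
  define e' :: "real^2 \<Rightarrow> complex" where "e' w = Complex (w $ 1) (w $ 2)" for w
  have ee': "e (e' w) = w" for w by (simp add: e_def e'_def vec2_eta)
  have e'e: "e' (e z) = z" for z by (simp add: e_def e'_def)
  have inj_e': "e' x = e' y \<longleftrightarrow> x = y" for x y by (metis ee')
  have ce: "continuous_on U e" for U
    unfolding e_def by (intro continuous_intros)
  have ce': "continuous_on U e'" for U
    unfolding e'_def by (subst Complex_eq) (intro continuous_intros)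
  have im: "e' ` U = e -` U" for U
    using ee' e'e by (auto simp: image_iff) metis
  have comp: "connected_component (- (e' ` U)) (e' a) (e' b)" if "connected_component (- U) a b" for U
  proof -
    obtain C where C: "connected C" "C \<subseteq> - U" "a \<in> C" "b \<in> C"
      using \<open>connected_component (- U) a b\<close> by (auto simp: connected_component_def)
    then show ?thesis
      unfolding connected_component_def
      by (intro exI[of _ "e' ` C"]) (auto intro!: connected_continuous_image ce' simp: inj_e')
  qed
  have "connected_component (- (e' ` S \<union> e' ` T)) (e' a) (e' b)"
  proof (rule Janiszewski)
    show "compact (e' ` S)" using assms(1) ce' compact_continuous_image by blast
    show "closed (e' ` T)" unfolding im using assms(2) ce[of UNIV] by (metis continuous_closed_vimage continuous_on_eq_continuous_at open_UNIV UNIV_I)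
    have "e' ` S \<inter> e' ` T = e' ` (S \<inter> T)" unfolding im by auto
    then show "connected (e' ` S \<inter> e' ` T)" using assms(3) ce' by (simp add: connected_continuous_image)
  qed (use assms comp in auto)
  then obtain C where C: "connected C" "C \<subseteq> - (e' ` S \<union> e' ` T)" "e' a \<in> C" "e' b \<in> C"
    by (auto simp: connected_component_def)
  then show ?thesis
    unfolding connected_component_def
    by (intro exI[of _ "e ` C"]) (auto intro!: connected_continuous_image ce simp: im image_iff ee' e'e;
         metis ee')
qed

text \<open>The components of \<open>K\<close> are open in \<open>K\<close> by local connectedness,
  so finitely many of them cover the part of \<open>K\<close> in the compact set \<open>T\<close>,
  which joins \<open>p\<close> to \<open>q\<close> off \<open>L\<close>. The rest of
  \<open>K\<close> cannot separate together with \<open>L\<close>, since \<open>T\<close> avoids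
  both. If no single component separated together with \<open>L\<close>, Janiszewski's theorem would
  allow the finitely many to be added back one at a time without separating.\<close>

lemma separating_component:
  fixes K L :: "(real^2) set"
  assumes L: "compact L" "connected L" and KL: "K \<inter> L = {}" "compact (K \<union> L)"
    and lc: "locally connected K"
    and T: "compact T" "connected T" "T \<inter> L = {}" "p \<in> T" "q \<in> T"
    and pq: "p \<notin> K" "q \<notin> K"
    and sep: "\<not> connected_component (- (K \<union> L)) p q"
  obtains J where "J \<in> components K" "compact (J \<union> L)"
    "\<not> connected_component (- (J \<union> L)) p q"
proof (rule ccontr)
  note thesis = that
  assume "\<not> thesis"
  have op: "openin (top_of_set K) J" if "J \<in> components K" for J
    using openin_components_locally_connected[OF lc that] .
  have clos: "closed (F \<union> L)" if F: "closedin (top_of_set K) F" for F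
  proof -
    obtain Z where Z: "closed Z" "F = K \<inter> Z" using F by (auto simp: closedin_closed)
    have "F \<union> L = (K \<union> L) \<inter> (Z \<union> L)" using Z by auto
    then show ?thesis using Z KL L by (simp add: closed_Int closed_Un compact_imp_closed)
  qed
  have cpt: "compact (J \<union> L)" if jc: "J \<in> components K" for J
  proof -
    have "closed (J \<union> L)" using clos closedin_component[OF jc] by blast
    moreover have "J \<union> L \<subseteq> K \<union> L" using in_components_subset[OF jc] by auto
    ultimately show ?thesis by (metis KL(2) compact_Int_closed inf.absorb2)
  qed
  have nosep: "connected_component (- (J \<union> L)) p q" if "J \<in> components K" for J
    using that thesis cpt \<open>\<not> thesis\<close> by blast
  have "compact (T \<inter> (K \<union> L))" using T KL by (simp add: compact_Int)
  moreover have "T \<inter> (K \<union> L) = T \<inter> K" using T by auto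
  ultimately have cTK: "compact (T \<inter> K)" by simp
  have "\<exists>D\<subseteq>(\<inter>) (T \<inter> K) ` components K. finite D \<and> T \<inter> K \<subseteq> \<Union>D"
  proof (rule cTK[unfolded compact_eq_openin_cover, rule_format], intro conjI ballI)
    fix c assume "c \<in> (\<inter>) (T \<inter> K) ` components K"
    then obtain J where J: "J \<in> components K" "c = T \<inter> K \<inter> J" by auto
    obtain Z where "open Z" "J = K \<inter> Z" using op[OF J(1)] by (auto simp: openin_open)
    then show "openin (top_of_set (T \<inter> K)) c" using J by (auto simp: openin_open)
  next
    show "T \<inter> K \<subseteq> \<Union> ((\<inter>) (T \<inter> K) ` components K)"
      using Union_components[of K] by blast
  qed
  then obtain D where D: "D \<subseteq> (\<inter>) (T \<inter> K) ` components K" "finite D" "T \<inter> K \<subseteq> \<Union>D" by blast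
  obtain \<J> where J: "\<J> \<subseteq> components K" "finite \<J>" "D = (\<inter>) (T \<inter> K) ` \<J>"
    using finite_subset_image[OF D(2,1)] by blast
  have cov: "T \<inter> K \<subseteq> \<Union>\<J>" using D(3) J(3) by auto
  define F where "F = K - \<Union>\<J>"
  have "openin (top_of_set K) (\<Union>\<J>)" using J(1) op by (intro openin_Union) auto
  then have cF: "closedin (top_of_set K) F" unfolding F_def by (intro closedin_diff) auto
  have F0: "connected_component (- (F \<union> L)) p q"
    unfolding connected_component_def using T cov by (intro exI[of _ T]) (auto simp: F_def)
  have "connected_component (- (F \<union> \<Union>\<G> \<union> L)) p q" if "\<G> \<subseteq> \<J>" for \<G>
    using finite_subset[OF that J(2)] that
  proof (induction \<G> rule: finite_induct)
    case empty
    then show ?case using F0 by simp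
  next
    case (insert j \<G>)
    have jc: "j \<in> components K" using insert J by auto
    have cG: "closedin (top_of_set K) (F \<union> \<Union>\<G>)"
      using insert J by (intro closedin_Un cF closedin_Union) (auto intro: closedin_component)
    have dis: "j \<inter> (F \<union> \<Union>\<G>) = {}"
    proof -
      have "j \<inter> j' = {}" if "j' \<in> \<G>" for j'
        using components_nonoverlap[OF jc, of j'] that insert J by (metis (no_types, lifting) insert_subset subsetD)
      then show ?thesis using insert.prems by (auto simp: F_def)
    qed
    \<comment> \<open>The two sets overlap exactly in \<open>L\<close>, because distinct components
      of \<open>K\<close> are disjoint; the connectedness of \<open>L\<close> is what Janiszewski's
      theorem asks for.\<close>
    have "connected_component (- ((j \<union> L) \<union> (F \<union> \<Union>\<G> \<union> L))) p q"
    proof (rule janiszewski_plane)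
      have "(j \<union> L) \<inter> (F \<union> \<Union>\<G> \<union> L) = L" using dis by auto
      then show "connected ((j \<union> L) \<inter> (F \<union> \<Union>\<G> \<union> L))" using L by simp
    qed (use cpt[OF jc] clos[OF cG] nosep[OF jc] insert in auto)
    moreover have "(j \<union> L) \<union> (F \<union> \<Union>\<G> \<union> L) = F \<union> \<Union>(insert j \<G>) \<union> L" by auto
    ultimately show ?case by simp
  qed
  from this[of \<J>] have "connected_component (- (F \<union> \<Union>\<J> \<union> L)) p q" by simp
  moreover have "F \<union> \<Union>\<J> = K" unfolding F_def using J(1) in_components_subset by blast
  ultimately show False using sep by simp
qed

text \<open>If \<open>J\<close> accumulated only on one side of the origin, Janiszewski's theorem would apply to the two
  halves of the segment, with \<open>J\<close> added to one of them.\<close>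

lemma crosscut_side:
  fixes J :: "(real^2) set" and s \<sigma> :: real
  assumes J: "\<And>w. w \<in> J \<Longrightarrow> 0 < w $ 2 \<and> s < norm w \<and> norm w < 1/2"
    and cJ: "compact (J \<union> {w. w $ 2 = 0 \<and> \<bar>w $ 1\<bar> \<le> 1/2})"
    and s: "0 < s" "s < 1/2" and \<sigma>: "\<bar>\<sigma>\<bar> = 1"
    and sep: "\<not> connected_component (- (J \<union> {w. w $ 2 = 0 \<and> \<bar>w $ 1\<bar> \<le> 1/2})) (vector [0, s]) (vector [0, 1])"
  shows "\<exists>w \<in> closure J. w $ 2 = 0 \<and> \<sigma> * w $ 1 < 0"
proof (rule ccontr)
  assume contra: "\<not> ?thesis"
  \<comment> \<open>Under the contrary assumption \<open>closure J\<close> can touch the axis only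
    on the side of \<open>Lp\<close>. Adding \<open>Lp\<close> to it therefore leaves only the
    origin in common with \<open>Lm\<close>.\<close>
  define Lp Lm :: "(real^2) set"
    where "Lp = {w. w $ 2 = 0 \<and> 0 \<le> \<sigma> * w $ 1 \<and> \<sigma> * w $ 1 \<le> 1/2}"
      and "Lm = {w. w $ 2 = 0 \<and> \<sigma> * w $ 1 \<le> 0 \<and> -1/2 \<le> \<sigma> * w $ 1}"
  define L :: "(real^2) set" where "L = {w. w $ 2 = 0 \<and> \<bar>w $ 1\<bar> \<le> 1/2}"
  have \<sigma>': "\<sigma> = 1 \<or> \<sigma> = -1" using \<sigma> by auto
  have L: "L = Lp \<union> Lm" using \<sigma>' by (auto simp: L_def Lp_def Lm_def abs_if)
  have clp: "closed Lp" unfolding Lp_def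
    by (intro closed_Collect_conj closed_Collect_eq closed_Collect_le continuous_intros)
  have clm: "closed Lm" unfolding Lm_def
    by (intro closed_Collect_conj closed_Collect_eq closed_Collect_le continuous_intros)
  have "convex Lm \<and> bounded Lm"
  proof (cases "\<sigma> = 1")
    case True
    then have "Lm = cbox (vector [-1/2, 0]) (vector [0, 0])"
      by (auto simp: Lm_def mem_box_cart forall_2)
    then show ?thesis by (simp add: convex_box bounded_cbox)
  next
    case False
    then have "Lm = cbox (vector [0, 0]) (vector [1/2, 0])"
      using \<sigma>' by (auto simp: Lm_def mem_box_cart forall_2)
    then show ?thesis by (simp add: convex_box bounded_cbox)
  qed
  then have cvx: "convex Lm" and bd: "bounded Lm" by auto
  have JL: "closure J \<subseteq> J \<union> L"
    using cJ by (fold L_def) (meson Un_upper1 closure_minimal compact_imp_closed)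
  have n1: "closure J \<subseteq> {w. s \<le> norm w \<and> norm w \<le> 1/2 \<and> 0 \<le> w $ 2}"
    using J by (intro closure_minimal closed_Collect_conj closed_Collect_le continuous_intros)
      (auto intro: less_imp_le)
  let ?p = "vector [0, s] :: real^2" and ?q = "vector [0, 1] :: real^2"
  \<comment> \<open>Corners of a detour from \<open>?p\<close> to \<open>?q\<close> that avoids
    \<open>closure J\<close> and \<open>Lp\<close>: inside the disc of radius \<open>s\<close>,
    which \<open>J\<close> does not meet, to the point \<open>p2\<close> of the other half
    \<open>Lm\<close>, then down below the axis and around outside the disc of radius 1/2.\<close>
  define p2 p3 :: "real^2" where "p2 = vector [- \<sigma> * s / 2, 0]" and "p3 = vector [- \<sigma> * s / 2, -1]"
  define S where "S = closure J \<union> Lp"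
  have SLm: "S \<union> Lm = J \<union> L"
    using JL closure_subset[of J] by (auto simp: S_def L)
  have "closed S" unfolding S_def by (intro closed_Un clp closed_closure)
  moreover have "bounded S"
    using SLm cJ by (fold L_def) (metis bounded_subset compact_imp_bounded sup_ge1)
  ultimately have cS: "compact S" by (simp add: compact_eq_bounded_closed)
  have "S \<inter> Lm = {0}"
  proof -
    have "w = 0" if "w \<in> S" "w \<in> Lm" for w
    proof -
      have "\<sigma> * w $ 1 = 0" "w $ 2 = 0"
        using that contra by (fastforce simp: S_def Lp_def Lm_def)+
      then show ?thesis using \<sigma>' by (auto simp: vec2_eq_iff)
    qed
    moreover have "0 \<in> S \<inter> Lm" by (simp add: S_def Lp_def Lm_def)
    ultimately show ?thesis by auto
  qed
  then have con: "connected (S \<inter> Lm)" by simp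
  have "connected (- Lm)"
    by (rule connected_complement_bounded_convex) (use cvx bd in auto)
  moreover have "?p \<in> - Lm" "?q \<in> - Lm" using s by (auto simp: Lm_def)
  ultimately have 1: "connected_component (- Lm) ?p ?q"
    unfolding connected_component_def by blast
  define C where "C = closed_segment ?p p2 \<union> (closed_segment p2 p3 \<union> - cball 0 (1/2))"
  have "connected (- cball (0::real^2) (1/2))"
    by (rule connected_complement_bounded_convex) auto
  moreover have "p3 \<in> - cball 0 (1/2)" "?q \<in> - cball 0 (1/2)"
    using component_le_norm_cart[of p3 2] component_le_norm_cart[of ?q 2] by (auto simp: p3_def)
  ultimately have C: "connected C" "?q \<in> C" "?p \<in> C"
    unfolding C_def by (auto intro!: connected_Un)
  have p2: "p2 \<notin> S"
  proof -
    have "norm p2 < s" using s \<sigma>' by (auto simp: p2_def norm_vector_2)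
    then show ?thesis using n1 \<sigma>' s by (auto simp: S_def Lp_def p2_def)
  qed
  have "w \<notin> S" if "w \<in> C" for w
  proof -
    consider "w \<in> closed_segment ?p p2" | "w \<in> closed_segment p2 p3" | "norm w > 1/2"
      using \<open>w \<in> C\<close> by (auto simp: C_def)
    then show ?thesis
    proof cases
      case 1
      then obtain u where u: "0 \<le> u" "u \<le> 1" "w = (1 - u) *\<^sub>R ?p + u *\<^sub>R p2"
        by (auto simp: in_segment)
      show ?thesis
      proof (cases "u = 1")
        case True
        then show ?thesis using u p2 by simp
      next
        case False
        then have w2: "w $ 2 > 0" using u s by (simp add: p2_def)
        have "w \<in> closed_segment ?p p2" by fact
        moreover have "closed_segment ?p p2 \<subseteq> cball 0 s"
          using s \<sigma>' by (intro closed_segment_subset) (auto simp: norm_vector_2 p2_def)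
        ultimately have "norm w \<le> s" by auto
        then have "w \<notin> J" using J by force
        then show ?thesis using w2 JL by (auto simp: S_def Lp_def L_def)
      qed
    next
      case 2
      then obtain u where u: "0 \<le> u" "u \<le> 1" "w = (1 - u) *\<^sub>R p2 + u *\<^sub>R p3"
        by (auto simp: in_segment)
      show ?thesis
      proof (cases "u = 0")
        case True
        then show ?thesis using u p2 by simp
      next
        case False
        then have w2: "w $ 2 < 0" using u s by (simp add: p2_def p3_def)
        then show ?thesis using n1 by (auto simp: S_def Lp_def)
      qed
    next
      case 3
      have "w \<notin> Lp"
      proof
        assume "w \<in> Lp"
        then have "norm w \<le> 1/2" using \<sigma>' by (auto simp: norm_vec2 Lp_def)
        then show False using 3 by simp
      qed
      then show ?thesis using 3 n1 by (auto simp: S_def)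
    qed
  qed
  then have 2: "connected_component (- S) ?p ?q"
    unfolding connected_component_def using C by blast
  have "connected_component (- (S \<union> Lm)) ?p ?q"
    using janiszewski_plane[OF cS clm con 2 1] .
  then show False using sep SLm by (simp add: L_def)
qed

section \<open>Arcs of a circle\<close>

definition circ :: "real^2 \<Rightarrow> real \<Rightarrow> real \<Rightarrow> real^2" where
  "circ a r t = a + r *\<^sub>R vector [cos t, sin t]"

lemma continuous_on_circ [continuous_intros]:
  fixes f :: "'b::t2_space \<Rightarrow> real"
  assumes "continuous_on S f"
  shows "continuous_on S (\<lambda>x. circ a r (f x))"
  unfolding circ_def by (intro continuous_intros assms)

lemma dist_circ [simp]: "dist a (circ a r t) = \<bar>r\<bar>"
  by (simp add: circ_def dist_norm norm_vector_2)

lemma circ_eq_iff: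
  assumes "r \<noteq> 0" "\<bar>s - t\<bar> < 2 * pi"
  shows "circ a r s = circ a r t \<longleftrightarrow> s = t"
proof
  assume "circ a r s = circ a r t"
  then have "sin s = sin t \<and> cos s = cos t"
    using assms(1) by (simp add: circ_def vec2_eq_iff)
  then obtain n :: int where n: "s = t + 2 * pi * n"
    using sin_cos_eq_iff by blast
  then have "2 * pi * \<bar>n\<bar> < 2 * pi * 1" using assms(2) by (simp add: abs_mult)
  then have "n = 0" by (subst (asm) mult_less_cancel_left_pos) auto
  then show "s = t" using n by simp
qed simp

text \<open>The parameter is normalized to a half-open window starting at \<open>\<alpha>\<close>,
  so that the circle can be cut open at a prescribed point.\<close>

lemma circ_surj:
  assumes "dist a w = r" "r > 0"
  obtains t where "\<alpha> \<le> t" "t < \<alpha> + 2 * pi" "circ a r t = w"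
proof -
  define v where "v = (1 / r) *\<^sub>R (w - a)"
  have "norm v = 1" using assms by (simp add: v_def dist_norm norm_minus_commute)
  then have "(v $ 1)\<^sup>2 + (v $ 2)\<^sup>2 = 1" by (simp add: norm_vec2)
  then obtain t where t: "v $ 1 = cos t" "v $ 2 = sin t" by (rule sincos_total_2pi)
  define n where "n = \<lfloor>(t - \<alpha>) / (2 * pi)\<rfloor>"
  define t' where "t' = t - 2 * pi * n"
  have "n \<le> (t - \<alpha>) / (2 * pi)" "(t - \<alpha>) / (2 * pi) < n + 1" unfolding n_def by linarith+
  then have "2 * pi * n \<le> t - \<alpha>" "t - \<alpha> < 2 * pi * n + 2 * pi"
    by (simp_all add: field_simps)
  moreover have "sin t' = sin t" "cos t' = cos t"
    using sin_cos_eq_iff[of t t'] by (auto simp: t'_def)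
  then have "vector [cos t', sin t'] = v" using t by (simp add: vec2_eq_iff)
  then have "circ a r t' = w" using assms by (simp add: circ_def v_def)
  ultimately show ?thesis using that[of t'] by (simp add: t'_def)
qed

lemma cos_less_cos_abs: "cos x < cos d" if "d < x" "x < 2 * pi - d" "0 \<le> d" "d \<le> pi"
proof (cases "x \<le> pi")
  case True
  then show ?thesis using that by (intro cos_monotone_0_pi) auto
next
  case False
  have "cos (2 * pi - x) < cos d" using that False by (intro cos_monotone_0_pi) auto
  then show ?thesis by (simp add: cos_diff)
qed

text \<open>Cutting the circle open at the missing point \<open>e\<close> turns
  \<open>\<Gamma>\<close> into a set \<open>I\<close> of parameters in an interval of length
  \<open>2 * pi\<close>. Connectedness makes \<open>I\<close> order-convex. The parameter
  \<open>\<beta>\<close> of \<open>e'\<close> is a limit of \<open>I\<close>, and so is at least one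
  end of the interval, both ends belonging to \<open>e\<close>; hence \<open>I\<close> contains
  everything between \<open>\<beta>\<close> and that end.\<close>

lemma circle_arc:
  fixes \<Gamma> :: "(real^2) set"
  assumes r: "0 < r" and G: "\<Gamma> \<subseteq> sphere a r" "connected \<Gamma>"
    and e: "e \<in> closure \<Gamma>" "e \<notin> \<Gamma>" "e' \<in> closure \<Gamma>" "e' \<notin> \<Gamma>" "e \<noteq> e'"
  obtains \<alpha> \<beta> where "\<alpha> < \<beta>" "\<beta> \<le> \<alpha> + 2 * pi" "circ a r ` {\<alpha><..<\<beta>} \<subseteq> \<Gamma>"
    "circ a r \<alpha> = e \<and> circ a r \<beta> = e' \<or> circ a r \<alpha> = e' \<and> circ a r \<beta> = e"
proof -
  have "closure \<Gamma> \<subseteq> sphere a r" using G(1) by (intro closure_minimal) auto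
  then have es: "dist a e = r" "dist a e' = r" using e by auto
  obtain \<alpha> where \<alpha>: "circ a r \<alpha> = e" using circ_surj[OF es(1) r] by metis
  obtain \<beta> where \<beta>: "\<alpha> \<le> \<beta>" "\<beta> < \<alpha> + 2 * pi" "circ a r \<beta> = e'" using circ_surj[OF es(2) r] by metis
  then have "\<alpha> < \<beta>" using e(5) \<alpha> by (cases "\<alpha> = \<beta>") auto
  have \<alpha>2: "circ a r (\<alpha> + 2 * pi) = e" using \<alpha> by (simp add: circ_def)
  define I where "I = {t. \<alpha> < t \<and> t < \<alpha> + 2 * pi \<and> circ a r t \<in> \<Gamma>}"
  have sub: "\<Gamma> \<subseteq> circ a r ` I"
  proof
    fix w assume w: "w \<in> \<Gamma>"
    then have "dist a w = r" using G(1) by auto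
    then obtain t where t: "\<alpha> \<le> t" "t < \<alpha> + 2 * pi" "circ a r t = w"
      using circ_surj[OF _ r] by metis
    have "t \<noteq> \<alpha>" using t w e(2) \<alpha> by auto
    then show "w \<in> circ a r ` I" using t w by (auto simp: I_def intro!: image_eqI[of _ _ t])
  qed
  have Icc: "closure I \<subseteq> {\<alpha>..\<alpha> + 2 * pi}"
    by (intro closure_minimal) (auto simp: I_def)
  have cl: "\<exists>t\<in>closure I. circ a r t = w" if "w \<in> closure \<Gamma>" for w
  proof -
    have "compact (closure I)" using Icc by (metis bounded_closed_interval bounded_subset closed_closure compact_eq_bounded_closed)
    then have "compact (circ a r ` closure I)"
      by (intro compact_continuous_image continuous_on_circ continuous_on_id)
    then have "closure \<Gamma> \<subseteq> circ a r ` closure I"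
      using sub closure_subset[of I] by (intro closure_minimal compact_imp_closed) auto
    then show ?thesis using that by auto
  qed
  have between: "\<tau> \<in> I" if t: "t1 \<in> I" "t2 \<in> I" "t1 < \<tau>" "\<tau> < t2" for t1 t2 \<tau>
  proof (rule ccontr)
    assume n: "\<tau> \<notin> I"
    \<comment> \<open>The zero set of \<open>f\<close> is the line through the points with
      parameters \<open>\<alpha>\<close> and \<open>\<tau>\<close>; \<open>m\<close> is the mean
      angle and \<open>d\<close> half the difference. This line separates the arc before
      \<open>\<tau>\<close> from the arc after it.\<close>
    define m d where "m = (\<alpha> + \<tau>) / 2" and "d = (\<tau> - \<alpha>) / 2"
    define f where "f w = (w - a) \<bullet> vector [cos m, sin m] - r * cos d" for w :: "real^2"
    have d: "0 < d" "d < pi" using t by (auto simp: d_def I_def)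
    have f: "f (circ a r t) = r * (cos (t - m) - cos d)" for t
      by (simp add: f_def circ_def inner_vec_def sum_2 cos_diff algebra_simps)
    have pos: "0 < f (circ a r t)" if "\<alpha> < t" "t < \<tau>" for t
    proof -
      have "\<bar>t - m\<bar> < d" using that by (auto simp: m_def d_def abs_if field_simps)
      then have "cos d < cos \<bar>t - m\<bar>" using d by (intro cos_monotone_0_pi) auto
      then show ?thesis using r by (simp add: f)
    qed
    have neg: "f (circ a r t) < 0" if "\<tau> < t" "t < \<alpha> + 2 * pi" for t
    proof -
      have "cos (t - m) < cos d"
        using that d by (intro cos_less_cos_abs) (auto simp: m_def d_def field_simps)
      then show ?thesis using r by (simp add: f mult_pos_neg)
    qed
    have cf: "continuous_on UNIV f" unfolding f_def by (intro continuous_intros)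
    have "open {w. 0 < f w}" "open {w. f w < 0}"
      using cf by (auto intro!: open_Collect_less continuous_intros)
    moreover have "\<Gamma> \<subseteq> {w. 0 < f w} \<union> {w. f w < 0}"
    proof
      fix w assume "w \<in> \<Gamma>"
      then obtain t where t: "t \<in> I" "w = circ a r t" using sub by auto
      then show "w \<in> {w. 0 < f w} \<union> {w. f w < 0}"
        using pos[of t] neg[of t] n by (cases t \<tau> rule: linorder_cases) (auto simp: I_def)
    qed
    moreover have "{w. 0 < f w} \<inter> {w. f w < 0} \<inter> \<Gamma> = {}" by auto
    moreover have "circ a r t1 \<in> {w. 0 < f w} \<inter> \<Gamma>" "circ a r t2 \<in> {w. f w < 0} \<inter> \<Gamma>"
      using t pos neg by (auto simp: I_def)
    ultimately show False using G(2) connectedD[of \<Gamma> "{w. 0 < f w}" "{w. f w < 0}"] by blast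
  qed
  obtain t where t: "t \<in> closure I" "circ a r t = e" using cl e(1) by blast
  obtain u where u: "u \<in> closure I" "circ a r u = e'" using cl e(3) by blast
  have "u \<noteq> \<alpha>" "u \<noteq> \<alpha> + 2 * pi" using u e(5) \<alpha> \<alpha>2 by auto
  moreover have "\<alpha> \<le> u" "u \<le> \<alpha> + 2 * pi" using u(1) Icc by auto
  ultimately have "\<bar>u - \<beta>\<bar> < 2 * pi" using \<beta> by linarith
  then have u\<beta>: "u = \<beta>" using u \<beta> r circ_eq_iff[of r u \<beta> a] by auto
  \<comment> \<open>Which of the two alternatives holds decides which of the two arcs between
    \<open>e\<close> and \<open>e'\<close> is found in \<open>\<Gamma>\<close>.\<close>
  have t\<alpha>: "t = \<alpha> \<or> t = \<alpha> + 2 * pi"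
  proof (rule ccontr)
    assume n: "\<not> ?thesis"
    have "\<alpha> \<le> t" "t \<le> \<alpha> + 2 * pi" using t(1) Icc by auto
    then have "\<bar>t - \<alpha>\<bar> < 2 * pi" using n by linarith
    then have "t = \<alpha>" using t \<alpha> r circ_eq_iff[of r t \<alpha> a] by auto
    then show False using n by auto
  qed
  have app: "\<exists>y\<in>I. \<bar>y - x\<bar> < \<epsilon>" if "x \<in> closure I" "0 < \<epsilon>" for x \<epsilon>
    using that by (auto simp: closure_approachable dist_real_def)
  have mid: "\<tau> \<in> I" if xy: "x \<in> closure I" "y \<in> closure I" "x < \<tau>" "\<tau> < y" for x y \<tau>
  proof -
    obtain t1 where "t1 \<in> I" "\<bar>t1 - x\<bar> < \<tau> - x" using app[OF xy(1), of "\<tau> - x"] xy by auto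
    moreover obtain t2 where "t2 \<in> I" "\<bar>t2 - y\<bar> < y - \<tau>" using app[OF xy(2), of "y - \<tau>"] xy by auto
    ultimately show ?thesis using between[of t1 t2 \<tau>] by auto
  qed
  have sub: "circ a r ` {x<..<y} \<subseteq> \<Gamma>" if "x \<in> closure I" "y \<in> closure I" for x y
    using mid[OF that] by (auto simp: I_def)
  show ?thesis
  proof (cases "t = \<alpha>")
    case True
    show ?thesis
    proof (rule that[of \<alpha> \<beta>])
      show "circ a r ` {\<alpha><..<\<beta>} \<subseteq> \<Gamma>" using sub t(1) u(1) u\<beta> True by blast
    qed (use \<open>\<alpha> < \<beta>\<close> \<beta> \<alpha> in simp_all)
  next
    case False
    then have t: "\<alpha> + 2 * pi \<in> closure I" using t\<alpha> t by simp
    show ?thesis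
    proof (rule that[of \<beta> "\<alpha> + 2 * pi"])
      show "circ a r ` {\<beta><..<\<alpha> + 2 * pi} \<subseteq> \<Gamma>" using sub t u(1) u\<beta> by blast
    qed (use \<open>\<alpha> < \<beta>\<close> \<beta> \<alpha>2 in simp_all)
  qed
qed

section \<open>Crosscuts of the half-disc and crossing paths\<close>

definition half_disc :: "(real^2) set" where
  "half_disc = {w. norm w \<le> 1 \<and> 0 \<le> w $ 2}"

lemma compact_half_disc: "compact half_disc"
proof -
  have "half_disc = cball 0 1 \<inter> {w. 0 \<le> w $ 2}" by (auto simp: half_disc_def)
  moreover have "closed {w::real^2. 0 \<le> w $ 2}" by (intro closed_Collect_le continuous_intros)
  ultimately show ?thesis by (metis compact_Int_closed compact_cball)
qed

text \<open>The part \<open>K\<close> of the preimage of the circle over the open half-plane,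
  together with the axis segment \<open>L\<close>, separates a point near the origin from a point on
  the rim, since \<open>K \<union> L\<close> contains the frontier of the preimage \<open>W\<close>
  of the disc. \<open>K\<close> is homeomorphic to an open subset of the circle, hence locally
  connected, and so one component \<open>J\<close> separates already. Its closure must reach the
  axis on both sides of the origin, and its image is a connected subset of the circle, thus contains
  an arc between the two limit points.\<close>

proposition crosscut_exists:
  fixes h :: "real^2 \<Rightarrow> real^2"
  assumes cont: "continuous_on half_disc h" and inj: "inj_on h half_disc" and r: "0 < r"
    and out: "\<And>w. w \<in> half_disc \<Longrightarrow> 1/2 \<le> norm w \<Longrightarrow> r < dist (h 0) (h w)"
  obtains \<alpha> \<beta> x y where "\<alpha> < \<beta>" "\<beta> \<le> \<alpha> + 2 * pi" "x * y < 0" "\<bar>x\<bar> < 1/2" "\<bar>y\<bar> < 1/2"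
    "circ (h 0) r \<alpha> = h (vector [x, 0])" "circ (h 0) r \<beta> = h (vector [y, 0])"
    "\<And>t. \<alpha> < t \<Longrightarrow> t < \<beta> \<Longrightarrow> \<exists>w. 0 < w $ 2 \<and> norm w < 1/2 \<and> circ (h 0) r t = h w"
proof -
  define L where "L = {w::real^2. w $ 2 = 0 \<and> \<bar>w $ 1\<bar> \<le> 1/2}"
  define K0 where "K0 = {w \<in> half_disc. dist (h 0) (h w) = r}"
  define K where "K = {w \<in> K0. 0 < w $ 2}"
  have K0: "norm w < 1/2" if "w \<in> K0" for w
    using that out[of w] by (force simp: K0_def)
  have L_box: "L = cbox (vector [-1/2, 0]) (vector [1/2, 0])"
    by (auto simp: L_def mem_box_cart forall_2)
  have cL: "compact L" "connected L" unfolding L_box by (auto simp: convex_connected convex_box)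
  have cld: "closed half_disc" using compact_half_disc compact_imp_closed by blast
  have "closed K0"
    unfolding K0_def using cld cont
    by (intro continuous_closed_preimage_constant continuous_intros)
  moreover have "bounded K0" using compact_half_disc by (auto simp: K0_def intro: bounded_subset compact_imp_bounded)
  ultimately have cK0: "compact K0" by (simp add: compact_eq_bounded_closed)
  have "K \<union> L = K0 \<union> L"
  proof -
    have "w \<in> L" if "w \<in> K0" "w \<notin> K" for w
    proof -
      have "w $ 2 = 0" using that by (auto simp: K_def K0_def half_disc_def)
      then show ?thesis using K0[OF that(1)] component_le_norm_cart[of w 1] by (auto simp: L_def)
    qed
    then show ?thesis by (auto simp: K_def)
  qed
  then have cKL: "compact (K \<union> L)" using cK0 cL by (simp add: compact_Un)
  have KL: "K \<inter> L = {}" by (auto simp: K_def L_def)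
  define Di where "Di = {w::real^2. norm w < 1 \<and> 0 < w $ 2}"
  have "Di = ball 0 1 \<inter> {w. 0 < w $ 2}" by (auto simp: Di_def)
  moreover have "open {w::real^2. 0 < w $ 2}" by (intro open_Collect_less continuous_intros)
  ultimately have oDi: "open Di" by (simp add: open_Int)
  have Dis: "Di \<subseteq> half_disc" by (auto simp: Di_def half_disc_def)
  \<comment> \<open>Invariance of domain: the image of the open half-disc is open in the plane,
    which makes the image of \<open>K\<close> relatively open in the circle.\<close>
  have ohDi: "open (h ` Di)"
    using invariance_of_domain[OF continuous_on_subset[OF cont Dis] oDi inj_on_subset[OF inj Dis]] .
  have KDi: "K \<subseteq> Di" using K0 by (force simp: K_def Di_def)
  have hK: "h ` K = sphere (h 0) r \<inter> h ` Di"
  proof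
    show "h ` K \<subseteq> sphere (h 0) r \<inter> h ` Di" using KDi by (auto simp: K_def K0_def)
    show "sphere (h 0) r \<inter> h ` Di \<subseteq> h ` K" using Dis by (auto simp: K_def K0_def Di_def)
  qed
  have ohK: "openin (top_of_set (sphere (h 0) r)) (h ` K)"
    unfolding hK using ohDi by (auto simp: openin_open)
  have lchK: "locally connected (h ` K)"
    using locally_open_subset[OF locally_connected_sphere ohK] .
  obtain k where hom: "homeomorphism half_disc (h ` half_disc) h k"
    using homeomorphism_compact[OF compact_half_disc cont refl inj] by blast
  have KD: "K \<subseteq> half_disc" using KDi Dis by auto
  have homK: "homeomorphism K (h ` K) h k"
    using homeomorphism_of_subsets[OF hom KD] KD by blast
  have lcK: "locally connected K"
    using homeomorphism_locally[OF homeomorphism_symD[OF homK], of connected connected] lchK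
    by (metis homeomorphic_connectedness homeomorphic_def)
  have 0: "0 \<in> half_disc" by (simp add: half_disc_def)
  obtain s where s: "0 < s" "s < 1/2" "\<And>w. w \<in> half_disc \<Longrightarrow> norm w \<le> s \<Longrightarrow> dist (h 0) (h w) < r"
  proof -
    obtain d where d: "d > 0" "\<And>w. w \<in> half_disc \<Longrightarrow> dist w 0 < d \<Longrightarrow> dist (h w) (h 0) < r"
      using cont 0 r unfolding continuous_on_iff by metis
    show ?thesis
    proof (rule that[of "min (d/2) (1/4)"])
      fix w assume w: "w \<in> half_disc" "norm w \<le> min (d/2) (1/4)"
      then have "dist w 0 < d" using d(1) by (auto simp: dist_norm)
      then show "dist (h 0) (h w) < r" using d(2)[OF w(1)] by (simp add: dist_commute)
    qed (use d(1) in auto)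
  qed
  let ?p = "vector [0, s] :: real^2" and ?q = "vector [0, 1] :: real^2"
  have pD: "?p \<in> half_disc" "?q \<in> half_disc" "norm ?p = s" "norm ?q = 1"
    using s by (auto simp: half_disc_def norm_vector_2)
  have pK: "?p \<notin> K" "?q \<notin> K" using s(3)[of ?p] K0[of ?q] pD by (auto simp: K_def K0_def)
  define W where "W = {w \<in> Di. dist (h 0) (h w) < r}"
  have oW: "open W"
  proof -
    have "open (Di \<inter> (\<lambda>w. dist (h 0) (h w)) -` {..<r})"
      using continuous_on_subset[OF cont Dis] oDi
      by (intro continuous_open_preimage continuous_intros) auto
    moreover have "Di \<inter> (\<lambda>w. dist (h 0) (h w)) -` {..<r} = W" by (auto simp: W_def)
    ultimately show ?thesis by simp
  qed
  have frW: "frontier W \<subseteq> K \<union> L"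
  proof -
    have "closed (half_disc \<inter> (\<lambda>w. dist (h 0) (h w)) -` {..r})"
      using cld cont by (intro continuous_closed_preimage continuous_intros) auto
    then have "closure W \<subseteq> half_disc \<inter> (\<lambda>w. dist (h 0) (h w)) -` {..r}"
      using Dis by (intro closure_minimal) (auto simp: W_def)
    moreover have "w \<in> K \<union> L"
      if w: "w \<in> half_disc" "dist (h 0) (h w) \<le> r" "w \<notin> W" for w
    proof -
      have n: "norm w < 1/2" using out[OF w(1)] w(2) by force
      show ?thesis
      proof (cases "w $ 2 = 0")
        case True
        then show ?thesis using n component_le_norm_cart[of w 1] by (auto simp: L_def)
      next
        case False
        then show ?thesis using w n by (auto simp: K_def K0_def W_def Di_def half_disc_def)
      qed
    qed
    ultimately show ?thesis unfolding frontier_def using oW by (auto simp: interior_open)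
  qed
  have sep: "\<not> connected_component (- (K \<union> L)) ?p ?q"
  proof
    assume "connected_component (- (K \<union> L)) ?p ?q"
    then obtain C where C: "connected C" "C \<subseteq> - (K \<union> L)" "?p \<in> C" "?q \<in> C"
      by (auto simp: connected_component_def)
    have "?p \<in> W" using s pD s(3)[of ?p] by (auto simp: W_def Di_def)
    moreover have "?q \<notin> W" using pD by (auto simp: W_def Di_def)
    ultimately have "C \<inter> frontier W \<noteq> {}" using C by (intro connected_Int_frontier) auto
    then show False using frW C by auto
  qed
  have T: "closed_segment ?p ?q \<inter> L = {}"
  proof -
    have "closed_segment ?p ?q \<subseteq> {w. 0 < w $ 2}"
    proof (rule closed_segment_subset)
      show "convex {w::real^2. 0 < w $ 2}"
        using convex_halfspace_gt[of 0 "axis 2 1 :: real^2"] by (simp add: inner_axis' )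
    qed (use s in auto)
    then show ?thesis by (auto simp: L_def)
  qed
  obtain J where J: "J \<in> components K" "compact (J \<union> L)" "\<not> connected_component (- (J \<union> L)) ?p ?q"
    by (rule separating_component[OF cL KL cKL lcK compact_segment connected_segment(1) T _ _ pK sep]) auto
  have JK: "J \<subseteq> K" and Jc: "connected J" using J(1) in_components_subset in_components_connected by auto
  have Js: "0 < w $ 2 \<and> s < norm w \<and> norm w < 1/2" if "w \<in> J" for w
    using that JK K0[of w] s(3)[of w] by (force simp: K_def K0_def)
  have side: "\<exists>w \<in> closure J. w $ 2 = 0 \<and> \<sigma> * w $ 1 < 0" if "\<bar>\<sigma>\<bar> = 1" for \<sigma> :: real
    by (rule crosscut_side[OF Js J(2)[unfolded L_def] s(1,2) that J(3)[unfolded L_def]])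
  obtain u where u: "u \<in> closure J" "u $ 2 = 0" "u $ 1 < 0" using side[of 1] by auto
  obtain v where v: "v \<in> closure J" "v $ 2 = 0" "0 < v $ 1" using side[of "-1"] by auto
  have cJ: "closure J \<subseteq> K0" using JK \<open>closed K0\<close> by (intro closure_minimal) (auto simp: K_def)
  have K0D: "K0 \<subseteq> half_disc" by (auto simp: K0_def)
  have cl: "h w \<in> closure (h ` J)" if "w \<in> closure J" for w
  proof -
    have "h ` closure J \<subseteq> closure (h ` J)"
      using cJ K0D cont by (intro image_closure_subset continuous_on_subset[OF cont]) (auto simp: closure_subset)
    then show ?thesis using that by auto
  qed
  have nin: "h w \<notin> h ` J" if "w \<in> closure J" "w $ 2 = 0" for w
  proof
    assume "h w \<in> h ` J"
    then obtain w' where "w' \<in> J" "h w = h w'" by auto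
    then have "w = w'" using inj that cJ K0D JK KD by (auto dest!: inj_onD)
    then show False using that \<open>w' \<in> J\<close> Js by force
  qed
  have hJ: "h ` J \<subseteq> sphere (h 0) r" using JK by (auto simp: K_def K0_def)
  have chJ: "connected (h ` J)"
    using Jc JK KD cont by (metis connected_continuous_image continuous_on_subset order_trans)
  have uv: "h u \<noteq> h v"
  proof
    assume "h u = h v"
    then have "u = v" using inj u v cJ K0D by (auto dest!: inj_onD)
    then show False using u v by auto
  qed
  obtain \<alpha> \<beta> where ab: "\<alpha> < \<beta>" "\<beta> \<le> \<alpha> + 2 * pi" "circ (h 0) r ` {\<alpha><..<\<beta>} \<subseteq> h ` J"
    "circ (h 0) r \<alpha> = h u \<and> circ (h 0) r \<beta> = h v \<or> circ (h 0) r \<alpha> = h v \<and> circ (h 0) r \<beta> = h u"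
    by (rule circle_arc[OF r hJ chJ cl[OF u(1)] nin[OF u(1,2)] cl[OF v(1)] nin[OF v(1,2)] uv])
  have mid: "\<exists>w. 0 < w $ 2 \<and> norm w < 1/2 \<and> circ (h 0) r t = h w" if "\<alpha> < t" "t < \<beta>" for t
    using ab(3) that Js by (force simp: image_subset_iff)
  have uve: "u = vector [u $ 1, 0]" "v = vector [v $ 1, 0]" using u v by (auto simp: vec2_eq_iff)
  have "norm u < 1/2" "norm v < 1/2" using u v cJ K0 by auto
  then have n: "\<bar>u $ 1\<bar> < 1/2" "\<bar>v $ 1\<bar> < 1/2" 
    using component_le_norm_cart[of u 1] component_le_norm_cart[of v 1] by linarith+
  from ab(4) show ?thesis
  proof
    assume e: "circ (h 0) r \<alpha> = h u \<and> circ (h 0) r \<beta> = h v"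
    show ?thesis
      by (rule that[OF ab(1,2) _ n _ _ mid]) (use u v e uve in \<open>auto simp: mult_neg_pos\<close>)
  next
    assume e: "circ (h 0) r \<alpha> = h v \<and> circ (h 0) r \<beta> = h u"
    show ?thesis
      by (rule that[OF ab(1,2) _ n(2,1) _ _ mid]) (use u v e uve in \<open>auto simp: mult_pos_neg\<close>)
  qed
qed

text \<open>\<open>Q\<close> is continued from its end point by a polygon \<open>tail\<close> to the
  corner \<open>(2, 0)\<close> of a box. Then the end points of \<open>P\<close> and of the
  continued \<open>Q\<close> alternate on the bottom side, so Fashoda's theorem gives a common
  point. It lies on \<open>Q\<close> itself because \<open>tail\<close> consists of points of norm
  at least \<open>R\<close>.\<close>

lemma fashoda_half_plane:
  fixes P Q :: "real \<Rightarrow> real^2"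
  assumes P: "path P" "\<And>t. t \<in> {0..1} \<Longrightarrow> 0 \<le> P t $ 2 \<and> norm (P t) < R"
    and Pe: "P 0 $ 2 = 0" "P 1 $ 2 = 0" "P 0 $ 1 * P 1 $ 1 < 0"
    and Q: "path Q" "\<And>t. t \<in> {0..1} \<Longrightarrow> 0 \<le> Q t $ 2 \<and> norm (Q t) \<le> 1"
    and Qe: "Q 0 = 0 \<or> Q 0 $ 2 = 0 \<and> \<bar>Q 0 $ 1\<bar> < \<bar>P 0 $ 1\<bar> \<and> \<bar>Q 0 $ 1\<bar> < \<bar>P 1 $ 1\<bar>" "R \<le> norm (Q 1)" "R \<le> 1"
  obtains s t where "s \<in> {0..1}" "t \<in> {0..1}" "P s = Q t"
proof -
  note result = that
  \<comment> \<open>\<open>P'\<close> will be \<open>P\<close> or its reverse, whichever runs from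
    left to right.\<close>
  have main: thesis if PP: "path P'" "path_image P' = path_image P" "P' 0 $ 2 = 0" "P' 1 $ 2 = 0"
      "P' 0 $ 1 < Q 0 $ 1" "Q 0 $ 1 < P' 1 $ 1" for P'
  proof -
    \<comment> \<open>Up to height 2, right to abscissa 2, down to the axis. The norm does not fall
      below that of \<open>Q 1\<close> on the first leg and is at least 2 on the others, so
      \<open>P\<close>, which has norm less than \<open>R\<close>, cannot be met.\<close>
    define w1 w2 w3 w4 :: "real^2" where "w1 = Q 1" and "w2 = vector [Q 1 $ 1, 2]"
      and "w3 = vector [2, 2]" and "w4 = vector [2, 0]"
    define tail where "tail = linepath w1 w2 +++ linepath w2 w3 +++ linepath w3 w4"
    have Pn: "0 \<le> w $ 2 \<and> norm w < R" if "w \<in> path_image P" for w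
      using that P(2) by (auto simp: path_image_def)
    have Qn: "0 \<le> w $ 2 \<and> norm w \<le> 1" if "w \<in> path_image Q" for w
      using that Q(2) by (auto simp: path_image_def)
    have box: "w \<in> cbox (vector [-2, 0]) (vector [2, 2])" if "0 \<le> w $ 2" "norm w \<le> 2" for w :: "real^2"
      using that component_le_norm_cart[of w 1] component_le_norm_cart[of w 2]
      by (auto simp: mem_box_cart forall_2)
    have w1: "0 \<le> w1 $ 2" "norm w1 \<le> 1" using Q(2)[of 1] by (auto simp: w1_def)
    have w1': "\<bar>w1 $ 1\<bar> \<le> 1" "w1 $ 2 \<le> 1"
      using component_le_norm_cart[of w1 1] component_le_norm_cart[of w1 2] w1 by linarith+
    have tb: "path_image tail \<subseteq> cbox (vector [-2, 0]) (vector [2, 2])"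
    proof -
      have "{w1, w2, w3, w4} \<subseteq> cbox (vector [-2, 0]) (vector [2, 2])"
        using w1' w1 unfolding w2_def w3_def w4_def w1_def[symmetric] by (auto simp: mem_box_cart forall_2)
      then show ?thesis
        unfolding tail_def by (simp add: path_image_join closed_segment_subset convex_box)
    qed
    have tn: "R \<le> norm w" if "w \<in> path_image tail" for w
    proof -
      have "w \<in> closed_segment w1 w2 \<or> w \<in> closed_segment w2 w3 \<or> w \<in> closed_segment w3 w4"
        using that unfolding tail_def by (simp add: path_image_join)
      then have "norm w1 \<le> norm w \<or> 1 \<le> norm w"
      proof (elim disjE)
        assume "w \<in> closed_segment w1 w2"
        then obtain u where u: "0 \<le> u" "u \<le> 1" "w = (1 - u) *\<^sub>R w1 + u *\<^sub>R w2" by (auto simp: in_segment)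
        have "w $ 1 = w1 $ 1" unfolding u(3) by (simp add: w2_def w1_def) (simp add: algebra_simps)
        moreover have "w $ 2 = w1 $ 2 + u * (2 - w1 $ 2)" unfolding u(3) by (simp add: w2_def) (simp add: algebra_simps)
        then have "w1 $ 2 \<le> w $ 2" using u w1' by (simp add: mult_nonneg_nonneg)
        ultimately have "norm w1 \<le> norm w" using w1 by (simp add: norm_vec2 power_mono)
        then show ?thesis by simp
      next
        assume "w \<in> closed_segment w2 w3"
        then obtain u where u: "w = (1 - u) *\<^sub>R w2 + u *\<^sub>R w3" by (auto simp: in_segment)
        have "w $ 2 = 2" unfolding u by (simp add: w2_def w3_def)
        then show ?thesis using component_le_norm_cart[of w 2] by simp
      next
        assume "w \<in> closed_segment w3 w4"
        then obtain u where u: "w = (1 - u) *\<^sub>R w3 + u *\<^sub>R w4" by (auto simp: in_segment)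
        have "w $ 1 = 2" unfolding u by (simp add: w4_def w3_def)
        then show ?thesis using component_le_norm_cart[of w 1] by simp
      qed
      then show ?thesis using Qe(2,3) by (auto simp: w1_def)
    qed
    have pt: "path tail"
      unfolding tail_def by (intro path_join_imp path_linepath) simp_all
    obtain z where z: "z \<in> path_image P'" "z \<in> path_image (Q +++ tail)"
    proof (rule fashoda_interlace[of P' "Q +++ tail" "vector [-2, 0]" "vector [2, 2]"])
      have ps: "pathstart tail = Q 1" "pathfinish tail = w4" by (simp_all add: tail_def w1_def)
      show "path (Q +++ tail)"
        using Q(1) ps pt by (simp add: pathfinish_def[of Q])
      show "path_image (Q +++ tail) \<subseteq> cbox (vector [- 2, 0]) (vector [2, 2])"
      proof -
        have "path_image Q \<subseteq> cbox (vector [- 2, 0]) (vector [2, 2])"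
        proof
          fix w assume "w \<in> path_image Q"
          from Qn[OF this] show "w \<in> cbox (vector [- 2, 0]) (vector [2, 2])" by (intro box) auto
        qed
        with tb path_image_join_subset[of Q tail] show ?thesis by blast
      qed
      show "path_image P' \<subseteq> cbox (vector [- 2, 0]) (vector [2, 2])"
      proof
        fix w assume "w \<in> path_image P'"
        then have "w \<in> path_image P" by (simp only: PP(2))
        from Pn[OF this] show "w \<in> cbox (vector [- 2, 0]) (vector [2, 2])"
          using Qe(3) by (intro box) auto
      qed
      have "P' 1 \<in> path_image P" using PP(2) by (auto simp: path_image_def)
      then have "\<bar>P' 1 $ 1\<bar> < 1" using Pn[of "P' 1"] component_le_norm_cart[of "P' 1" 1] Qe(3) by linarith
      then show "pathfinish P' $ 1 < pathfinish (Q +++ tail) $ 1"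
        by (simp add: pathfinish_def[of P'] ps w4_def)
    qed (use PP Qe in \<open>auto simp: pathstart_def pathfinish_def joinpaths_def tail_def w4_def linepath_def\<close>)
    have "z \<in> path_image P" using z PP by simp
    moreover have "z \<notin> path_image tail" using Pn[OF calculation] tn[of z] by auto
    then have "z \<in> path_image Q" using z(2) path_image_join_subset by blast
    ultimately show thesis using result by (auto simp: path_image_def)
  qed
  show thesis
  proof (cases "P 0 $ 1 < 0")
    case True
    then have "0 < P 1 $ 1" using Pe(3) by (simp add: mult_less_0_iff)
    then show thesis using True P Pe Qe(1) by (intro main[of P]) auto
  next
    case False
    then have "0 < P 0 $ 1" "P 1 $ 1 < 0" using Pe(3) by (auto simp: mult_less_0_iff)
    then show thesis using P Pe Qe(1)
      by (intro main[of "reversepath P"]) (auto simp: reversepath_def path_reversepath[unfolded reversepath_def] path_image_reversepath[unfolded reversepath_def])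
  qed
qed

section \<open>Smooth curves\<close>

text \<open>A one-variable counterpart of \<open>Ck_on\<close> in which the derivative is any
  witness instead of \<open>frechet_derivative\<close> in all directions, so that closure properties
  follow by plain induction. On open sets both notions agree, see
  \<open>Ck_on_eq_curve_C\<close>.\<close>

primrec curve_C :: "nat \<Rightarrow> (real \<Rightarrow> 'b::real_normed_vector) \<Rightarrow> real set \<Rightarrow> bool" where
  "curve_C 0 f N \<longleftrightarrow> continuous_on N f"
| "curve_C (Suc k) f N \<longleftrightarrow>
     (\<exists>f'. (\<forall>x\<in>N. (f has_vector_derivative f' x) (at x)) \<and> curve_C k f' N)"

lemma curve_C_SucI:
  assumes "\<And>x. x \<in> N \<Longrightarrow> (f has_vector_derivative f' x) (at x)" "curve_C k f' N"
  shows "curve_C (Suc k) f N"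
  using assms by auto

lemma curve_C_cong:
  assumes "open N" "\<And>x. x \<in> N \<Longrightarrow> f x = g x" "curve_C k f N"
  shows "curve_C k g N"
proof (cases k)
  case 0
  then show ?thesis using assms by (simp cong: continuous_on_cong)
next
  case (Suc j)
  then obtain f' where f': "\<And>x. x \<in> N \<Longrightarrow> (f has_vector_derivative f' x) (at x)" "curve_C j f' N"
    using assms(3) by auto
  have "(g has_vector_derivative f' x) (at x)" if "x \<in> N" for x
    using f'(1)[OF that] assms(1) that assms(2) by (rule has_vector_derivative_transform_within_open)
  then show ?thesis using f' Suc by auto
qed

lemma curve_C_subset: "curve_C k f N \<Longrightarrow> M \<subseteq> N \<Longrightarrow> curve_C k f M"
proof (induction k arbitrary: f)
  case 0
  then show ?case by (auto intro: continuous_on_subset)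
next
  case (Suc k)
  then show ?case by (metis curve_C.simps(2) subsetD)
qed

lemma curve_C_Suc_D: "curve_C (Suc k) f N \<Longrightarrow> curve_C k f N"
proof (induction k arbitrary: f)
  case 0
  then obtain f' where "\<And>x. x \<in> N \<Longrightarrow> (f has_vector_derivative f' x) (at x)" by auto
  then have "\<And>x. x \<in> N \<Longrightarrow> isCont f x"
    using has_vector_derivative_continuous by blast
  then show ?case by (simp add: continuous_at_imp_continuous_on)
next
  case (Suc k)
  then obtain f' where "\<And>x. x \<in> N \<Longrightarrow> (f has_vector_derivative f' x) (at x)" "curve_C (Suc k) f' N" by auto
  then show ?case using Suc.IH unfolding curve_C.simps(2)[of k] by blast
qed

lemma curve_C_const [simp]: "curve_C k (\<lambda>_. c) N"
proof (induction k arbitrary: c)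
  case (Suc k)
  have "((\<lambda>_. c) has_vector_derivative 0) (at x)" for x by (rule has_vector_derivative_const)
  then show ?case using Suc by (intro curve_C_SucI[where f' = "\<lambda>_. 0"]) auto
qed simp

lemma curve_C_add: "curve_C k f N \<Longrightarrow> curve_C k g N \<Longrightarrow> curve_C k (\<lambda>x. f x + g x) N"
proof (induction k arbitrary: f g)
  case 0
  then show ?case by (auto intro: continuous_intros)
next
  case (Suc k)
  obtain f' where f: "\<And>x. x \<in> N \<Longrightarrow> (f has_vector_derivative f' x) (at x)" "curve_C k f' N"
    using Suc.prems(1) by auto
  obtain g' where g: "\<And>x. x \<in> N \<Longrightarrow> (g has_vector_derivative g' x) (at x)" "curve_C k g' N"
    using Suc.prems(2) by auto
  show ?case
  proof (rule curve_C_SucI)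
    show "((\<lambda>x. f x + g x) has_vector_derivative f' x + g' x) (at x)" if "x \<in> N" for x
      by (intro has_vector_derivative_add f(1) g(1) that)
    show "curve_C k (\<lambda>x. f' x + g' x) N" by (intro Suc.IH f(2) g(2))
  qed
qed

lemma curve_C_scaleR:
  fixes u :: "real \<Rightarrow> real"
  shows "curve_C k u N \<Longrightarrow> curve_C k f N \<Longrightarrow> curve_C k (\<lambda>x. u x *\<^sub>R f x) N"
proof (induction k arbitrary: u f)
  case 0
  then show ?case by (auto intro: continuous_intros)
next
  case (Suc k)
  obtain f' where f: "\<And>x. x \<in> N \<Longrightarrow> (f has_vector_derivative f' x) (at x)" "curve_C k f' N"
    using Suc.prems(2) by auto
  obtain u' where u: "\<And>x. x \<in> N \<Longrightarrow> (u has_vector_derivative u' x) (at x)" "curve_C k u' N"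
    using Suc.prems(1) by auto
  have uf: "curve_C k u N" "curve_C k f N" using Suc.prems curve_C_Suc_D by blast+
  show ?case
  proof (rule curve_C_SucI)
    show "((\<lambda>x. u x *\<^sub>R f x) has_vector_derivative u x *\<^sub>R f' x + u' x *\<^sub>R f x) (at x)" if "x \<in> N" for x
      using u(1)[OF that] f(1)[OF that]
      by (intro has_vector_derivative_scaleR) (simp_all add: has_real_derivative_iff_has_vector_derivative)
    show "curve_C k (\<lambda>x. u x *\<^sub>R f' x + u' x *\<^sub>R f x) N"
      by (intro curve_C_add Suc.IH uf f(2) u(2))
  qed
qed

lemma curve_C_bounded_linear:
  assumes "bounded_linear L"
  shows "curve_C k f N \<Longrightarrow> curve_C k (\<lambda>x. L (f x)) N"
proof (induction k arbitrary: f)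
  case 0
  then show ?case using assms by (auto intro: bounded_linear.continuous_on)
next
  case (Suc k)
  then obtain f' where f: "\<And>x. x \<in> N \<Longrightarrow> (f has_vector_derivative f' x) (at x)" "curve_C k f' N" by auto
  show ?case
  proof (rule curve_C_SucI)
    show "((\<lambda>x. L (f x)) has_vector_derivative L (f' x)) (at x)" if "x \<in> N" for x
      by (rule bounded_linear.has_vector_derivative[OF assms f(1)[OF that]])
    show "curve_C k (\<lambda>x. L (f' x)) N" by (rule Suc.IH[OF f(2)])
  qed
qed

lemma curve_C_compose:
  fixes \<tau> :: "real \<Rightarrow> real"
  assumes "\<And>x. x \<in> N \<Longrightarrow> \<tau> x \<in> M"
  shows "curve_C k \<tau> N \<Longrightarrow> curve_C k f M \<Longrightarrow> curve_C k (\<lambda>x. f (\<tau> x)) N"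
proof (induction k arbitrary: f)
  case 0
  then show ?case using assms by (auto intro: continuous_on_compose2)
next
  case (Suc k)
  obtain f' where f: "\<And>x. x \<in> M \<Longrightarrow> (f has_vector_derivative f' x) (at x)" "curve_C k f' M"
    using Suc.prems(2) by auto
  obtain \<tau>' where t: "\<And>x. x \<in> N \<Longrightarrow> (\<tau> has_vector_derivative \<tau>' x) (at x)" "curve_C k \<tau>' N"
    using Suc.prems(1) by auto
  have "curve_C k \<tau> N" using Suc.prems curve_C_Suc_D by blast
  then have c: "curve_C k (\<lambda>x. f' (\<tau> x)) N" by (rule Suc.IH[OF _ f(2)])
  have D: "((\<lambda>x. f (\<tau> x)) has_vector_derivative \<tau>' x *\<^sub>R f' (\<tau> x)) (at x)" if "x \<in> N" for x
    using vector_diff_chain_at[OF t(1)[OF that] f(1)[OF assms[OF that]]] by (simp add: o_def)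
  show ?case by (rule curve_C_SucI[OF D curve_C_scaleR[OF t(2) c]])
qed

lemma frechet_derivative_real:
  fixes f :: "real \<Rightarrow> 'b::real_normed_vector"
  assumes "(f has_vector_derivative d) (at x)"
  shows "frechet_derivative f (at x) v = v *\<^sub>R d"
  using frechet_derivative_at[OF assms[unfolded has_vector_derivative_def]] by metis

lemma Ck_on_eq_curve_C:
  fixes f :: "real \<Rightarrow> 'b::real_normed_vector"
  assumes "open N"
  shows "Ck_on k f N \<longleftrightarrow> curve_C k f N"
proof (induction k arbitrary: f)
  case (Suc k)
  show ?case
  proof
    assume L: "Ck_on (Suc k) f N"
    have D: "(f has_vector_derivative frechet_derivative f (at x) 1) (at x)" if "x \<in> N" for x
    proof -
      have d: "(f has_derivative frechet_derivative f (at x)) (at x)"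
        using L that by (simp add: frechet_derivative_works[symmetric])
      then have "frechet_derivative f (at x) h = h *\<^sub>R frechet_derivative f (at x) 1" for h
        using has_derivative_linear[OF d] by (metis linear_cmul mult.right_neutral real_scaleR_def)
      then have "frechet_derivative f (at x) = (\<lambda>h. h *\<^sub>R frechet_derivative f (at x) 1)" by blast
      then show ?thesis using d unfolding has_vector_derivative_def by metis
    qed
    have "curve_C k (\<lambda>x. frechet_derivative f (at x) 1) N"
      using L Suc by simp
    from D this show "curve_C (Suc k) f N" by (rule curve_C_SucI)
  next
    assume R: "curve_C (Suc k) f N"
    then obtain f' where f: "\<And>x. x \<in> N \<Longrightarrow> (f has_vector_derivative f' x) (at x)" "curve_C k f' N" by auto
    have "curve_C k (\<lambda>x. frechet_derivative f (at x) v) N" for v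
    proof (rule curve_C_cong[OF assms])
      show "curve_C k (\<lambda>x. v *\<^sub>R f' x) N" using f(2) by (intro curve_C_scaleR) auto
    qed (use frechet_derivative_real[OF f(1)] in auto)
    moreover have "f differentiable at x" if "x \<in> N" for x
      using f(1)[OF that] by (rule differentiableI_vector)
    ultimately show "Ck_on (Suc k) f N" using Suc by simp
  qed
qed simp

lemma smooth_on_iff_curve_C:
  fixes f :: "real \<Rightarrow> 'b::real_normed_vector"
  assumes "open N"
  shows "smooth_on f N \<longleftrightarrow> (\<forall>k. curve_C k f N)"
  using Ck_on_eq_curve_C[OF assms, of _ f] by (simp add: smooth_on_def)

lemma vec2_basis: "v = v $ 1 *\<^sub>R axis 1 1 + v $ 2 *\<^sub>R axis 2 1" for v :: "real^2"
  by (simp add: vec2_eq_iff axis_def)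

lemma linear_vec2:
  fixes v :: "real^2"
  assumes "linear L"
  shows "L v = v $ 1 *\<^sub>R L (axis 1 1) + v $ 2 *\<^sub>R L (axis 2 1)"
  by (subst (1) vec2_basis) (simp add: assms linear_add linear_cmul)

text \<open>Chain rule by induction: the derivative of the composite is a combination of the partial
  derivatives of \<open>F\<close> along \<open>P\<close>, to which the induction hypothesis applies,
  with the components of \<open>P'\<close> as coefficients. For transition maps this shows that
  smoothness of a curve carries over from chart to chart.\<close>

lemma curve_C_Ck_on:
  fixes F :: "real^2 \<Rightarrow> 'b::real_normed_vector"
  assumes "\<And>x. x \<in> N \<Longrightarrow> P x \<in> S"
  shows "Ck_on k F S \<Longrightarrow> curve_C k P N \<Longrightarrow> curve_C k (\<lambda>x. F (P x)) N"
proof (induction k arbitrary: F)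
  case 0
  then show ?case using assms by (auto intro: continuous_on_compose2)
next
  case (Suc k)
  obtain P' where P: "\<And>x. x \<in> N \<Longrightarrow> (P has_vector_derivative P' x) (at x)" "curve_C k P' N"
    using Suc.prems(2) by auto
  have Pk: "curve_C k P N" using Suc.prems curve_C_Suc_D by blast
  define G where "G v x = frechet_derivative F (at x) v" for v x
  have G: "curve_C k (\<lambda>x. G v (P x)) N" for v
    using Suc.prems(1) Suc.IH[OF _ Pk, of "G v"] by (simp add: G_def)
  have comp: "curve_C k (\<lambda>x. P' x $ i) N" for i
    by (rule curve_C_bounded_linear[OF bounded_linear_vec_nth P(2)])
  have D: "((\<lambda>x. F (P x)) has_vector_derivative
      (P' x $ 1 *\<^sub>R G (axis 1 1) (P x) + P' x $ 2 *\<^sub>R G (axis 2 1) (P x))) (at x)" if "x \<in> N" for x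
  proof -
    have d: "(F has_derivative frechet_derivative F (at (P x))) (at (P x))"
      using Suc.prems(1) assms[OF that] by (simp add: frechet_derivative_works[symmetric])
    have "((F \<circ> P) has_derivative frechet_derivative F (at (P x)) \<circ> (\<lambda>h. h *\<^sub>R P' x)) (at x)"
      using P(1)[OF that] d unfolding has_vector_derivative_def by (rule diff_chain_at)
    moreover have "frechet_derivative F (at (P x)) \<circ> (\<lambda>h. h *\<^sub>R P' x) =
       (\<lambda>h. h *\<^sub>R frechet_derivative F (at (P x)) (P' x))"
      using has_derivative_linear[OF d] by (auto simp: linear_cmul)
    moreover have "frechet_derivative F (at (P x)) (P' x) =
       P' x $ 1 *\<^sub>R G (axis 1 1) (P x) + P' x $ 2 *\<^sub>R G (axis 2 1) (P x)"
      unfolding G_def by (rule linear_vec2[OF has_derivative_linear[OF d]])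
    ultimately show ?thesis by (simp add: has_vector_derivative_def o_def)
  qed
  have "curve_C k (\<lambda>x. P' x $ 1 *\<^sub>R G (axis 1 1) (P x) + P' x $ 2 *\<^sub>R G (axis 2 1) (P x)) N"
    by (intro curve_C_add curve_C_scaleR comp G)
  from D this show ?case by (rule curve_C_SucI)
qed

section \<open>Explicit smooth curves and a smooth step function\<close>

lemma curve_C_id: "curve_C k (\<lambda>x. x :: real) N"
proof (cases k)
  case (Suc j)
  have "((\<lambda>x. x) has_vector_derivative 1) (at x)" for x :: real
    by (rule has_vector_derivative_id)
  then show ?thesis using Suc by (auto intro!: exI[of _ "\<lambda>_. 1"])
qed (simp add: continuous_on_id)

lemma curve_C_affine: "curve_C k (\<lambda>x. a + b * x :: real) N"
  using curve_C_add[OF curve_C_const curve_C_scaleR[OF curve_C_const curve_C_id]] by simp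

text \<open>One family for all explicit paths: circular arcs if \<open>v\<close> and
  \<open>w\<close> are orthogonal of equal length, motion along a straight segment if
  \<open>w = 0\<close>. Differentiation leads back into the family, so smoothness is an immediate
  induction.\<close>

definition ellipse_arc :: "real^2 \<Rightarrow> real^2 \<Rightarrow> real^2 \<Rightarrow> real \<Rightarrow> real \<Rightarrow> real \<Rightarrow> real^2" where
  "ellipse_arc m v w \<alpha> \<beta> t = m + (cos (\<alpha> + \<beta> * t) *\<^sub>R v + sin (\<alpha> + \<beta> * t) *\<^sub>R w)"

lemma ellipse_arc_deriv:
  "(ellipse_arc m v w \<alpha> \<beta> has_vector_derivative ellipse_arc 0 (\<beta> *\<^sub>R w) (- \<beta> *\<^sub>R v) \<alpha> \<beta> t) (at t)"
proof -
  have c: "((\<lambda>t. cos (\<alpha> + \<beta> * t)) has_real_derivative - (\<beta> * sin (\<alpha> + \<beta> * t))) (at t)"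
    and s: "((\<lambda>t. sin (\<alpha> + \<beta> * t)) has_real_derivative \<beta> * cos (\<alpha> + \<beta> * t)) (at t)"
    by (auto intro!: derivative_eq_intros)
  have "((\<lambda>t. m + (cos (\<alpha> + \<beta> * t) *\<^sub>R v + sin (\<alpha> + \<beta> * t) *\<^sub>R w)) has_vector_derivative
     (0 + ((cos (\<alpha> + \<beta> * t) *\<^sub>R 0 + (- (\<beta> * sin (\<alpha> + \<beta> * t))) *\<^sub>R v) +
       (sin (\<alpha> + \<beta> * t) *\<^sub>R 0 + (\<beta> * cos (\<alpha> + \<beta> * t)) *\<^sub>R w)))) (at t)"
    by (intro has_vector_derivative_add has_vector_derivative_scaleR has_vector_derivative_const c s)
  then show ?thesis
    by (simp add: ellipse_arc_def[abs_def] algebra_simps)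
qed

lemma curve_C_ellipse_arc: "curve_C k (ellipse_arc m v w \<alpha> \<beta>) N"
proof (induction k arbitrary: m v w)
  case 0
  show ?case unfolding ellipse_arc_def curve_C.simps by (intro continuous_intros)
next
  case (Suc k)
  show ?case by (rule curve_C_SucI[OF ellipse_arc_deriv Suc])
qed

text \<open>The classical function exp(-1/x), extended by 0, times powers of 1/x. By
  \<open>flat_deriv\<close> the derivative of each member is a linear combination of members, which
  gives smoothness of all of them, also at 0.\<close>

definition flat :: "nat \<Rightarrow> real \<Rightarrow> real" where
  "flat m x = (if 0 < x then inverse x ^ m * exp (- inverse x) else 0)"

lemma flat_nonneg: "0 \<le> flat m x" by (simp add: flat_def)

lemma flat_tendsto: "((\<lambda>x. flat m x) \<longlongrightarrow> 0) (at 0)"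
proof -
  have "((\<lambda>x::real. inverse x ^ m * exp (- inverse x)) \<longlongrightarrow> 0) (at_right 0)"
  proof -
    have "((\<lambda>y::real. y ^ m / exp y) \<longlongrightarrow> 0) at_top" by (rule tendsto_power_div_exp_0)
    from filterlim_compose[OF this filterlim_inverse_at_top_right]
    show ?thesis by (simp add: exp_minus field_simps)
  qed
  then have "((\<lambda>x. flat m x) \<longlongrightarrow> 0) (at_right 0)"
    by (rule Lim_transform_eventually) (auto simp: eventually_at_right_field flat_def intro: exI[of _ 1])
  moreover have "((\<lambda>x. flat m x) \<longlongrightarrow> 0) (at_left 0)"
    by (rule Lim_transform_eventually[OF tendsto_const]) (auto simp: eventually_at_left_field flat_def intro: exI[of _ "-1"])
  ultimately show ?thesis using filterlim_split_at by blast
qed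

lemma mult_power_pred: "x * x ^ (n - Suc 0) = (if n = 0 then x else x ^ n)" for x :: real
  by (cases n) auto

lemma flat_deriv:
  "(flat m has_real_derivative (flat (m + 2) x - m * flat (m + 1) x)) (at x)"
proof -
  consider "x < 0" | "0 < x" | "x = 0" by linarith
  then show ?thesis
  proof cases
    case 1
    have "((\<lambda>_. 0) has_real_derivative 0) (at x)" by simp
    then have "(flat m has_real_derivative 0) (at x)"
      by (rule has_field_derivative_transform_within_open[of _ _ _ "{..<0}"]) (use 1 in \<open>auto simp: flat_def\<close>)
    then show ?thesis using 1 by (simp add: flat_def)
  next
    case 2
    have "((\<lambda>x. inverse x ^ m * exp (- inverse x)) has_real_derivative (flat (m + 2) x - m * flat (m + 1) x)) (at x)"
      using 2 by (cases m) (auto intro!: derivative_eq_intros simp: flat_def power2_eq_square field_simps mult_power_pred)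
    then show ?thesis
      by (rule has_field_derivative_transform_within_open[of _ _ _ "{0<..}"]) (use 2 in \<open>auto simp: flat_def\<close>)
  next
    case 3
    \<comment> \<open>The difference quotient at 0 is again a member of the family, namely
      \<open>flat (Suc m)\<close>.\<close>
    have "((\<lambda>h. (flat m (0 + h) - flat m 0) / h) \<longlongrightarrow> 0) (at 0)"
      using flat_tendsto[of "Suc m"]
      by (rule Lim_transform_eventually) (auto simp: eventually_at flat_def field_simps intro!: exI[of _ 1])
    then have "(flat m has_real_derivative 0) (at 0)" by (simp add: DERIV_def)
    then show ?thesis using 3 by (simp add: flat_def)
  qed
qed

lemma curve_C_flat: "curve_C k (flat m) N"
proof (induction k arbitrary: m)
  case 0
  show ?case using DERIV_isCont[OF flat_deriv] by (simp add: continuous_at_imp_continuous_on)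
next
  case (Suc k)
  have C: "curve_C k (\<lambda>x. flat (m + 2) x + (- m) *\<^sub>R flat (m + 1) x) N"
    by (intro curve_C_add curve_C_scaleR Suc curve_C_const)
  have D: "(flat m has_vector_derivative flat (m + 2) x + (- m) *\<^sub>R flat (m + 1) x) (at x)" for x
    using flat_deriv[of m x] by (simp add: has_real_derivative_iff_has_vector_derivative)
  show ?case by (rule curve_C_SucI[OF D C])
qed

lemma curve_C_inverse_power: "curve_C k (\<lambda>x::real. inverse x ^ m) {0<..}"
proof (induction k arbitrary: m)
  case 0
  show ?case by (auto intro!: continuous_intros)
next
  case (Suc k)
  have D: "((\<lambda>x. inverse x ^ m) has_vector_derivative (- m) *\<^sub>R inverse x ^ (m + 1)) (at x)" if "x \<in> {0<..}" for x :: real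
    unfolding has_real_derivative_iff_has_vector_derivative[symmetric]
    using that by (cases m) (auto intro!: derivative_eq_intros simp: field_simps mult_power_pred)
  have C: "curve_C k (\<lambda>x::real. (- m) *\<^sub>R inverse x ^ (m + 1)) {0<..}"
    by (intro curve_C_scaleR Suc curve_C_const)
  show ?case by (rule curve_C_SucI[OF D C])
qed

text \<open>The quotient \<open>a / (a + b)\<close>, where \<open>a\<close> is positive to the right
  of 1/3 and \<open>b\<close> to the left of 2/3, so that the denominator never vanishes. The two
  constant stretches are used for joining paths, and the nonnegative derivative permits substitution
  in length integrals.\<close>

lemma smooth_step:
  obtains \<theta> \<theta>' :: "real \<Rightarrow> real" where "\<And>k. curve_C k \<theta> UNIV"
    "\<And>x. (\<theta> has_real_derivative \<theta>' x) (at x)" "\<And>x. 0 \<le> \<theta>' x"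
    "\<And>x. x \<le> 1/3 \<Longrightarrow> \<theta> x = 0" "\<And>x. 2/3 \<le> x \<Longrightarrow> \<theta> x = 1"
proof -
  \<comment> \<open>The explicit coefficient \<open>1\<close> keeps the arguments in the form
    \<open>a + b * x\<close> of \<open>curve_C_affine\<close>.\<close>
  define a b where "a x = flat 0 (-1/3 + 1 * x)" and "b x = flat 0 (2/3 + (-1) * x)" for x
  define a' b' where "a' x = flat 2 (-1/3 + 1 * x)" and "b' x = - flat 2 (2/3 + (-1) * x)" for x
  have pos: "0 < a x + b x" for x
  proof -
    have "0 < a x \<or> 0 < b x" by (cases "x > 1/3") (auto simp: a_def b_def flat_def)
    moreover have "0 \<le> a x" "0 \<le> b x" by (auto simp: a_def b_def flat_nonneg)
    ultimately show ?thesis by linarith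
  qed
  have ab: "curve_C k a N" "curve_C k b N" for k N
    unfolding a_def b_def by (rule curve_C_compose[OF UNIV_I curve_C_affine curve_C_flat])+
  have inv: "curve_C k (\<lambda>x. inverse (a x + b x) ^ 1) UNIV" for k
    by (rule curve_C_compose[OF _ curve_C_add curve_C_inverse_power]) (auto simp: pos ab)
  have df: "((\<lambda>x. flat 0 (c + d * x)) has_real_derivative flat 2 (c + d * x) * d) (at x)" for c d x
  proof (rule DERIV_chain2[where f = "flat 0" and g = "\<lambda>x. c + d * x"])
    show "(flat 0 has_real_derivative flat 2 (c + d * x)) (at (c + d * x))"
      using flat_deriv[of 0 "c + d * x"] by (simp add: numeral_2_eq_2)
    show "((\<lambda>x. c + d * x) has_real_derivative d) (at x)"
      by (auto intro!: derivative_eq_intros)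
  qed
  have da: "(a has_real_derivative a' x) (at x)" "(b has_real_derivative b' x) (at x)" for x
    using df[of "-1/3" 1] df[of "2/3" "-1"]
    by (simp_all add: a_def[abs_def] b_def[abs_def] a'_def b'_def)
  show ?thesis
  proof (rule that[of "\<lambda>x. a x *\<^sub>R inverse (a x + b x)" "\<lambda>x. (a' x * b x - a x * b' x) / (a x + b x)\<^sup>2"])
    show "curve_C k (\<lambda>x. a x *\<^sub>R inverse (a x + b x)) UNIV" for k
      using inv by (intro curve_C_scaleR ab) simp
    show "((\<lambda>x. a x *\<^sub>R inverse (a x + b x)) has_real_derivative ((a' x * b x - a x * b' x) / (a x + b x)\<^sup>2)) (at x)" for x
    proof -
      have "((\<lambda>x. a x / (a x + b x)) has_real_derivative
          (a' x * (a x + b x) - a x * (a' x + b' x)) / ((a x + b x) * (a x + b x))) (at x)"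
        using pos[of x] by (intro DERIV_divide DERIV_add da) auto
      then show ?thesis by (simp add: power2_eq_square divide_inverse algebra_simps)
    qed
    show "0 \<le> (a' x * b x - a x * b' x) / (a x + b x)\<^sup>2" for x
    proof -
      have "0 \<le> a' x * b x" "0 \<le> a x * (- b' x)"
        unfolding a_def b_def a'_def b'_def minus_minus
        by (intro mult_nonneg_nonneg flat_nonneg)+
      then show ?thesis by (intro divide_nonneg_nonneg) simp_all
    qed
    show "a x *\<^sub>R inverse (a x + b x) = 0" if "x \<le> 1/3" for x
      using that by (simp add: a_def flat_def)
    show "a x *\<^sub>R inverse (a x + b x) = 1" if "2/3 \<le> x" for x
      using that pos[of x] by (simp add: b_def flat_def)
  qed
qed

section \<open>Charts and speed\<close>

locale surface =
  fixes X :: "'a topology" and A :: "'a chart set" and g :: "'a metric_components"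
  assumes riemannian: "riemannian_surface X A g"
begin

abbreviation rng :: "'a chart \<Rightarrow> (real^2) set" where "rng c \<equiv> snd c ` fst c"
abbreviation crd_inv :: "'a chart \<Rightarrow> real^2 \<Rightarrow> 'a" where "crd_inv c \<equiv> inv_into (fst c) (snd c)"

lemma Hausdorff: "Hausdorff_space X"
  using riemannian by (simp add: riemannian_surface_def smooth_surface_def)

lemma chart_homeomorphic:
  assumes "c \<in> A"
  shows "homeomorphic_map (subtopology X (fst c)) (top_of_set (rng c)) (snd c)"
  using assms riemannian
  by (auto simp: riemannian_surface_def smooth_surface_def chart_on_def split: prod.splits)

lemma openin_dom: "c \<in> A \<Longrightarrow> openin X (fst c)"
  and open_rng: "c \<in> A \<Longrightarrow> open (rng c)"
  using riemannian by (auto simp: riemannian_surface_def smooth_surface_def chart_on_def)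

lemma dom_subset: "c \<in> A \<Longrightarrow> fst c \<subseteq> topspace X"
  using openin_dom openin_subset by blast

lemma chart_at:
  assumes "p \<in> topspace X"
  obtains c where "c \<in> A" "p \<in> fst c"
proof -
  have "p \<in> (\<Union>c\<in>A. fst c)"
    using assms riemannian by (simp add: riemannian_surface_def smooth_surface_def)
  then show ?thesis using that by blast
qed

lemma inj_chart: "c \<in> A \<Longrightarrow> inj_on (snd c) (fst c)"
  using homeomorphic_imp_injective_map[OF chart_homeomorphic] dom_subset
  by (simp add: topspace_subtopology inf.absorb2)

lemma crd_inv_crd [simp]: "c \<in> A \<Longrightarrow> p \<in> fst c \<Longrightarrow> crd_inv c (snd c p) = p"
  by (simp add: inj_chart)

lemma continuous_map_chart: "c \<in> A \<Longrightarrow> continuous_map (subtopology X (fst c)) euclidean (snd c)"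
  using homeomorphic_imp_continuous_map[OF chart_homeomorphic]
  by (auto simp: continuous_map_in_subtopology)

lemma continuous_map_crd_inv: "c \<in> A \<Longrightarrow> continuous_map (top_of_set (rng c)) X (crd_inv c)"
proof -
  assume c: "c \<in> A"
  obtain k where k: "homeomorphic_maps (subtopology X (fst c)) (top_of_set (rng c)) (snd c) k"
    using chart_homeomorphic[OF c] homeomorphic_map_maps by blast
  have "continuous_map (top_of_set (rng c)) X k"
    using k by (simp add: homeomorphic_maps_def continuous_map_in_subtopology)
  moreover have "k x = crd_inv c x" if x: "x \<in> rng c" for x
  proof -
    obtain p where p: "p \<in> fst c" "x = snd c p" using x by auto
    then have "k x = p"
      using k dom_subset[OF c] by (auto simp: homeomorphic_maps_def topspace_subtopology)
    then show ?thesis using p c by simp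
  qed
  ultimately show ?thesis by (rule continuous_map_eq) simp
qed

lemma open_chart_image:
  assumes "c \<in> A" "openin X W"
  shows "open (snd c ` (fst c \<inter> W))"
proof -
  have "openin (subtopology X (fst c)) (fst c \<inter> W)"
    using assms by (auto simp: openin_subtopology)
  then have "openin (top_of_set (rng c)) (snd c ` (fst c \<inter> W))"
    using homeomorphic_imp_open_map[OF chart_homeomorphic[OF assms(1)]] by (simp add: open_map_def)
  then show ?thesis using open_rng[OF assms(1)] openin_open_eq by blast
qed

lemma openin_chart_preimage:
  assumes "c \<in> A" "open O'"
  shows "openin X {p \<in> fst c. snd c p \<in> O'}"
proof -
  have "openin (subtopology X (fst c)) {p \<in> topspace (subtopology X (fst c)). snd c p \<in> O'}"
    using continuous_map_chart[OF assms(1)] assms(2) by (simp add: continuous_map_def)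
  then show ?thesis
    using openin_dom[OF assms(1)] dom_subset[OF assms(1)]
    by (simp add: topspace_subtopology inf.absorb2 openin_open_subtopology)
qed

text \<open>Closedness in all of \<open>X\<close>, not only in the chart domain, comes from
  compactness in a Hausdorff space. It ensures that a path is still inside the chart domain when it
  reaches the rim of a coordinate ball.\<close>

lemma closedin_chart_compact:
  assumes "c \<in> A" "compact K" "K \<subseteq> rng c"
  shows "closedin X {p \<in> fst c. snd c p \<in> K}"
proof -
  have "compactin (top_of_set (rng c)) K" using assms by (simp add: compactin_subtopology)
  then have "compactin X (crd_inv c ` K)"
    by (rule image_compactin[OF _ continuous_map_crd_inv[OF assms(1)]])
  moreover have "crd_inv c ` K = {p \<in> fst c. snd c p \<in> K}"
  proof
    show "crd_inv c ` K \<subseteq> {p \<in> fst c. snd c p \<in> K}"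
    proof
      fix p assume "p \<in> crd_inv c ` K"
      then obtain x where x: "x \<in> K" "p = crd_inv c x" by auto
      then have "x \<in> rng c" using assms(3) by auto
      then have "p \<in> fst c" "snd c p = x" using x by (simp_all add: inv_into_into f_inv_into_f)
      then show "p \<in> {p \<in> fst c. snd c p \<in> K}" using x by simp
    qed
    show "{p \<in> fst c. snd c p \<in> K} \<subseteq> crd_inv c ` K"
    proof
      fix p assume "p \<in> {p \<in> fst c. snd c p \<in> K}"
      then show "p \<in> crd_inv c ` K" using crd_inv_crd[OF assms(1), of p] by (metis (mono_tags) imageI mem_Collect_eq)
    qed
  qed
  ultimately show ?thesis using Hausdorff compactin_imp_closedin by auto
qed

lemma smooth_transition:
  assumes "c \<in> A" "d \<in> A"
  shows "smooth_on (transition c d) (snd c ` (fst c \<inter> fst d))"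
  using assms riemannian unfolding riemannian_surface_def smooth_surface_def by blast

lemma metric:
  assumes "c \<in> A" "p \<in> fst c"
  shows "bilinear (g c p)" "g c p v w = g c p w v" "v \<noteq> 0 \<Longrightarrow> 0 < g c p v v"
proof -
  have "bilinear (g c p) \<and> (\<forall>v w. g c p v w = g c p w v) \<and> (\<forall>v. v \<noteq> 0 \<longrightarrow> 0 < g c p v v)"
    using riemannian assms unfolding riemannian_surface_def riemannian_metric_def by blast
  then show "bilinear (g c p)" "g c p v w = g c p w v" "v \<noteq> 0 \<Longrightarrow> 0 < g c p v v" by blast+
qed

lemma metric_nonneg: "c \<in> A \<Longrightarrow> p \<in> fst c \<Longrightarrow> 0 \<le> g c p v v"
  using metric(3)[of c p v] metric(1)[of c p] by (cases "v = 0") (auto simp: bilinear_lzero)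

definition qform :: "'a chart \<Rightarrow> real^2 \<Rightarrow> real^2 \<Rightarrow> real" where
  "qform c x v = g c (crd_inv c x) v v"

text \<open>The metric components are known to be smooth in the point for fixed vectors only;
  expansion in the standard basis yields continuity jointly in point and vector.\<close>

lemma qform_expand:
  assumes "c \<in> A" "x \<in> rng c"
  shows "qform c x v = (v $ 1)\<^sup>2 * g c (crd_inv c x) (axis 1 1) (axis 1 1)
    + 2 * (v $ 1 * v $ 2) * g c (crd_inv c x) (axis 1 1) (axis 2 1)
    + (v $ 2)\<^sup>2 * g c (crd_inv c x) (axis 2 1) (axis 2 1)"
proof -
  have p: "crd_inv c x \<in> fst c" using assms(2) by (rule inv_into_into)
  define B where "B = g c (crd_inv c x)"
  have B: "bilinear B" and sym: "B (axis 2 1) (axis 1 1) = B (axis 1 1) (axis 2 1)"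
    using metric(1,2)[OF assms(1) p] by (auto simp: B_def)
  have l: "linear (B u)" "linear (\<lambda>y. B y u)" for u using B by (auto simp: bilinear_def)
  have "B v v = v $ 1 * B (axis 1 1) v + v $ 2 * B (axis 2 1) v"
    using linear_vec2[OF l(2), of v v] by simp
  also have "B (axis 1 1) v = v $ 1 * B (axis 1 1) (axis 1 1) + v $ 2 * B (axis 1 1) (axis 2 1)"
    using linear_vec2[OF l(1), of "axis 1 1" v] by simp
  also have "B (axis 2 1) v = v $ 1 * B (axis 1 1) (axis 2 1) + v $ 2 * B (axis 2 1) (axis 2 1)"
    using linear_vec2[OF l(1), of "axis 2 1" v] sym by simp
  finally show ?thesis
    unfolding qform_def B_def by (simp add: power2_eq_square algebra_simps)
qed

lemma continuous_on_qform:
  fixes u v :: "'b::topological_space \<Rightarrow> real^2"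
  assumes c: "c \<in> A" and u: "continuous_on S u" "u ` S \<subseteq> rng c" and v: "continuous_on S v"
  shows "continuous_on S (\<lambda>s. qform c (u s) (v s))"
proof -
  have "smooth_on (\<lambda>x. g c (crd_inv c x) a b) (rng c)" for a b
    using riemannian c unfolding riemannian_surface_def riemannian_metric_def by blast
  then have "continuous_on (rng c) (\<lambda>x. g c (crd_inv c x) a b)" for a b
    unfolding smooth_on_def by (metis Ck_on.simps(1))
  then have *: "continuous_on S (\<lambda>s. g c (crd_inv c (u s)) a b)" for a b
    using u by (rule continuous_on_compose2[where g = "\<lambda>x. g c (crd_inv c x) a b"])
  have "continuous_on S (\<lambda>s. (v s $ 1)\<^sup>2 * g c (crd_inv c (u s)) (axis 1 1) (axis 1 1)
    + 2 * (v s $ 1 * v s $ 2) * g c (crd_inv c (u s)) (axis 1 1) (axis 2 1)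
    + (v s $ 2)\<^sup>2 * g c (crd_inv c (u s)) (axis 2 1) (axis 2 1))"
    by (intro continuous_intros v *)
  then show ?thesis
    using u(2) qform_expand[OF c] by (subst continuous_on_cong[OF refl]) auto
qed

lemma qform_scaleR:
  assumes "c \<in> A" "x \<in> rng c"
  shows "qform c x (a *\<^sub>R v) = a\<^sup>2 * qform c x v"
  unfolding qform_expand[OF assms] by (simp add: power2_eq_square algebra_simps)

text \<open>Extrema of a continuous positive function on the compact product of \<open>K\<close> and
  the unit circle, extended to all vectors by homogeneity. Over \<open>K\<close>, Riemannian and
  Euclidean length become comparable.\<close>

lemma qform_bounds:
  assumes c: "c \<in> A" and K: "compact K" "K \<subseteq> rng c" "K \<noteq> {}"
  obtains \<kappa> C where "0 < \<kappa>" "0 < C" "\<And>x v. x \<in> K \<Longrightarrow> \<kappa> * norm v \<le> sqrt (qform c x v)"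
    "\<And>x v. x \<in> K \<Longrightarrow> sqrt (qform c x v) \<le> C * norm v"
proof -
  let ?S = "K \<times> sphere (0::real^2) 1"
  let ?f = "\<lambda>z. sqrt (qform c (fst z) (snd z))"
  have cS: "compact ?S" using K by (simp add: compact_Times)
  have "axis 1 1 \<in> sphere (0::real^2) 1" by (simp add: norm_axis_1)
  then have ne: "?S \<noteq> {}" using K by blast
  have cf: "continuous_on ?S ?f"
    using K(2) by (intro continuous_intros continuous_on_qform[OF c]) auto
  obtain z0 where z0: "z0 \<in> ?S" "\<And>z. z \<in> ?S \<Longrightarrow> ?f z0 \<le> ?f z"
    using continuous_attains_inf[OF cS ne cf] by blast
  obtain z1 where z1: "z1 \<in> ?S" "\<And>z. z \<in> ?S \<Longrightarrow> ?f z \<le> ?f z1"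
    using continuous_attains_sup[OF cS ne cf] by blast
  have pos: "0 < ?f z" if "z \<in> ?S" for z
  proof -
    have "fst z \<in> rng c" "snd z \<noteq> 0" using that K(2) by auto
    then show ?thesis unfolding qform_def using metric(3)[OF c inv_into_into] by simp
  qed
  have scale: "sqrt (qform c x v) = norm v * ?f (x, v /\<^sub>R norm v)" if "x \<in> K" "v \<noteq> 0" for x v
  proof -
    have "qform c x v = (norm v)\<^sup>2 * qform c x (v /\<^sub>R norm v)"
      using qform_scaleR[OF c, of x "norm v" "v /\<^sub>R norm v"] that K(2) by auto
    then show ?thesis by (simp add: real_sqrt_mult)
  qed
  have zero: "qform c x 0 = 0" if "x \<in> K" for x
    using qform_scaleR[OF c, of x 0 0] that K(2) by auto
  show ?thesis
  proof (rule that)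
    show "?f z0 * norm v \<le> sqrt (qform c x v)" if "x \<in> K" for x v
      using z0(2)[of "(x, v /\<^sub>R norm v)"] scale[OF that, of v] that zero
      by (cases "v = 0") (auto simp: mult.commute[of "norm v"] intro!: mult_right_mono)
    show "sqrt (qform c x v) \<le> ?f z1 * norm v" if "x \<in> K" for x v
      using z1(2)[of "(x, v /\<^sub>R norm v)"] scale[OF that, of v] that zero
      by (cases "v = 0") (auto simp: mult.commute[of "norm v"] intro!: mult_right_mono)
  qed (use z0 z1 pos in auto)
qed

section \<open>Velocity and speed in a chart\<close>

lemma smooth_path_local:
  assumes "smooth_path X A \<gamma>" "c \<in> A" "t \<in> {0..1}" "\<gamma> t \<in> fst c"
  obtains N h where "open N" "t \<in> N" "\<And>k. curve_C k h N"
    "\<And>s. s \<in> N \<Longrightarrow> s \<in> {0..1} \<Longrightarrow> \<gamma> s \<in> fst c \<and> snd c (\<gamma> s) = h s"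
  using assms unfolding smooth_path_def by (metis (no_types, lifting) IntI smooth_on_iff_curve_C)

lemma smooth_pathI:
  assumes "pathin X \<gamma>" "\<not> \<gamma> constant_on {0..1}"
    and "\<And>c t. c \<in> A \<Longrightarrow> t \<in> {0..1} \<Longrightarrow> \<gamma> t \<in> fst c \<Longrightarrow>
      \<exists>N h. open N \<and> t \<in> N \<and> (\<forall>k. curve_C k h N) \<and>
        (\<forall>s\<in>N. s \<in> {0..1} \<longrightarrow> \<gamma> s \<in> fst c \<and> snd c (\<gamma> s) = h s)"
  shows "smooth_path X A \<gamma>"
  unfolding smooth_path_def
proof (intro conjI ballI impI assms(1,2))
  fix c t assume "c \<in> A" "t \<in> {0..1::real}" "\<gamma> t \<in> fst c"
  from assms(3)[OF this] obtain N h where "open N" "t \<in> N" "\<forall>k. curve_C k h N"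
    "\<forall>s\<in>N. s \<in> {0..1} \<longrightarrow> \<gamma> s \<in> fst c \<and> snd c (\<gamma> s) = h s" by blast
  then show "\<exists>N h. open N \<and> t \<in> N \<and> smooth_on h N \<and>
      (\<forall>s\<in>N \<inter> {0..1}. \<gamma> s \<in> fst c \<and> snd c (\<gamma> s) = h s)"
    by (intro exI[of _ N] exI[of _ h]) (auto simp: smooth_on_iff_curve_C)
qed

text \<open>At the parameters 0 and 1 the derivative is one-sided, yet the smooth extension
  \<open>h\<close> determines it, since the unit interval has no isolated points.\<close>

lemma vector_derivative_local:
  assumes "open N" "t \<in> N" "t \<in> {0..1}" "(h has_vector_derivative v) (at t)"
    and "\<And>s. s \<in> N \<Longrightarrow> s \<in> {0..1} \<Longrightarrow> k s = h s"
  shows "vector_derivative k (at t within {0..1}) = v"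
proof -
  obtain d where d: "0 < d" "ball t d \<subseteq> N" using assms(1,2) openE by blast
  have "(h has_vector_derivative v) (at t within {0..1})"
    using assms(4) by (rule has_vector_derivative_at_within)
  then have "(k has_vector_derivative v) (at t within {0..1})"
  proof (rule has_vector_derivative_transform_within)
    show "0 < d" by fact
    show "h s = k s" if "s \<in> {0..1}" "dist s t < d" for s
    proof -
      have "s \<in> N" using that d(2) by (auto simp: dist_commute subset_iff)
      then show ?thesis using assms(5) that by simp
    qed
  qed (use assms in auto)
  then show ?thesis
    using assms(3) vector_derivative_within_cbox[of 0 1 t k v] by auto
qed

text \<open>The definition of \<open>speed\<close> uses an unspecified chart, called
  \<open>d\<close> in the proof. The chain rule for the transition map expresses the velocity there
  as \<open>D v\<close>, and the transformation law of the metric returns the value for the given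
  chart \<open>c\<close>.\<close>

lemma speed_chart:
  assumes c: "c \<in> A" and t: "t \<in> {0..1}" "\<gamma> t \<in> fst c"
    and N: "open N" "t \<in> N" "(h has_vector_derivative v) (at t)"
      "\<And>s. s \<in> N \<Longrightarrow> s \<in> {0..1} \<Longrightarrow> \<gamma> s \<in> fst c \<and> snd c (\<gamma> s) = h s"
    and pth: "pathin X \<gamma>"
  shows "speed A g \<gamma> t = sqrt (qform c (h t) v)"
proof -
  define d where "d = (SOME d. d \<in> A \<and> \<gamma> t \<in> fst d)"
  have d: "d \<in> A" "\<gamma> t \<in> fst d"
    using someI[of "\<lambda>d. d \<in> A \<and> \<gamma> t \<in> fst d" c] c t by (auto simp: d_def)
  have ht: "snd c (\<gamma> t) = h t" using N(2,4) t by auto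
  have od: "openin (top_of_set {0..1}) {s \<in> {0..1}. \<gamma> s \<in> fst d}"
    using pth openin_dom[OF d(1)] by (auto simp: pathin_def continuous_map_def)
  then obtain M where M: "open M" "{s \<in> {0..1}. \<gamma> s \<in> fst d} = {0..1} \<inter> M"
    by (auto simp: openin_open)
  define D where "D = frechet_derivative (transition c d) (at (h t))"
  have "Ck_on (Suc 0) (transition c d) (snd c ` (fst c \<inter> fst d))"
    using smooth_transition[OF c d(1)] unfolding smooth_on_def by blast
  moreover have "h t \<in> snd c ` (fst c \<inter> fst d)" using t(2) d(2) ht by (metis IntI imageI)
  ultimately have "transition c d differentiable at (h t)" unfolding Ck_on.simps by blast
  then have tD: "(transition c d has_derivative D) (at (h t))"
    unfolding D_def by (simp add: frechet_derivative_works[symmetric])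
  have "((transition c d \<circ> h) has_derivative D \<circ> (\<lambda>x. x *\<^sub>R v)) (at t)"
    using N(3)[unfolded has_vector_derivative_def] tD by (rule diff_chain_at)
  moreover have "D \<circ> (\<lambda>x. x *\<^sub>R v) = (\<lambda>x. x *\<^sub>R D v)"
    using has_derivative_linear[OF tD] by (auto simp: linear_cmul)
  ultimately have hv: "((transition c d \<circ> h) has_vector_derivative D v) (at t)"
    by (simp add: has_vector_derivative_def)
  have "vector_derivative (snd d \<circ> \<gamma>) (at t within {0..1}) = D v"
  proof (rule vector_derivative_local[OF _ _ t(1) hv])
    show "open (N \<inter> M)" using N M by auto
    show "t \<in> N \<inter> M" using N M t d by auto
    fix s assume s: "s \<in> N \<inter> M" "s \<in> {0..1}"
    then have "\<gamma> s \<in> fst c" "snd c (\<gamma> s) = h s" using N(4) by auto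
    then show "(snd d \<circ> \<gamma>) s = (transition c d \<circ> h) s"
      using crd_inv_crd[OF c, of "\<gamma> s"] by (simp add: transition_def)
  qed
  then have "speed A g \<gamma> t = sqrt (g d (\<gamma> t) (D v) (D v))"
    by (simp add: speed_def Let_def d_def[symmetric])
  also have "g d (\<gamma> t) (D v) (D v) = g c (\<gamma> t) v v"
  proof -
    have "g c p u w = g d p (frechet_derivative (transition c d) (at (snd c p)) u)
        (frechet_derivative (transition c d) (at (snd c p)) w)" if "p \<in> fst c \<inter> fst d" for p u w
      using riemannian c d(1) that unfolding riemannian_surface_def riemannian_metric_def by blast
    from this[of "\<gamma> t" v v] show ?thesis
      using t(2) d(2) unfolding ht D_def by simp
  qed
  also have "\<dots> = qform c (h t) v"
    using ht crd_inv_crd[OF c t(2)] by (simp add: qform_def)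
  finally show ?thesis .
qed

lemma smooth_path_speed:
  assumes s: "smooth_path X A \<gamma>" and c: "c \<in> A" and t: "t \<in> {0..1}" "\<gamma> t \<in> fst c"
  obtains N h h' where "open N" "t \<in> N" "\<And>k. curve_C k h N" "continuous_on N h'" "h ` (N \<inter> {0..1}) \<subseteq> rng c"
    "\<And>s. s \<in> N \<Longrightarrow> (h has_vector_derivative h' s) (at s)"
    "\<And>s. s \<in> N \<Longrightarrow> s \<in> {0..1} \<Longrightarrow> \<gamma> s \<in> fst c \<and> snd c (\<gamma> s) = h s"
    "\<And>s. s \<in> N \<Longrightarrow> s \<in> {0..1} \<Longrightarrow> speed A g \<gamma> s = sqrt (qform c (h s) (h' s))"
proof -
  obtain N h where N: "open N" "t \<in> N" "\<And>k. curve_C k h N"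
    "\<And>s. s \<in> N \<Longrightarrow> s \<in> {0..1} \<Longrightarrow> \<gamma> s \<in> fst c \<and> snd c (\<gamma> s) = h s"
    using smooth_path_local[OF s c t] by blast
  obtain h' where h': "\<And>s. s \<in> N \<Longrightarrow> (h has_vector_derivative h' s) (at s)" "continuous_on N h'"
    using N(3)[of "Suc 0"] by auto
  have "pathin X \<gamma>" using s by (simp add: smooth_path_def)
  then have sp: "speed A g \<gamma> s = sqrt (qform c (h s) (h' s))" if "s \<in> N" "s \<in> {0..1}" for s
    using speed_chart[OF c that(2) _ N(1) that(1) h'(1)[OF that(1)] N(4)] N(4)[OF that] by blast
  have im: "h ` (N \<inter> {0..1}) \<subseteq> rng c"
  proof
    fix y assume "y \<in> h ` (N \<inter> {0..1})"
    then obtain s where "s \<in> N" "s \<in> {0..1}" "y = h s" by auto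
    with N(4)[of s] show "y \<in> rng c" by (metis imageI)
  qed
  show ?thesis by (rule that[OF N(1,2,3) h'(2) im h'(1) N(4) sp])
qed

lemma continuous_on_speed:
  assumes s: "smooth_path X A \<gamma>"
  shows "continuous_on {0..1} (speed A g \<gamma>)"
  unfolding continuous_on_eq_continuous_within
proof
  fix t :: real assume t: "t \<in> {0..1}"
  have "\<gamma> t \<in> topspace X"
    using s t by (auto simp: smooth_path_def pathin_def continuous_map_def)
  then obtain c where c: "c \<in> A" "\<gamma> t \<in> fst c" by (rule chart_at)
  obtain N h h' where N: "open N" "t \<in> N" "\<And>k. curve_C k h N" "continuous_on N h'" "h ` (N \<inter> {0..1}) \<subseteq> rng c"
    "\<And>s. s \<in> N \<Longrightarrow> s \<in> {0..1} \<Longrightarrow> speed A g \<gamma> s = sqrt (qform c (h s) (h' s))"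
    using smooth_path_speed[OF s c(1) t c(2)] by metis
  have "continuous_on N h" using N(3)[of 0] by simp
  then have "continuous_on (N \<inter> {0..1}) (\<lambda>s. sqrt (qform c (h s) (h' s)))"
    using N(4,5) by (intro continuous_intros continuous_on_qform[OF c(1)]) (auto intro: continuous_on_subset)
  then have "continuous_on (N \<inter> {0..1}) (speed A g \<gamma>)"
    using N(6) by (subst continuous_on_cong[OF refl]) auto
  then have "continuous (at t within N \<inter> {0..1}) (speed A g \<gamma>)"
    using N(2) t by (simp add: continuous_on_eq_continuous_within)
  then show "continuous (at t within {0..1}) (speed A g \<gamma>)"
    using at_within_nhd[of t N "N \<inter> {0..1}" "{0..1}"] N(1,2) by (simp add: Int_ac)
qed

end

section \<open>Smooth paths and their length\<close>

context surface
begin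

lemma speed_nonneg:
  assumes s: "smooth_path X A \<gamma>" and t: "t \<in> {0..1}"
  shows "0 \<le> speed A g \<gamma> t"
proof -
  have "\<gamma> t \<in> topspace X"
    using s t by (auto simp: smooth_path_def pathin_def continuous_map_def)
  then obtain c where c: "c \<in> A" "\<gamma> t \<in> fst c" by (rule chart_at)
  obtain N h h' where N: "t \<in> N" "h ` (N \<inter> {0..1}) \<subseteq> rng c"
    "\<And>s. s \<in> N \<Longrightarrow> s \<in> {0..1} \<Longrightarrow> speed A g \<gamma> s = sqrt (qform c (h s) (h' s))"
    using smooth_path_speed[OF s c(1) t c(2)] by metis
  have "h t \<in> rng c" using N t by auto
  then have "0 \<le> qform c (h t) (h' t)"
    unfolding qform_def by (intro metric_nonneg c(1) inv_into_into)
  then show ?thesis using N(3)[OF N(1) t] by simp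
qed

lemma speed_integrable:
  assumes "smooth_path X A \<gamma>" "0 \<le> a" "b \<le> 1"
  shows "speed A g \<gamma> integrable_on {a..b}"
  using continuous_on_subset[OF continuous_on_speed[OF assms(1)], of "{a..b}"] assms
  by (intro integrable_continuous_real) auto

lemma integral_speed_nonneg:
  assumes "smooth_path X A \<gamma>" "0 \<le> a" "b \<le> 1"
  shows "0 \<le> integral {a..b} (speed A g \<gamma>)"
  using assms by (intro integral_nonneg speed_integrable speed_nonneg) auto

lemma path_len_nonneg: "smooth_path X A \<gamma> \<Longrightarrow> 0 \<le> path_len A g \<gamma>"
  unfolding path_len_def by (rule integral_speed_nonneg) auto

lemma pathin_compose_chart:
  assumes c: "c \<in> A" and P: "continuous_on {0..1} P" "P ` {0..1} \<subseteq> rng c"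
  shows "pathin X (\<lambda>t. crd_inv c (P t))"
proof -
  have "continuous_map (top_of_set {0..1}) (top_of_set (rng c)) P"
    using P by (auto simp: continuous_map_in_subtopology)
  from continuous_map_compose[OF this continuous_map_crd_inv[OF c]]
  show ?thesis by (simp add: pathin_def o_def)
qed

text \<open>In a further chart \<open>d\<close> the curve is represented by
  \<open>transition c d\<close> after \<open>P\<close>, on the open set of parameters that
  \<open>P\<close> sends into the overlap of the two charts.\<close>

lemma smooth_path_chart:
  assumes c: "c \<in> A" and P: "\<And>k. curve_C k P UNIV" "P ` {0..1} \<subseteq> rng c"
    and nc: "\<not> P constant_on {0..1}"
  shows "smooth_path X A (\<lambda>t. crd_inv c (P t))"
proof (rule smooth_pathI)
  have cP: "continuous_on UNIV P" using P(1)[of 0] by simp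
  show "pathin X (\<lambda>t. crd_inv c (P t))"
    using c continuous_on_subset[OF cP] P(2) by (intro pathin_compose_chart) auto
  have crd: "snd c (crd_inv c (P t)) = P t" if "t \<in> {0..1}" for t
    using P(2) that by (intro f_inv_into_f) auto
  show "\<not> (\<lambda>t. crd_inv c (P t)) constant_on {0..1}"
    using nc crd unfolding constant_on_def by metis
  fix d t assume d: "d \<in> A" and t: "t \<in> {0..1}" "crd_inv c (P t) \<in> fst d"
  define R where "R = snd c ` (fst c \<inter> fst d)"
  have oR: "open R" unfolding R_def using open_chart_image[OF c openin_dom[OF d]] .
  define N where "N = P -` R"
  have "open N" unfolding N_def by (rule open_vimage[OF oR cP])
  moreover have "t \<in> N"
  proof -
    have "crd_inv c (P t) \<in> fst c" using P(2) t(1) by (intro inv_into_into) blast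
    then have "snd c (crd_inv c (P t)) \<in> R" unfolding R_def using t(2) by blast
    then show ?thesis unfolding N_def by (simp only: crd[OF t(1)] vimageI2)
  qed
  moreover have "curve_C k (\<lambda>s. transition c d (P s)) N" for k
  proof (rule curve_C_Ck_on[where S = R and F = "transition c d" and P = P])
    show "Ck_on k (transition c d) R"
      using smooth_transition[OF c d] unfolding smooth_on_def R_def by blast
    show "curve_C k P N" by (rule curve_C_subset[OF P(1)]) simp
  qed (simp add: N_def)
  moreover have "crd_inv c (P s) \<in> fst d \<and> snd d (crd_inv c (P s)) = transition c d (P s)" if sN: "s \<in> N" for s
  proof -
    obtain p where p: "p \<in> fst c" "p \<in> fst d" "P s = snd c p"
      using sN by (auto simp: N_def R_def)
    then show ?thesis using c by (simp add: transition_def)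
  qed
  ultimately show "\<exists>N h. open N \<and> t \<in> N \<and> (\<forall>k. curve_C k h N) \<and>
      (\<forall>s\<in>N. s \<in> {0..1} \<longrightarrow> crd_inv c (P s) \<in> fst d \<and> snd d (crd_inv c (P s)) = h s)"
    by blast
qed

lemma speed_path_chart:
  assumes c: "c \<in> A" and P: "\<And>k. curve_C k P UNIV" "P ` {0..1} \<subseteq> rng c"
    and t: "t \<in> {0..1}" "(P has_vector_derivative v) (at t)"
  shows "speed A g (\<lambda>t. crd_inv c (P t)) t = sqrt (qform c (P t) v)"
proof (rule speed_chart[where N = UNIV, OF c t(1) _ _ _ t(2)])
  have cP: "continuous_on UNIV P" using P(1)[of 0] by simp
  show "pathin X (\<lambda>t. crd_inv c (P t))"
    using c continuous_on_subset[OF cP] P(2) by (intro pathin_compose_chart) auto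
  show "crd_inv c (P s) \<in> fst c \<and> snd c (crd_inv c (P s)) = P s" if "s \<in> {0..1}" for s
  proof -
    have "P s \<in> rng c" using P(2) that by blast
    then show ?thesis by (simp add: inv_into_into f_inv_into_f)
  qed
  then show "crd_inv c (P t) \<in> fst c" using t by blast
qed auto

section \<open>Reparametrization, reversal and joining of paths\<close>

lemma vector_derivative_germ:
  assumes "open N" "t \<in> N" "t \<in> S" "\<And>s. s \<in> N \<Longrightarrow> s \<in> S \<Longrightarrow> f s = h s"
  shows "vector_derivative f (at t within S) = vector_derivative h (at t within S)"
proof -
  obtain d where d: "0 < d" "ball t d \<subseteq> N" using assms(1,2) openE by blast
  have eq: "f s = h s" if "s \<in> S" "dist s t < d" for s
    using that assms(4) d(2) by (auto simp: dist_commute subset_iff)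
  have "(f has_vector_derivative v) (at t within S) \<longleftrightarrow> (h has_vector_derivative v) (at t within S)" for v
    using eq d(1) assms(3) by (metis has_vector_derivative_transform_within)
  then show ?thesis unfolding vector_derivative_def by simp
qed

text \<open>Serves paths glued from two pieces, which agree with each piece on a part of the
  interval only.\<close>

lemma speed_germ:
  assumes "open N" "t \<in> N" "t \<in> {0..1}" "\<And>s. s \<in> N \<Longrightarrow> s \<in> {0..1} \<Longrightarrow> \<gamma> s = \<delta> s"
  shows "speed A g \<gamma> t = speed A g \<delta> t"
proof -
  have "\<gamma> t = \<delta> t" using assms by auto
  moreover have "vector_derivative (f \<circ> \<gamma>) (at t within {0..1}) = vector_derivative (f \<circ> \<delta>) (at t within {0..1})"
    for f :: "'a \<Rightarrow> real^2"
    using assms by (intro vector_derivative_germ[of N]) auto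
  ultimately show ?thesis unfolding speed_def by simp
qed

lemma smooth_path_reparam:
  assumes s: "smooth_path X A \<gamma>" and \<tau>: "\<And>k. curve_C k \<tau> UNIV" "\<tau> ` {0..1} \<subseteq> {0..1}"
    and nc: "\<not> (\<lambda>t. \<gamma> (\<tau> t)) constant_on {0..1}"
  shows "smooth_path X A (\<lambda>t. \<gamma> (\<tau> t))"
proof (rule smooth_pathI)
  have c\<tau>: "continuous_on UNIV \<tau>" using \<tau>(1)[of 0] by simp
  have "continuous_map (top_of_set {0..1}) (top_of_set {0..1}) \<tau>"
    using continuous_on_subset[OF c\<tau>] \<tau>(2) by (auto simp: continuous_map_in_subtopology)
  then show "pathin X (\<lambda>t. \<gamma> (\<tau> t))"
    using s continuous_map_compose unfolding smooth_path_def pathin_def o_def by blast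
  show "\<not> (\<lambda>t. \<gamma> (\<tau> t)) constant_on {0..1}" by fact
  fix c t assume c: "c \<in> A" and t: "t \<in> {0..1}" "\<gamma> (\<tau> t) \<in> fst c"
  have "\<tau> t \<in> {0..1}" using \<tau>(2) t(1) by blast
  obtain N h where N: "open N" "\<tau> t \<in> N" "\<And>k. curve_C k h N"
    "\<And>s. s \<in> N \<Longrightarrow> s \<in> {0..1} \<Longrightarrow> \<gamma> s \<in> fst c \<and> snd c (\<gamma> s) = h s"
    using smooth_path_local[OF s c \<open>\<tau> t \<in> {0..1}\<close> t(2)] by blast
  have "open (\<tau> -` N)" by (rule open_vimage[OF N(1) c\<tau>])
  moreover have "curve_C k (\<lambda>s. h (\<tau> s)) (\<tau> -` N)" for k
    by (rule curve_C_compose[OF _ curve_C_subset[OF \<tau>(1)] N(3)]) auto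
  moreover have "\<gamma> (\<tau> s) \<in> fst c \<and> snd c (\<gamma> (\<tau> s)) = h (\<tau> s)" if "s \<in> \<tau> -` N" "s \<in> {0..1}" for s
    using N(4)[of "\<tau> s"] that \<tau>(2) by blast
  ultimately show "\<exists>N h. open N \<and> t \<in> N \<and> (\<forall>k. curve_C k h N) \<and>
      (\<forall>s\<in>N. s \<in> {0..1} \<longrightarrow> \<gamma> (\<tau> s) \<in> fst c \<and> snd c (\<gamma> (\<tau> s)) = h s)"
    using N(2) by (intro exI[of _ "\<tau> -` N"] exI[of _ "\<lambda>s. h (\<tau> s)"]) blast
qed

lemma speed_reparam:
  assumes s: "smooth_path X A \<gamma>" and \<tau>: "\<And>k. curve_C k \<tau> UNIV" "\<tau> ` {0..1} \<subseteq> {0..1}"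
    and t: "t \<in> {0..1}" "(\<tau> has_real_derivative d) (at t)"
  shows "speed A g (\<lambda>t. \<gamma> (\<tau> t)) t = \<bar>d\<bar> * speed A g \<gamma> (\<tau> t)"
proof -
  have c\<tau>: "continuous_on UNIV \<tau>" using \<tau>(1)[of 0] by simp
  have \<tau>t: "\<tau> t \<in> {0..1}" using \<tau>(2) t(1) by blast
  then have "\<gamma> (\<tau> t) \<in> topspace X"
    using s by (auto simp: smooth_path_def pathin_def continuous_map_def)
  then obtain c where c: "c \<in> A" "\<gamma> (\<tau> t) \<in> fst c" by (rule chart_at)
  obtain N h h' where N: "open N" "\<tau> t \<in> N" "h ` (N \<inter> {0..1}) \<subseteq> rng c"
    "\<And>s. s \<in> N \<Longrightarrow> (h has_vector_derivative h' s) (at s)"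
    "\<And>s. s \<in> N \<Longrightarrow> s \<in> {0..1} \<Longrightarrow> \<gamma> s \<in> fst c \<and> snd c (\<gamma> s) = h s"
    "\<And>s. s \<in> N \<Longrightarrow> s \<in> {0..1} \<Longrightarrow> speed A g \<gamma> s = sqrt (qform c (h s) (h' s))"
    using smooth_path_speed[OF s c(1) \<tau>t c(2)] by metis
  have "continuous_map (top_of_set {0..1}) (top_of_set {0..1}) \<tau>"
    using continuous_on_subset[OF c\<tau>] \<tau>(2) by (auto simp: continuous_map_in_subtopology)
  then have p: "pathin X (\<lambda>t. \<gamma> (\<tau> t))"
    using s continuous_map_compose unfolding smooth_path_def pathin_def o_def by blast
  have "((h \<circ> \<tau>) has_vector_derivative d *\<^sub>R h' (\<tau> t)) (at t)"
    using t(2) N(4)[OF N(2)] by (intro vector_diff_chain_at) (simp_all add: has_real_derivative_iff_has_vector_derivative)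
  then have hv: "((\<lambda>s. h (\<tau> s)) has_vector_derivative d *\<^sub>R h' (\<tau> t)) (at t)" by (simp add: o_def)
  have "speed A g (\<lambda>t. \<gamma> (\<tau> t)) t = sqrt (qform c (h (\<tau> t)) (d *\<^sub>R h' (\<tau> t)))"
  proof (rule speed_chart[OF c(1) t(1) c(2) _ _ hv _ p])
    show "open (\<tau> -` N)" by (rule open_vimage[OF N(1) c\<tau>])
    show "\<gamma> (\<tau> s) \<in> fst c \<and> snd c (\<gamma> (\<tau> s)) = h (\<tau> s)" if "s \<in> \<tau> -` N" "s \<in> {0..1}" for s
      using N(5)[of "\<tau> s"] that \<tau>(2) by blast
  qed (use N(2) in simp)
  moreover have "h (\<tau> t) \<in> rng c" using N(2,3) \<tau>t by auto
  ultimately show ?thesis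
    using N(6)[OF N(2) \<tau>t] by (simp add: qform_scaleR[OF c(1)] real_sqrt_mult)
qed

text \<open>For a nondecreasing \<open>\<tau>\<close> the absolute value in
  \<open>speed_reparam\<close> disappears and the limits of integration stay ordered. The decreasing
  case occurs only in \<open>smooth_path_reverse\<close> and is treated there directly.\<close>

lemma integral_speed_reparam:
  assumes s: "smooth_path X A \<gamma>" and \<tau>: "\<And>k. curve_C k \<tau> UNIV" "\<tau> ` {0..1} \<subseteq> {0..1}"
    and d: "\<And>t. (\<tau> has_real_derivative \<tau>' t) (at t)" "\<And>t. 0 \<le> \<tau>' t"
    and ab: "0 \<le> a" "a \<le> b" "b \<le> 1"
  shows "integral {a..b} (speed A g (\<lambda>t. \<gamma> (\<tau> t))) = integral {\<tau> a..\<tau> b} (speed A g \<gamma>)"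
proof -
  have "\<tau> a \<le> \<tau> b"
    using ab(2) d by (intro DERIV_nonneg_imp_nondecreasing[of a b \<tau>]) blast+
  moreover have "{a..b} \<subseteq> {0..1}" using ab by auto
  then have "\<tau> ` {a..b} \<subseteq> {0..1}" using \<tau>(2) by blast
  ultimately have "((\<lambda>t. \<tau>' t *\<^sub>R speed A g \<gamma> (\<tau> t)) has_integral integral {\<tau> a..\<tau> b} (speed A g \<gamma>)) {a..b}"
    using continuous_on_speed[OF s] d(1) ab(2)
    by (intro has_integral_substitution[where c = 0 and d = 1]) (auto intro: has_field_derivative_at_within)
  then have "((speed A g (\<lambda>t. \<gamma> (\<tau> t))) has_integral integral {\<tau> a..\<tau> b} (speed A g \<gamma>)) {a..b}"
  proof (rule has_integral_eq[rotated])
    fix t assume "t \<in> {a..b}"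
    then have "t \<in> {0..1}" using ab by auto
    then show "\<tau>' t *\<^sub>R speed A g \<gamma> (\<tau> t) = speed A g (\<lambda>t. \<gamma> (\<tau> t)) t"
      using speed_reparam[OF s \<tau> _ d(1), of t] d(2)[of t] by simp
  qed
  then show ?thesis by (rule integral_unique)
qed

lemma smooth_path_reverse:
  assumes s: "smooth_path X A \<gamma>"
  shows "smooth_path X A (\<lambda>t. \<gamma> (1 - t))" "path_len A g (\<lambda>t. \<gamma> (1 - t)) = path_len A g \<gamma>"
proof -
  define \<tau> where "\<tau> t = 1 + (-1) * t" for t :: real
  have \<tau>: "curve_C k \<tau> UNIV" for k unfolding \<tau>_def by (rule curve_C_affine)
  have im: "\<tau> ` {0..1} \<subseteq> {0..1}" by (auto simp: \<tau>_def)
  have eq: "(\<lambda>t. \<gamma> (1 - t)) = (\<lambda>t. \<gamma> (\<tau> t))" by (simp add: \<tau>_def)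
  have nc: "\<not> (\<lambda>t. \<gamma> (\<tau> t)) constant_on {0..1}"
  proof
    assume "(\<lambda>t. \<gamma> (\<tau> t)) constant_on {0..1}"
    then obtain y where y: "\<And>t. t \<in> {0..1} \<Longrightarrow> \<gamma> (\<tau> t) = y" by (auto simp: constant_on_def)
    have "\<gamma> t = y" if "t \<in> {0..1}" for t using y[of "1 - t"] that by (simp add: \<tau>_def)
    then show False using s by (auto simp: smooth_path_def constant_on_def)
  qed
  show "smooth_path X A (\<lambda>t. \<gamma> (1 - t))" unfolding eq by (rule smooth_path_reparam[OF s \<tau> im nc])
  have "speed A g (\<lambda>t. \<gamma> (\<tau> t)) t = speed A g \<gamma> (1 - t)" if "t \<in> {0..1}" for t
  proof -
    have "(\<tau> has_real_derivative -1) (at t)" unfolding \<tau>_def by (auto intro!: derivative_eq_intros)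
    from speed_reparam[OF s \<tau> im that this] show ?thesis by (simp add: \<tau>_def)
  qed
  then have "path_len A g (\<lambda>t. \<gamma> (\<tau> t)) = integral {0..1} (\<lambda>t. speed A g \<gamma> (1 - t))"
    unfolding path_len_def by (intro integral_cong) auto
  also have "\<dots> = path_len A g \<gamma>"
  proof -
    have "((\<lambda>x. speed A g \<gamma> (x)) has_integral path_len A g \<gamma>) {0..1}"
      unfolding path_len_def using speed_integrable[OF s, of 0 1] by (simp add: integrable_integral)
    \<comment> \<open>Affine substitution with factor -1 and shift 1, which maps the unit interval
      onto itself.\<close>
    then have "((\<lambda>x. speed A g \<gamma> ((-1) *\<^sub>R x + 1)) has_integral (1 / (\<bar>-1\<bar> ^ DIM(real))) *\<^sub>R path_len A g \<gamma>)
       ((\<lambda>x. (1 / (-1)) *\<^sub>R x + - ((1 / (-1)) *\<^sub>R 1)) ` cbox 0 1)"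
      by (intro has_integral_affinity) auto
    moreover have "((\<lambda>x. (1 / (-1)) *\<^sub>R x + - ((1 / (-1)) *\<^sub>R 1)) ` cbox 0 1) = {0..1::real}"
    proof -
      have "(\<lambda>x::real. 1 - x) ` {0..1} = {0..1}" by (simp add: image_diff_atLeastAtMost)
      then show ?thesis by simp
    qed
    ultimately have "((\<lambda>x. speed A g \<gamma> (1 - x)) has_integral path_len A g \<gamma>) {0..1}" by simp
    then show ?thesis by (rule integral_unique)
  qed
  finally show "path_len A g (\<lambda>t. \<gamma> (1 - t)) = path_len A g \<gamma>" using eq by simp
qed

text \<open>Both paths are first reparametrized to be constant near the junction, so that no derivatives
  have to be matched there.\<close>

lemma smooth_path_join:
  assumes s1: "smooth_path X A \<gamma>1" and s2: "smooth_path X A \<gamma>2" and j: "\<gamma>1 1 = \<gamma>2 0"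
  obtains \<gamma> where "smooth_path X A \<gamma>" "\<gamma> 0 = \<gamma>1 0" "\<gamma> 1 = \<gamma>2 1"
    "\<gamma> ` {0..1} \<subseteq> \<gamma>1 ` {0..1} \<union> \<gamma>2 ` {0..1}" "path_len A g \<gamma> = path_len A g \<gamma>1 + path_len A g \<gamma>2"
proof -
  obtain \<theta> \<theta>' :: "real \<Rightarrow> real" where \<theta>: "\<And>k. curve_C k \<theta> UNIV"
    "\<And>x. (\<theta> has_real_derivative \<theta>' x) (at x)" "\<And>x. 0 \<le> \<theta>' x"
    "\<And>x. x \<le> 1/3 \<Longrightarrow> \<theta> x = 0" "\<And>x. 2/3 \<le> x \<Longrightarrow> \<theta> x = 1" using smooth_step by blast
  have mono: "\<theta> x \<le> \<theta> y" if "x \<le> y" for x y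
    using that \<theta>(2,3) by (intro DERIV_nonneg_imp_nondecreasing[of x y \<theta>]) blast+
  have \<theta>01: "\<theta> x \<in> {0..1}" for x
    using mono[of x "max x 1"] mono[of "min x 0" x] \<theta>(4)[of "min x 0"] \<theta>(5)[of "max x 1"] by auto
  have c\<theta>: "continuous_on S \<theta>" for S using \<theta>(1)[of 0] continuous_on_subset by auto
  have surj: "\<exists>x\<in>{0..1}. \<theta> x = y" if "y \<in> {0..1}" for y
    using IVT'[of \<theta> 0 y 1] that \<theta>(4)[of 0] \<theta>(5)[of 1] c\<theta> by auto
  \<comment> \<open>\<open>\<tau>1\<close> has reached 1 at the parameter 1/3 and
    \<open>\<tau>2\<close> stays 0 up to 2/3, so both paths rest at the junction during the whole
    middle third. Near each parameter the glued path therefore coincides with \<open>a\<close> or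
    with \<open>b\<close>.\<close>
  define \<tau>1 \<tau>2 where "\<tau>1 t = \<theta> (0 + 2 * t)" and "\<tau>2 t = \<theta> (-1 + 2 * t)" for t
  define a b where "a = (\<lambda>t. \<gamma>1 (\<tau>1 t))" and "b = (\<lambda>t. \<gamma>2 (\<tau>2 t))"
  have C: "curve_C k \<tau>1 UNIV" "curve_C k \<tau>2 UNIV" for k
    unfolding \<tau>1_def \<tau>2_def by (rule curve_C_compose[OF UNIV_I curve_C_affine \<theta>(1)])+
  have im: "\<tau>1 ` {0..1} \<subseteq> {0..1}" "\<tau>2 ` {0..1} \<subseteq> {0..1}"
    unfolding \<tau>1_def \<tau>2_def using \<theta>01 by blast+
  have df: "((\<lambda>t. \<theta> (c + 2 * t)) has_real_derivative \<theta>' (c + 2 * t) * 2) (at t)" for c t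
    by (rule DERIV_chain2[where f = \<theta> and g = "\<lambda>t. c + 2 * t", OF \<theta>(2)]) (auto intro!: derivative_eq_intros)
  have d1: "(\<tau>1 has_real_derivative \<theta>' (0 + 2 * t) * 2) (at t)" "0 \<le> \<theta>' (0 + 2 * t) * 2" for t
    unfolding \<tau>1_def using df[of 0] \<theta>(3) by auto
  have d2: "(\<tau>2 has_real_derivative \<theta>' (-1 + 2 * t) * 2) (at t)" "0 \<le> \<theta>' (-1 + 2 * t) * 2" for t
    unfolding \<tau>2_def using df[of "-1"] \<theta>(3) by auto
  have a_im: "\<exists>t\<in>{0..1/2}. a t = \<gamma>1 u" if u: "u \<in> {0..1}" for u
  proof -
    obtain x where "x \<in> {0..1}" "\<theta> x = u" using surj[OF u] by blast
    then show ?thesis by (intro bexI[of _ "x/2"]) (auto simp: a_def \<tau>1_def)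
  qed
  have b_im: "\<exists>t\<in>{1/2..1}. b t = \<gamma>2 u" if u: "u \<in> {0..1}" for u
  proof -
    obtain x where "x \<in> {0..1}" "\<theta> x = u" using surj[OF u] by blast
    then show ?thesis by (intro bexI[of _ "(x + 1) / 2"]) (auto simp: b_def \<tau>2_def add_divide_distrib)
  qed
  have nca: "\<not> a constant_on {0..1/2}"
  proof
    assume "a constant_on {0..1/2}"
    then have "\<gamma>1 constant_on {0..1}" unfolding constant_on_def using a_im by metis
    then show False using s1 by (simp add: smooth_path_def)
  qed
  have ncb: "\<not> b constant_on {1/2..1}"
  proof
    assume "b constant_on {1/2..1}"
    then have "\<gamma>2 constant_on {0..1}" unfolding constant_on_def using b_im by metis
    then show False using s2 by (simp add: smooth_path_def)
  qed
  have sa: "smooth_path X A a"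
    unfolding a_def by (rule smooth_path_reparam[OF s1 C(1) im(1)])
      (use nca constant_on_subset[of a "{0..1}" "{0..1/2}"] in \<open>auto simp: a_def\<close>)
  have sb: "smooth_path X A b"
    unfolding b_def by (rule smooth_path_reparam[OF s2 C(2) im(2)])
      (use ncb constant_on_subset[of b "{0..1}" "{1/2..1}"] in \<open>auto simp: b_def\<close>)
  define \<gamma> where "\<gamma> t = (if t \<le> 1/2 then a t else b t)" for t
  have ga: "\<gamma> t = a t" if "t < 2/3" for t
    using that \<theta>(5)[of "0 + 2 * t"] \<theta>(4)[of "-1 + 2 * t"] j by (auto simp: \<gamma>_def a_def b_def \<tau>1_def \<tau>2_def)
  have gb: "\<gamma> t = b t" if "1/3 < t" for t
    using that \<theta>(5)[of "0 + 2 * t"] \<theta>(4)[of "-1 + 2 * t"] j by (auto simp: \<gamma>_def a_def b_def \<tau>1_def \<tau>2_def)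
  have pg: "pathin X \<gamma>"
    unfolding pathin_def \<gamma>_def
  proof (rule continuous_map_cases_le)
    show "continuous_map (subtopology (top_of_set {0..1}) {x \<in> topspace (top_of_set {0..1}). x \<le> 1 / 2}) X a"
      using sa by (auto simp: smooth_path_def pathin_def intro: continuous_map_from_subtopology)
    show "continuous_map (subtopology (top_of_set {0..1}) {x \<in> topspace (top_of_set {0..1}). 1 / 2 \<le> x}) X b"
      using sb by (auto simp: smooth_path_def pathin_def intro: continuous_map_from_subtopology)
    show "a x = b x" if "x = 1/2" for x unfolding that using ga[of "1/2"] gb[of "1/2"] by simp
  qed auto
  have sg: "smooth_path X A \<gamma>"
  proof (rule smooth_pathI[OF pg])
    show "\<not> \<gamma> constant_on {0..1}"
    proof
      assume "\<gamma> constant_on {0..1}"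
      then have "\<gamma> constant_on {0..1/2}" by (rule constant_on_subset) auto
      then have "a constant_on {0..1/2}" unfolding constant_on_def using ga by auto
      then show False using nca by simp
    qed
    fix c t assume c: "c \<in> A" and t: "t \<in> {0..1}" "\<gamma> t \<in> fst c"
    show "\<exists>N h. open N \<and> t \<in> N \<and> (\<forall>k. curve_C k h N) \<and>
        (\<forall>s\<in>N. s \<in> {0..1} \<longrightarrow> \<gamma> s \<in> fst c \<and> snd c (\<gamma> s) = h s)"
    proof (cases "t < 2/3")
      case True
      then have "a t \<in> fst c" using t ga by simp
      then obtain N h where N: "open N" "t \<in> N" "\<And>k. curve_C k h N"
        "\<And>s. s \<in> N \<Longrightarrow> s \<in> {0..1} \<Longrightarrow> a s \<in> fst c \<and> snd c (a s) = h s"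
        using smooth_path_local[OF sa c t(1)] by blast
      show ?thesis
      proof (intro exI[of _ "N \<inter> {..<2/3}"] exI[of _ h] conjI allI ballI impI)
        show "curve_C k h (N \<inter> {..<2/3})" for k using curve_C_subset[OF N(3)] by blast
      qed (use N True ga in auto)
    next
      case False
      then have "b t \<in> fst c" using t gb[of t] by simp
      then obtain N h where N: "open N" "t \<in> N" "\<And>k. curve_C k h N"
        "\<And>s. s \<in> N \<Longrightarrow> s \<in> {0..1} \<Longrightarrow> b s \<in> fst c \<and> snd c (b s) = h s"
        using smooth_path_local[OF sb c t(1)] by blast
      show ?thesis
      proof (intro exI[of _ "N \<inter> {1/3<..}"] exI[of _ h] conjI allI ballI impI)
        show "curve_C k h (N \<inter> {1/3<..})" for k using curve_C_subset[OF N(3)] by blast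
      qed (use N False gb in auto)
    qed
  qed
  have spa: "speed A g \<gamma> t = speed A g a t" if "t \<in> {0..1/2}" for t
    by (rule speed_germ[of "{..<2/3}"]) (use that ga in auto)
  have spb: "speed A g \<gamma> t = speed A g b t" if "t \<in> {1/2..1}" for t
    by (rule speed_germ[of "{1/3<..}"]) (use that gb in auto)
  have "path_len A g \<gamma> = integral {0..1/2} (speed A g \<gamma>) + integral {1/2..1} (speed A g \<gamma>)"
    unfolding path_len_def using Henstock_Kurzweil_Integration.integral_combine[where a = 0 and c = "1/2" and b = 1 and f = "speed A g \<gamma>"] speed_integrable[OF sg, of 0 1] by simp
  also have "integral {0..1/2} (speed A g \<gamma>) = integral {0..1/2} (speed A g a)"
    using spa by (intro integral_cong) auto
  also have "\<dots> = integral {\<tau>1 0..\<tau>1 (1/2)} (speed A g \<gamma>1)"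
    unfolding a_def by (rule integral_speed_reparam[OF s1 C(1) im(1) d1]) auto
  also have "\<dots> = path_len A g \<gamma>1"
    using \<theta>(4)[of 0] \<theta>(5)[of 1] by (simp add: \<tau>1_def path_len_def)
  also have "integral {1/2..1} (speed A g \<gamma>) = integral {1/2..1} (speed A g b)"
    using spb by (intro integral_cong) auto
  also have "\<dots> = integral {\<tau>2 (1/2)..\<tau>2 1} (speed A g \<gamma>2)"
    unfolding b_def by (rule integral_speed_reparam[OF s2 C(2) im(2) d2]) auto
  also have "\<dots> = path_len A g \<gamma>2"
    using \<theta>(4)[of 0] \<theta>(5)[of 1] by (simp add: \<tau>2_def path_len_def)
  finally have len: "path_len A g \<gamma> = path_len A g \<gamma>1 + path_len A g \<gamma>2" .
  show ?thesis
  proof (rule that[OF sg _ _ _ len])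
    show "\<gamma> 0 = \<gamma>1 0" using ga[of 0] \<theta>(4)[of 0] by (simp add: a_def \<tau>1_def)
    show "\<gamma> 1 = \<gamma>2 1" using gb[of 1] \<theta>(5)[of 1] by (simp add: b_def \<tau>2_def)
    show "\<gamma> ` {0..1} \<subseteq> \<gamma>1 ` {0..1} \<union> \<gamma>2 ` {0..1}"
      using im by (auto simp: \<gamma>_def a_def b_def)
  qed
qed

end

section \<open>The length distance in an open set\<close>

context surface
begin

text \<open>\<open>interior_dist\<close> with an arbitrary \<open>W\<close> in place of the manifold
  interior, which separates the facts about length from those about submanifolds. The value is
  infinite if no path exists.\<close>

definition dist_in :: "'a set \<Rightarrow> 'a \<Rightarrow> 'a \<Rightarrow> ennreal" where
  "dist_in W x y = (INF \<gamma> \<in> {\<gamma>. smooth_path X A \<gamma> \<and> \<gamma> ` {0..1} \<subseteq> W \<and> \<gamma> 0 = x \<and> \<gamma> 1 = y}.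
     ennreal (path_len A g \<gamma>))"

lemma dist_in_le:
  assumes "smooth_path X A \<gamma>" "\<gamma> ` {0..1} \<subseteq> W"
  shows "dist_in W (\<gamma> 0) (\<gamma> 1) \<le> ennreal (path_len A g \<gamma>)"
  unfolding dist_in_def using assms by (intro INF_lower) auto

lemma dist_in_lessE:
  assumes "dist_in W x y < L"
  obtains \<gamma> where "smooth_path X A \<gamma>" "\<gamma> ` {0..1} \<subseteq> W" "\<gamma> 0 = x" "\<gamma> 1 = y"
    "ennreal (path_len A g \<gamma>) < L"
  using assms unfolding dist_in_def INF_less_iff by blast

lemma dist_in_sym: "dist_in W x y = dist_in W y x"
proof -
  have "dist_in W x y \<le> dist_in W y x" for x y
    unfolding dist_in_def[of W y x]
  proof (rule INF_greatest)
    fix \<gamma> assume "\<gamma> \<in> {\<gamma>. smooth_path X A \<gamma> \<and> \<gamma> ` {0..1} \<subseteq> W \<and> \<gamma> 0 = y \<and> \<gamma> 1 = x}"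
    then have s: "smooth_path X A \<gamma>" "\<gamma> ` {0..1} \<subseteq> W" "\<gamma> 0 = y" "\<gamma> 1 = x" by auto
    have "(\<lambda>t. \<gamma> (1 - t)) ` {0..1} \<subseteq> \<gamma> ` {0..1}" by auto
    then have "(\<lambda>t. \<gamma> (1 - t)) ` {0..1} \<subseteq> W" using s(2) by blast
    from dist_in_le[OF smooth_path_reverse(1)[OF s(1)] this]
    show "dist_in W x y \<le> ennreal (path_len A g \<gamma>)"
      using s smooth_path_reverse(2)[OF s(1)] by simp
  qed
  then show ?thesis by (simp add: antisym)
qed

lemma dist_in_triangle: "dist_in W x z \<le> dist_in W x y + dist_in W y z"
proof (rule ennreal_le_epsilon)
  fix e :: real
  assume fin: "dist_in W x y + dist_in W y z < top" and e: "0 < e"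
  have e2: "d < d + ennreal (e/2)" if "d < top" for d
    using that e by (cases d rule: ennreal_cases) (auto simp: ennreal_plus[symmetric] ennreal_less_iff simp del: ennreal_plus)
  have fin: "dist_in W x y < top" "dist_in W y z < top"
    by (rule le_less_trans[OF _ fin]; simp add: add_increasing add_increasing2)+
  obtain \<gamma>1 where g1: "smooth_path X A \<gamma>1" "\<gamma>1 ` {0..1} \<subseteq> W" "\<gamma>1 0 = x" "\<gamma>1 1 = y"
    "ennreal (path_len A g \<gamma>1) < dist_in W x y + ennreal (e/2)"
    by (rule dist_in_lessE[OF e2[OF fin(1)]])
  obtain \<gamma>2 where g2: "smooth_path X A \<gamma>2" "\<gamma>2 ` {0..1} \<subseteq> W" "\<gamma>2 0 = y" "\<gamma>2 1 = z"
    "ennreal (path_len A g \<gamma>2) < dist_in W y z + ennreal (e/2)"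
    by (rule dist_in_lessE[OF e2[OF fin(2)]])
  have "\<gamma>1 1 = \<gamma>2 0" using g1 g2 by simp
  then obtain \<gamma> where \<gamma>: "smooth_path X A \<gamma>" "\<gamma> 0 = \<gamma>1 0" "\<gamma> 1 = \<gamma>2 1"
    "\<gamma> ` {0..1} \<subseteq> \<gamma>1 ` {0..1} \<union> \<gamma>2 ` {0..1}" "path_len A g \<gamma> = path_len A g \<gamma>1 + path_len A g \<gamma>2"
    by (rule smooth_path_join[OF g1(1) g2(1)])
  have "\<gamma> ` {0..1} \<subseteq> W" using \<gamma>(4) g1 g2 by blast
  from dist_in_le[OF \<gamma>(1) this] have "dist_in W x z \<le> ennreal (path_len A g \<gamma>1 + path_len A g \<gamma>2)"
    using \<gamma> g1 g2 by simp
  also have "\<dots> = ennreal (path_len A g \<gamma>1) + ennreal (path_len A g \<gamma>2)"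
    using path_len_nonneg g1 g2 by (simp add: ennreal_plus)
  also have "\<dots> \<le> (dist_in W x y + ennreal (e/2)) + (dist_in W y z + ennreal (e/2))"
    using g1(5) g2(5) by (intro add_mono less_imp_le)
  also have "\<dots> = dist_in W x y + dist_in W y z + (ennreal (e/2) + ennreal (e/2))"
    by (simp add: add_ac)
  also have "ennreal (e/2) + ennreal (e/2) = ennreal e"
    using e by (subst ennreal_plus[symmetric]) auto
  finally show "dist_in W x z \<le> dist_in W x y + dist_in W y z + ennreal e" by simp
qed

section \<open>Upper bounds by explicit arcs, lower bounds by escape from a coordinate ball\<close>

lemma ellipse_arc_speed_bound:
  "norm (ellipse_arc 0 (\<beta> *\<^sub>R w) (- \<beta> *\<^sub>R v) \<alpha> \<beta> t) \<le> \<bar>\<beta>\<bar> * (norm v + norm w)"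
proof -
  have "norm (ellipse_arc 0 (\<beta> *\<^sub>R w) (- \<beta> *\<^sub>R v) \<alpha> \<beta> t)
    \<le> \<bar>cos (\<alpha> + \<beta> * t)\<bar> * (\<bar>\<beta>\<bar> * norm w) + \<bar>sin (\<alpha> + \<beta> * t)\<bar> * (\<bar>\<beta>\<bar> * norm v)"
    using norm_triangle_ineq[of "cos (\<alpha> + \<beta> * t) *\<^sub>R \<beta> *\<^sub>R w" "sin (\<alpha> + \<beta> * t) *\<^sub>R (- \<beta>) *\<^sub>R v"]
    by (simp add: ellipse_arc_def abs_mult mult.assoc)
  also have "\<dots> \<le> 1 * (\<bar>\<beta>\<bar> * norm w) + 1 * (\<bar>\<beta>\<bar> * norm v)"
    by (intro add_mono mult_right_mono) auto
  finally show ?thesis by (simp add: algebra_simps)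
qed

lemma ellipse_arc_path:
  assumes c: "c \<in> A" and C: "\<And>x v. x \<in> K \<Longrightarrow> sqrt (qform c x v) \<le> C * norm v" "0 \<le> C" "K \<subseteq> rng c"
    and P: "ellipse_arc m v w \<alpha> \<beta> ` {0..1} \<subseteq> K" "\<not> ellipse_arc m v w \<alpha> \<beta> constant_on {0..1}"
  shows "smooth_path X A (\<lambda>t. crd_inv c (ellipse_arc m v w \<alpha> \<beta> t))"
    "path_len A g (\<lambda>t. crd_inv c (ellipse_arc m v w \<alpha> \<beta> t)) \<le> C * (\<bar>\<beta>\<bar> * (norm v + norm w))"
proof -
  let ?P = "ellipse_arc m v w \<alpha> \<beta>"
  have r: "?P ` {0..1} \<subseteq> rng c" using P(1) C(3) by blast
  show s: "smooth_path X A (\<lambda>t. crd_inv c (?P t))"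
    by (rule smooth_path_chart[OF c curve_C_ellipse_arc r P(2)])
  have "speed A g (\<lambda>t. crd_inv c (?P t)) t \<le> C * (\<bar>\<beta>\<bar> * (norm v + norm w))" if t: "t \<in> {0..1}" for t
  proof -
    have "speed A g (\<lambda>t. crd_inv c (?P t)) t = sqrt (qform c (?P t) (ellipse_arc 0 (\<beta> *\<^sub>R w) (- \<beta> *\<^sub>R v) \<alpha> \<beta> t))"
      by (rule speed_path_chart[OF c curve_C_ellipse_arc r t ellipse_arc_deriv])
    also have "\<dots> \<le> C * norm (ellipse_arc 0 (\<beta> *\<^sub>R w) (- \<beta> *\<^sub>R v) \<alpha> \<beta> t)"
      using P(1) t by (intro C(1)) blast
    also have "\<dots> \<le> C * (\<bar>\<beta>\<bar> * (norm v + norm w))"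
      by (intro mult_left_mono ellipse_arc_speed_bound C(2))
    finally show ?thesis .
  qed
  then have "integral {0..1} (speed A g (\<lambda>t. crd_inv c (?P t))) \<le> integral {0..1::real} (\<lambda>_. C * (\<bar>\<beta>\<bar> * (norm v + norm w)))"
    by (intro integral_le speed_integrable[OF s]) auto
  then show "path_len A g (\<lambda>t. crd_inv c (?P t)) \<le> C * (\<bar>\<beta>\<bar> * (norm v + norm w))"
    by (simp add: path_len_def)
qed

text \<open>Constant paths being excluded, the length \<open>0\<close> is only an infimum, over small loops.\<close>

lemma dist_in_self:
  assumes W: "openin X W" "x \<in> W"
  shows "dist_in W x x = 0"
proof -
  have "x \<in> topspace X" using W openin_subset by blast
  then obtain c where c: "c \<in> A" "x \<in> fst c" by (rule chart_at)
  define O' where "O' = snd c ` (fst c \<inter> W)"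
  have "open O'" unfolding O'_def by (rule open_chart_image[OF c(1) W(1)])
  moreover have xO: "snd c x \<in> O'" using c W by (auto simp: O'_def)
  ultimately obtain \<epsilon> where \<epsilon>: "0 < \<epsilon>" "cball (snd c x) \<epsilon> \<subseteq> O'" using open_contains_cball by blast
  define K where "K = cball (snd c x) \<epsilon>"
  have K: "compact K" "K \<subseteq> rng c" "K \<noteq> {}" using \<epsilon> by (auto simp: K_def O'_def)
  obtain \<kappa> C where C: "0 < C" "\<And>x v. x \<in> K \<Longrightarrow> sqrt (qform c x v) \<le> C * norm v"
    using qform_bounds[OF c(1) K] by metis
  have "dist_in W x x \<le> ennreal e" if e: "0 < e" for e
  proof -
    \<comment> \<open>The loop is a coordinate circle of radius \<open>\<delta>\<close> through the
      point. Its diameter \<open>2 * \<delta>\<close> keeps it in \<open>K\<close>, and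
      \<open>ellipse_arc_path\<close> bounds its length by
      \<open>C * (2 * pi * (\<delta> + \<delta>))\<close>.\<close>
    define \<delta> where "\<delta> = min (\<epsilon> / 2) (e / (C * (2 * pi * 2)))"
    have \<delta>: "0 < \<delta>" "2 * \<delta> \<le> \<epsilon>" "C * (2 * pi * (\<delta> + \<delta>)) \<le> e"
      using \<epsilon> e C(1) by (auto simp: \<delta>_def min_def field_simps)
    define v w :: "real^2" where "v = \<delta> *\<^sub>R axis 1 1" and "w = \<delta> *\<^sub>R axis 2 1"
    have vw: "norm v = \<delta>" "norm w = \<delta>" using \<delta> by (simp_all add: v_def w_def norm_axis_1)
    define m where "m = snd c x - v"
    let ?P = "ellipse_arc m v w 0 (2 * pi)"
    have P01: "?P 0 = snd c x" "?P 1 = snd c x" by (simp_all add: ellipse_arc_def m_def)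
    have "?P (1/2) = snd c x - 2 *\<^sub>R v" by (simp add: ellipse_arc_def m_def scaleR_2)
    then have "?P (1/2) \<noteq> ?P 0" using P01 vw \<delta> by auto
    then have nc: "\<not> ?P constant_on {0..1}" by (force simp: constant_on_def)
    have im: "?P ` {0..1} \<subseteq> K"
    proof
      fix y assume "y \<in> ?P ` {0..1}"
      then obtain t where t: "y = ?P t" by auto
      have "?P t - snd c x = cos (2 * pi * t) *\<^sub>R v + sin (2 * pi * t) *\<^sub>R w - v"
        by (simp add: ellipse_arc_def m_def)
      also have "cos (2 * pi * t) *\<^sub>R v + sin (2 * pi * t) *\<^sub>R w = \<delta> *\<^sub>R vector [cos (2 * pi * t), sin (2 * pi * t)]"
        by (simp add: vec2_eq_iff v_def w_def axis_def)
      finally have "norm (?P t - snd c x) \<le> norm (\<delta> *\<^sub>R (vector [cos (2 * pi * t), sin (2 * pi * t)] :: real^2)) + norm v"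
        by (simp only: norm_triangle_ineq4)
      also have "\<dots> = 2 * \<delta>" using \<delta> vw by (simp add: norm_vector_2)
      finally show "y \<in> K" using \<delta> t by (simp add: K_def dist_norm norm_minus_commute)
    qed
    note p = ellipse_arc_path[OF c(1) C(2) less_imp_le[OF C(1)] K(2) im nc]
    have inW: "crd_inv c y \<in> W" if "y \<in> O'" for y
      using that c(1) by (auto simp: O'_def)
    have "(\<lambda>t. crd_inv c (?P t)) ` {0..1} \<subseteq> W"
      using im \<epsilon>(2) inW unfolding K_def by blast
    from dist_in_le[OF p(1) this] have "dist_in W x x \<le> ennreal (path_len A g (\<lambda>t. crd_inv c (?P t)))"
      unfolding P01 using c by simp
    also have "\<dots> \<le> ennreal e"
      using p(2) \<delta>(3) vw by (intro ennreal_leI) simp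
    finally show ?thesis .
  qed
  then show ?thesis
    by (metis (no_types, lifting) ennreal_le_epsilon add.left_neutral le_zero_eq)
qed

text \<open>A constant arc is not an admissible path; in this case \<open>dist_in_self\<close>
  supplies the bound, for which \<open>W\<close> is assumed to be open.\<close>

lemma dist_in_ellipse_arc:
  assumes c: "c \<in> A" and C: "\<And>x v. x \<in> K \<Longrightarrow> sqrt (qform c x v) \<le> C * norm v" "0 \<le> C" "K \<subseteq> rng c"
    and W: "openin X W"
    and P: "\<And>t. t \<in> {0..1} \<Longrightarrow> ellipse_arc m v w \<alpha> \<beta> t \<in> K \<and> crd_inv c (ellipse_arc m v w \<alpha> \<beta> t) \<in> W"
  shows "dist_in W (crd_inv c (ellipse_arc m v w \<alpha> \<beta> 0)) (crd_inv c (ellipse_arc m v w \<alpha> \<beta> 1))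
    \<le> ennreal (C * (\<bar>\<beta>\<bar> * (norm v + norm w)))"
proof (cases "ellipse_arc m v w \<alpha> \<beta> constant_on {0..1}")
  case True
  then have "ellipse_arc m v w \<alpha> \<beta> 0 = ellipse_arc m v w \<alpha> \<beta> 1" by (auto simp: constant_on_def)
  then show ?thesis using dist_in_self[OF W, of "crd_inv c (ellipse_arc m v w \<alpha> \<beta> 1)"] P[of 1] by simp
next
  case False
  have im: "ellipse_arc m v w \<alpha> \<beta> ` {0..1} \<subseteq> K" using P by blast
  note p = ellipse_arc_path[OF c C im False]
  have "(\<lambda>t. crd_inv c (ellipse_arc m v w \<alpha> \<beta> t)) ` {0..1} \<subseteq> W" using P by blast
  from dist_in_le[OF p(1) this] show ?thesis
    using ennreal_leI[OF p(2)] by (rule order_trans)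
qed

lemma dist_in_subpath:
  assumes W: "openin X W" and s: "smooth_path X A \<gamma>" "\<gamma> ` {0..1} \<subseteq> W" and ab: "0 \<le> a" "a \<le> b" "b \<le> 1"
  shows "dist_in W (\<gamma> a) (\<gamma> b) \<le> ennreal (integral {a..b} (speed A g \<gamma>))"
proof -
  define \<tau> where "\<tau> t = a + (b - a) * t" for t
  have \<tau>: "curve_C k \<tau> UNIV" for k unfolding \<tau>_def by (rule curve_C_affine)
  have im: "\<tau> ` {0..1} \<subseteq> {0..1}"
  proof
    fix y assume "y \<in> \<tau> ` {0..1}"
    then obtain t where t: "0 \<le> t" "t \<le> 1" "y = a + (b - a) * t" by (auto simp: \<tau>_def)
    have "(b - a) * t \<le> (b - a) * 1" using t ab by (intro mult_left_mono) auto
    moreover have "0 \<le> (b - a) * t" using t ab by simp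
    ultimately show "y \<in> {0..1}" using t ab by simp
  qed
  have d: "(\<tau> has_real_derivative (b - a)) (at t)" for t
    unfolding \<tau>_def by (auto intro!: derivative_eq_intros)
  have e: "\<tau> 0 = a" "\<tau> 1 = b" by (simp_all add: \<tau>_def)
  show ?thesis
  proof (cases "(\<lambda>t. \<gamma> (\<tau> t)) constant_on {0..1}")
    case True
    then have "\<gamma> (\<tau> 0) = \<gamma> (\<tau> 1)" by (auto simp: constant_on_def)
    then have "\<gamma> a = \<gamma> b" by (simp add: e)
    moreover have "\<gamma> b \<in> W" using s(2) ab by auto
    ultimately show ?thesis using dist_in_self[OF W] by simp
  next
    case False
    have sp: "smooth_path X A (\<lambda>t. \<gamma> (\<tau> t))" by (rule smooth_path_reparam[OF s(1) \<tau> im False])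
    have "(\<lambda>t. \<gamma> (\<tau> t)) ` {0..1} \<subseteq> W" using im s(2) by blast
    from dist_in_le[OF sp this]
    have "dist_in W (\<gamma> a) (\<gamma> b) \<le> ennreal (path_len A g (\<lambda>t. \<gamma> (\<tau> t)))" by (simp add: e)
    also have "path_len A g (\<lambda>t. \<gamma> (\<tau> t)) = integral {\<tau> 0..\<tau> 1} (speed A g \<gamma>)"
      unfolding path_len_def using ab by (intro integral_speed_reparam[OF s(1) \<tau> im d]) auto
    finally show ?thesis by (simp add: e)
  qed
qed

text \<open>The arc length \<open>\<Lambda>\<close> may be constant on intervals where the speed
  vanishes, so \<open>\<sigma>\<close> merely chooses a parameter at which the fraction
  \<open>u\<close> of the length is reached. Any choice satisfies the Lipschitz bound, because
  \<open>dist_in_subpath\<close> sees only differences of \<open>\<Lambda>\<close>.\<close>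

lemma length_parametrization:
  assumes W: "openin X W" and s: "smooth_path X A \<gamma>" "\<gamma> ` {0..1} \<subseteq> W"
  obtains m :: "real \<Rightarrow> 'a" where "m 0 = \<gamma> 0" "m 1 = \<gamma> 1" "m ` {0..1} \<subseteq> W"
    "\<And>s t. 0 \<le> s \<Longrightarrow> s \<le> t \<Longrightarrow> t \<le> 1 \<Longrightarrow> dist_in W (m s) (m t) \<le> ennreal ((t - s) * path_len A g \<gamma>)"
proof -
  define L where "L = path_len A g \<gamma>"
  define \<Lambda> where "\<Lambda> u = integral {0..u} (speed A g \<gamma>)" for u
  have c: "continuous_on {0..1} \<Lambda>"
    unfolding \<Lambda>_def using speed_integrable[OF s(1), of 0 1] by (intro indefinite_integral_continuous_1) auto
  have \<Lambda>01: "\<Lambda> 0 = 0" "\<Lambda> 1 = L" by (simp_all add: \<Lambda>_def L_def path_len_def)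
  have L0: "0 \<le> L" unfolding L_def by (rule path_len_nonneg[OF s(1)])
  have "\<exists>t\<in>{0..1}. \<Lambda> t = u * L" if "u \<in> {0..1}" for u
    using IVT'[of \<Lambda> 0 "u * L" 1] c that L0 \<Lambda>01 mult_right_mono[of u 1 L] by auto
  then obtain \<sigma>0 where \<sigma>0: "\<And>u. u \<in> {0..1} \<Longrightarrow> \<sigma>0 u \<in> {0..1} \<and> \<Lambda> (\<sigma>0 u) = u * L" by metis
  \<comment> \<open>The choice is overridden at 0 and 1, where several parameters may qualify, to
    keep the end points.\<close>
  define \<sigma> where "\<sigma> u = (if u = 0 then 0 else if u = 1 then 1 else \<sigma>0 u)" for u :: real
  have \<sigma>: "\<sigma> u \<in> {0..1} \<and> \<Lambda> (\<sigma> u) = u * L" if "u \<in> {0..1}" for u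
    using \<sigma>0[OF that] \<Lambda>01 by (auto simp: \<sigma>_def)
  have diff: "integral {a..b} (speed A g \<gamma>) = \<Lambda> b - \<Lambda> a" if "0 \<le> a" "a \<le> b" "b \<le> 1" for a b
    using Henstock_Kurzweil_Integration.integral_combine[where a = 0 and c = a and b = b and f = "speed A g \<gamma>"] speed_integrable[OF s(1), of 0 b] that by (simp add: \<Lambda>_def)
  show ?thesis
  proof (rule that[of "\<lambda>u. \<gamma> (\<sigma> u)"])
    show "(\<lambda>u. \<gamma> (\<sigma> u)) ` {0..1} \<subseteq> W" using \<sigma> s(2) by blast
    fix u v :: real assume uv: "0 \<le> u" "u \<le> v" "v \<le> 1"
    have su: "\<sigma> u \<in> {0..1}" "\<Lambda> (\<sigma> u) = u * L" and sv: "\<sigma> v \<in> {0..1}" "\<Lambda> (\<sigma> v) = v * L"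
      using \<sigma>[of u] \<sigma>[of v] uv by auto
    show "dist_in W (\<gamma> (\<sigma> u)) (\<gamma> (\<sigma> v)) \<le> ennreal ((v - u) * path_len A g \<gamma>)"
    proof (cases "\<sigma> u \<le> \<sigma> v")
      case True
      have "dist_in W (\<gamma> (\<sigma> u)) (\<gamma> (\<sigma> v)) \<le> ennreal (integral {\<sigma> u..\<sigma> v} (speed A g \<gamma>))"
        using su sv True by (intro dist_in_subpath[OF W s]) auto
      also have "integral {\<sigma> u..\<sigma> v} (speed A g \<gamma>) = (v - u) * L"
        using diff[of "\<sigma> u" "\<sigma> v"] su sv True by (simp add: algebra_simps)
      finally show ?thesis by (simp add: L_def)
    next
      case False
      \<comment> \<open>If the chosen parameters are out of order, the length between them is
        \<open>(u - v) * L\<close>, which is not positive.\<close>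
      have "dist_in W (\<gamma> (\<sigma> v)) (\<gamma> (\<sigma> u)) \<le> ennreal (integral {\<sigma> v..\<sigma> u} (speed A g \<gamma>))"
        using su sv False by (intro dist_in_subpath[OF W s]) auto
      also have "integral {\<sigma> v..\<sigma> u} (speed A g \<gamma>) = (u - v) * L"
        using diff[of "\<sigma> v" "\<sigma> u"] su sv False by (simp add: algebra_simps)
      also have "ennreal ((u - v) * L) \<le> ennreal ((v - u) * L)"
        using uv L0 by (intro ennreal_leI mult_right_mono) auto
      finally show ?thesis by (simp add: L_def dist_in_sym)
    qed
  qed (auto simp: \<sigma>_def)
qed

text \<open>Up to the first exit from the coordinate ball of radius \<open>R\<close> the coordinate
  curve has Euclidean speed at most the Riemannian speed divided by \<open>\<kappa>\<close>, and by
  then it has covered at least the Euclidean distance \<open>R - r\<close>.\<close>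

lemma path_len_escape:
  assumes c: "c \<in> A" and \<kappa>: "\<And>x v. x \<in> cball x0 R \<Longrightarrow> \<kappa> * norm v \<le> sqrt (qform c x v)" "0 < \<kappa>"
    and R: "cball x0 R \<subseteq> rng c" "r < R"
    and s: "smooth_path X A \<gamma>" and start: "\<gamma> 0 \<in> fst c" "snd c (\<gamma> 0) \<in> cball x0 r"
    and esc: "\<not> (\<gamma> 1 \<in> fst c \<and> snd c (\<gamma> 1) \<in> ball x0 R)"
  shows "\<kappa> * (R - r) \<le> path_len A g \<gamma>"
proof -
  define B where "B = {p \<in> fst c. snd c p \<in> ball x0 R}"
  define B' where "B' = {p \<in> fst c. snd c p \<in> cball x0 R}"
  have oB: "openin X B" unfolding B_def by (rule openin_chart_preimage[OF c]) simp
  have cB': "closedin X B'" unfolding B'_def by (rule closedin_chart_compact[OF c _ R(1)]) simp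
  have cm: "continuous_map (top_of_set {0..1}) X \<gamma>"
    using s by (simp add: smooth_path_def pathin_def)
  have clo: "closed {t \<in> {0..1}. \<gamma> t \<in> S}" if S: "closedin X S" for S
  proof -
    have "closedin (top_of_set {0..1}) {t \<in> topspace (top_of_set {0..1}). \<gamma> t \<in> S}"
      using closedin_continuous_map_preimage[OF cm S] .
    then show ?thesis using closedin_closed_trans[of "{0..1::real}"] by simp
  qed
  define T where "T = {t \<in> {0..1}. \<gamma> t \<in> topspace X - B}"
  have cT: "closed T" unfolding T_def by (rule clo) (use oB in blast)
  have top: "\<gamma> t \<in> topspace X" if "t \<in> {0..1}" for t
    using cm that by (auto simp: continuous_map_def)
  have T1: "1 \<in> T" using esc top by (auto simp: T_def B_def)
  have bT: "bdd_below T" by (rule bdd_belowI[of _ 0]) (auto simp: T_def)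
  \<comment> \<open>The first time outside the open ball. Since \<open>B'\<close> is closed in
    \<open>X\<close>, the point \<open>\<gamma> t1\<close> is still in the chart domain, and the
    coordinate curve is defined on the closed interval up to \<open>t1\<close>.\<close>
  define t1 where "t1 = Inf T"
  have t1T: "t1 \<in> T" unfolding t1_def using closed_contains_Inf[OF _ bT cT] T1 by blast
  have t1: "t1 \<in> {0..1}" using t1T by (auto simp: T_def)
  have before: "\<gamma> t \<in> B" if "0 \<le> t" "t < t1" for t
  proof (rule ccontr)
    assume "\<gamma> t \<notin> B"
    then have "t \<in> T" using that t1 top by (auto simp: T_def)
    then have "t1 \<le> t" unfolding t1_def using bT by (intro cInf_lower) auto
    then show False using that by simp
  qed
  have "0 \<notin> T" using start R(2) by (auto simp: T_def B_def)
  then have t1pos: "0 < t1" using t1 t1T by (cases "t1 = 0") auto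
  have inB': "\<gamma> t \<in> B'" if "t \<in> {0..t1}" for t
  proof -
    have "{0..<t1} \<subseteq> {t \<in> {0..1}. \<gamma> t \<in> B'}"
      using before t1 by (auto simp: B_def B'_def intro: less_imp_le)
    then have "closure {0..<t1} \<subseteq> {t \<in> {0..1}. \<gamma> t \<in> B'}"
      using clo[OF cB'] by (rule closure_minimal)
    then show ?thesis using that t1pos by auto
  qed
  define F where "F t = snd c (\<gamma> t)" for t
  define F' where "F' t = vector_derivative F (at t within {0..1})" for t
  have loc: "(F has_vector_derivative F' t) (at t within {0..1}) \<and> norm (F' t) \<le> speed A g \<gamma> t / \<kappa>"
    if t: "t \<in> {0..t1}" for t
  proof -
    have t01: "t \<in> {0..1}" using t t1 by auto
    have tc: "\<gamma> t \<in> fst c" using inB'[OF t] by (simp add: B'_def)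
    obtain N h h' where N: "open N" "t \<in> N"
      "\<And>s. s \<in> N \<Longrightarrow> (h has_vector_derivative h' s) (at s)"
      "\<And>s. s \<in> N \<Longrightarrow> s \<in> {0..1} \<Longrightarrow> \<gamma> s \<in> fst c \<and> snd c (\<gamma> s) = h s"
      "\<And>s. s \<in> N \<Longrightarrow> s \<in> {0..1} \<Longrightarrow> speed A g \<gamma> s = sqrt (qform c (h s) (h' s))"
      using smooth_path_speed[OF s c t01 tc] by metis
    have v: "F' t = h' t" unfolding F'_def
      by (rule vector_derivative_local[OF N(1,2) t01 N(3)[OF N(2)]]) (use N(4) in \<open>auto simp: F_def\<close>)
    obtain d where d: "0 < d" "ball t d \<subseteq> N" using N(1,2) openE by blast
    have "(F has_vector_derivative h' t) (at t within {0..1})"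
    proof (rule has_vector_derivative_transform_within)
      show "(h has_vector_derivative h' t) (at t within {0..1})"
        using N(3)[OF N(2)] by (rule has_vector_derivative_at_within)
      fix u assume u: "u \<in> {0..1}" "dist u t < d"
      then have "u \<in> N" using d(2) by (auto simp: dist_commute subset_iff)
      then show "h u = F u" using N(4)[OF _ u(1)] by (simp add: F_def)
    qed (use d t01 in auto)
    moreover have "h t \<in> cball x0 R" using inB'[OF t] N(4)[OF N(2) t01] by (simp add: B'_def)
    then have "\<kappa> * norm (h' t) \<le> speed A g \<gamma> t" using \<kappa>(1) N(5)[OF N(2) t01] by simp
    then have "norm (h' t) \<le> speed A g \<gamma> t / \<kappa>" using \<kappa>(2) by (simp add: field_simps)
    ultimately show ?thesis by (simp add: v)
  qed
  have "(F' has_integral (F t1 - F 0)) {0..t1}"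
    using t1 t1pos loc by (intro fundamental_theorem_of_calculus)
      (auto intro: has_vector_derivative_within_subset[where S = "{0..1}"])
  then have "norm (F t1 - F 0) \<le> integral {0..t1} (\<lambda>t. speed A g \<gamma> t / \<kappa>)"
    using integral_norm_bound_integral[of F' "{0..t1}" "\<lambda>t. speed A g \<gamma> t / \<kappa>"] loc
      speed_integrable[OF s, of 0 t1] t1
    by (auto simp: has_integral_iff intro: integrable_on_divide)
  also have "\<dots> = integral {0..t1} (speed A g \<gamma>) / \<kappa>" by simp
  also have "\<dots> \<le> path_len A g \<gamma> / \<kappa>"
    unfolding path_len_def using t1 \<kappa>(2)
    by (intro divide_right_mono integral_subset_le speed_integrable[OF s])
      (auto intro: speed_nonneg[OF s])
  finally have 1: "norm (F t1 - F 0) \<le> path_len A g \<gamma> / \<kappa>" .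
  have "\<gamma> t1 \<in> B'" "\<gamma> t1 \<notin> B" using inB'[of t1] t1pos t1T by (auto simp: T_def)
  then have "R \<le> dist x0 (F t1)" by (auto simp: B'_def B_def F_def)
  moreover have "dist x0 (F 0) \<le> r" using start by (simp add: F_def)
  moreover have "dist x0 (F t1) \<le> dist x0 (F 0) + norm (F t1 - F 0)"
    using dist_triangle[of x0 "F t1" "F 0"] by (simp add: dist_norm norm_minus_commute)
  ultimately have "R - r \<le> path_len A g \<gamma> / \<kappa>" using 1 by linarith
  then show ?thesis using \<kappa>(2) by (simp add: field_simps)
qed

lemma dist_in_escape:
  assumes c: "c \<in> A" and \<kappa>: "\<And>x v. x \<in> cball x0 R \<Longrightarrow> \<kappa> * norm v \<le> sqrt (qform c x v)" "0 < \<kappa>"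
    and R: "cball x0 R \<subseteq> rng c" "r < R"
    and x: "x \<in> fst c" "snd c x \<in> cball x0 r"
    and lt: "dist_in W x y < ennreal (\<kappa> * (R - r))"
  shows "y \<in> fst c \<and> snd c y \<in> ball x0 R"
proof (rule ccontr)
  assume n: "\<not> ?thesis"
  obtain \<gamma> where g: "smooth_path X A \<gamma>" "\<gamma> 0 = x" "\<gamma> 1 = y"
    "ennreal (path_len A g \<gamma>) < ennreal (\<kappa> * (R - r))" using dist_in_lessE[OF lt] by metis
  have "\<kappa> * (R - r) \<le> path_len A g \<gamma>"
    by (rule path_len_escape[OF c \<kappa> R g(1)]) (use g x n in auto)
  then show False using g(4) ennreal_leI leD by blast
qed

end

section \<open>Half-disc charts at the boundary\<close>

context surface
begin

text \<open>Invariance of domain transported through a chart: a homeomorphic copy of an open piece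
  of the plane is open in \<open>X\<close>, both being two-dimensional.\<close>

lemma homeomorphic_open_imp_openin:
  fixes V :: "(real^2) set"
  assumes c: "c \<in> A" "N \<subseteq> fst c" and V: "open V"
    and h: "homeomorphic_maps (subtopology X N) (top_of_set V) q p"
  shows "openin X N"
proof -
  have NX: "N \<subseteq> topspace X" using c dom_subset by blast
  have pN: "p z \<in> N" "q (p z) = z" if "z \<in> V" for z
    using h that by (auto simp: homeomorphic_maps_def continuous_map_def topspace_subtopology)
  have qV: "q x \<in> V" "p (q x) = x" if "x \<in> N" for x
    using h that NX by (auto simp: homeomorphic_maps_def continuous_map_def topspace_subtopology)
  have "continuous_map (top_of_set V) (subtopology X (fst c)) p"
    using h c(2) pN by (auto simp: homeomorphic_maps_def continuous_map_in_subtopology)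
  from continuous_map_compose[OF this continuous_map_chart[OF c(1)]]
  have "continuous_on V (\<lambda>z. snd c (p z))" by (simp add: o_def)
  moreover have "inj_on (\<lambda>z. snd c (p z)) V"
  proof (rule inj_onI)
    fix z z' assume z: "z \<in> V" "z' \<in> V" "snd c (p z) = snd c (p z')"
    have "p z = p z'" using inj_onD[OF inj_chart[OF c(1)] z(3)] pN(1) z c(2) by blast
    then show "z = z'" using pN(2) z by metis
  qed
  ultimately have o: "open ((\<lambda>z. snd c (p z)) ` V)" by (rule invariance_of_domain[OF _ V])
  have "N = {x \<in> fst c. snd c x \<in> (\<lambda>z. snd c (p z)) ` V}"
  proof
    show "N \<subseteq> {x \<in> fst c. snd c x \<in> (\<lambda>z. snd c (p z)) ` V}"
    proof
      fix x assume x: "x \<in> N"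
      then have "snd c x = snd c (p (q x))" using qV by simp
      then show "x \<in> {x \<in> fst c. snd c x \<in> (\<lambda>z. snd c (p z)) ` V}"
        using x qV(1)[OF x] c(2) by blast
    qed
    show "{x \<in> fst c. snd c x \<in> (\<lambda>z. snd c (p z)) ` V} \<subseteq> N"
    proof
      fix x assume "x \<in> {x \<in> fst c. snd c x \<in> (\<lambda>z. snd c (p z)) ` V}"
      then obtain z where z: "x \<in> fst c" "z \<in> V" "snd c x = snd c (p z)" by auto
      then have "x = p z" using inj_onD[OF inj_chart[OF c(1)] z(3)] pN(1)[OF z(2)] c(2) by blast
      then show "x \<in> N" using pN z by simp
    qed
  qed
  then show ?thesis using openin_chart_preimage[OF c(1) o] by simp
qed

text \<open>Relative openness in \<open>Y\<close> is upgraded to openness in \<open>X\<close> by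
  invariance of domain, after shrinking to a single chart domain.\<close>

lemma openin_mf_interior:
  assumes Y: "Y \<subseteq> topspace X"
  shows "openin X (mf_interior X Y)"
proof (subst openin_subopen, rule ballI)
  fix y assume "y \<in> mf_interior X Y"
  then obtain N and V :: "(real^2) set" where N: "openin (subtopology X Y) N" "y \<in> N" "open V"
    "subtopology X N homeomorphic_space top_of_set V" "y \<in> Y"
    by (auto simp: mf_interior_def)
  obtain q p where h: "homeomorphic_maps (subtopology X N) (top_of_set V) q p"
    using N(4) by (auto simp: homeomorphic_space_def)
  obtain c where c: "c \<in> A" "y \<in> fst c" using chart_at Y N(5) by blast
  define N' where "N' = N \<inter> fst c"
  have "openin (subtopology X N) N'"
    unfolding N'_def using openin_dom[OF c(1)] by (auto simp: openin_subtopology)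
  then have "openin (top_of_set V) (q ` N')"
    using h by (meson homeomorphic_maps_imp_map homeomorphic_imp_open_map open_map_def)
  then have oq: "open (q ` N')" using N(3) openin_open_eq by blast
  have NX: "N \<subseteq> topspace X" using N(1) Y openin_subset by fastforce
  have h': "homeomorphic_maps (subtopology (subtopology X N) N') (subtopology (top_of_set V) (q ` N')) q p"
  proof (rule homeomorphic_maps_subtopologies[OF h])
    show "q ` (topspace (subtopology X N) \<inter> N') = topspace (top_of_set V) \<inter> q ` N'"
      using h NX by (auto simp: homeomorphic_maps_def continuous_map_def N'_def)
  qed
  have "subtopology (subtopology X N) N' = subtopology X N'"
    by (simp add: subtopology_subtopology N'_def Int_absorb1 inf.absorb2)
  moreover have "subtopology (top_of_set V) (q ` N') = top_of_set (q ` N')"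
  proof -
    have "q ` N' \<subseteq> V" using h NX by (auto simp: homeomorphic_maps_def continuous_map_def N'_def)
    then show ?thesis by (simp add: subtopology_subtopology Int_absorb1)
  qed
  ultimately have "homeomorphic_maps (subtopology X N') (top_of_set (q ` N')) q p" using h' by simp
  then have "openin X N'" using homeomorphic_open_imp_openin[OF c(1) _ oq] by (simp add: N'_def)
  moreover have "N' \<subseteq> mf_interior X Y"
  proof
    fix x assume "x \<in> N'"
    then have "x \<in> N" by (simp add: N'_def)
    moreover have "x \<in> Y" using \<open>x \<in> N\<close> N(1) openin_subset by fastforce
    ultimately show "x \<in> mf_interior X Y" unfolding mf_interior_def using N by blast
  qed
  ultimately show "\<exists>T. openin X T \<and> y \<in> T \<and> T \<subseteq> mf_interior X Y"
    using N c unfolding N'_def by blast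
qed

text \<open>The half-disc is taken closed because a continuous injection of a compact set into the
  Hausdorff space \<open>X\<close> is a homeomorphism onto a closed set. Only the straight edge
  consists of boundary points; openness in \<open>Y\<close> is demanded for radii up to 1, where the
  curved rim is left out. The bound variable \<open>\<rho>\<close> is a radius here.\<close>

definition bdry_chart :: "'a set \<Rightarrow> (real^2 \<Rightarrow> 'a) \<Rightarrow> bool" where
  "bdry_chart Y k \<longleftrightarrow> continuous_map (top_of_set half_disc) X k \<and> inj_on k half_disc \<and>
     k ` half_disc \<subseteq> Y \<and> (\<forall>w\<in>half_disc. k w \<in> mf_interior X Y \<longleftrightarrow> 0 < w $ 2) \<and>
     (\<forall>\<rho>\<le>1. openin (subtopology X Y) (k ` {w \<in> half_disc. norm w < \<rho>}))"

lemma bdry_chartD: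
  assumes "bdry_chart Y k"
  shows "continuous_map (top_of_set half_disc) X k" "inj_on k half_disc" "k ` half_disc \<subseteq> Y"
    "w \<in> half_disc \<Longrightarrow> k w \<in> mf_interior X Y \<longleftrightarrow> 0 < w $ 2"
    "\<rho> \<le> 1 \<Longrightarrow> openin (subtopology X Y) (k ` {w \<in> half_disc. norm w < \<rho>})"
  using assms unfolding bdry_chart_def by simp_all

text \<open>The homeomorphism \<open>p\<close> from a piece of the half-plane, given by the manifold
  structure, is rescaled around the preimage \<open>q a\<close>, which lies on the edge because
  \<open>a\<close> is not interior. That edge points are never interior is again invariance of
  domain.\<close>

lemma bdry_chart_exists:
  assumes Y: "C0_submanifold_bd X Y" and a: "a \<in> mf_boundary X Y" and c: "c \<in> A" "a \<in> fst c"
    and W: "openin X W" "a \<in> W"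
  obtains k where "bdry_chart Y k" "k 0 = a" "k ` half_disc \<subseteq> fst c \<inter> W"
proof -
  have YX: "Y \<subseteq> topspace X" using Y by (simp add: C0_submanifold_bd_def)
  have aY: "a \<in> Y" "a \<notin> mf_interior X Y" using a by (auto simp: mf_boundary_def)
  obtain N and V :: "(real^2) set" where N: "openin (subtopology X Y) N" "a \<in> N"
    "openin (top_of_set half_plane) V" "subtopology X N homeomorphic_space top_of_set V"
    using Y aY(1) unfolding C0_submanifold_bd_def by blast
  obtain q p where h: "homeomorphic_maps (subtopology X N) (top_of_set V) q p"
    using N(4) by (auto simp: homeomorphic_space_def)
  have NY: "N \<subseteq> Y" using N(1) openin_subset by fastforce
  then have NX: "N \<subseteq> topspace X" using YX by blast
  have tN: "topspace (subtopology X N) = N" using NX by (simp add: topspace_subtopology inf.absorb2)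
  have pN: "p z \<in> N" "q (p z) = z" if "z \<in> V" for z
    using h that by (auto simp: homeomorphic_maps_def continuous_map_def topspace_subtopology)
  have qV: "q x \<in> V" "p (q x) = x" if "x \<in> N" for x
    using h that NX by (auto simp: homeomorphic_maps_def continuous_map_def topspace_subtopology)
  have cq: "continuous_map (subtopology X N) euclidean q"
    and cp: "continuous_map (top_of_set V) X p"
    using h by (auto simp: homeomorphic_maps_def continuous_map_in_subtopology)
  have "homeomorphic_maps (top_of_set V) (subtopology X N) p q"
    using h homeomorphic_maps_sym by blast
  then have op: "openin (subtopology X N) (p ` S)" if "openin (top_of_set V) S" for S
    using that by (meson homeomorphic_maps_imp_map homeomorphic_imp_open_map open_map_def)
  have oq: "openin (top_of_set V) (q ` S)" if "openin (subtopology X N) S" for S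
    using h that by (meson homeomorphic_maps_imp_map homeomorphic_imp_open_map open_map_def)
  obtain O' where O': "open O'" "V = half_plane \<inter> O'" using N(3) by (auto simp: openin_open)
  have interior: "p z \<in> mf_interior X Y" if z: "z \<in> V" "0 < z $ 2" for z
  proof -
    define V' where "V' = O' \<inter> {z. 0 < z $ 2}"
    have "open {z::real^2. 0 < z $ 2}" by (intro open_Collect_less continuous_intros)
    then have oV': "open V'" using O' by (simp add: V'_def open_Int)
    have V'V: "V' \<subseteq> V" by (auto simp: V'_def O'(2) half_plane_def)
    then have "openin (top_of_set V) V'" using oV' by (auto simp: openin_open)
    then have "openin (subtopology X N) (p ` V')" by (rule op)
    then have o: "openin (subtopology X Y) (p ` V')"
    proof -
      obtain T1 where T1: "openin X T1" "p ` V' = T1 \<inter> N"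
        using \<open>openin (subtopology X N) (p ` V')\<close> by (auto simp: openin_subtopology)
      obtain T2 where T2: "openin X T2" "N = T2 \<inter> Y" using N(1) by (auto simp: openin_subtopology)
      show ?thesis unfolding openin_subtopology
        by (intro exI[of _ "T1 \<inter> T2"]) (use T1 T2 in auto)
    qed
    have "homeomorphic_maps (subtopology X (p ` V')) (top_of_set V') q p"
      unfolding homeomorphic_maps_def
    proof (intro conjI ballI)
      show "continuous_map (subtopology X (p ` V')) (top_of_set V') q"
      proof -
        have "p ` V' \<subseteq> N" using pN V'V by blast
        then have "continuous_map (subtopology X (p ` V')) euclidean q"
          using cq continuous_map_from_subtopology_mono by blast
        moreover have "q ` p ` V' \<subseteq> V'" using pN(2) V'V by (auto simp: subset_iff)
        ultimately show ?thesis by (auto simp: continuous_map_in_subtopology)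
      qed
      show "continuous_map (top_of_set V') (subtopology X (p ` V')) p"
        using continuous_map_from_subtopology_mono[OF cp V'V] by (auto simp: continuous_map_in_subtopology)
    qed (use pN V'V in \<open>auto simp: subset_iff\<close>)
    then have "subtopology X (p ` V') homeomorphic_space top_of_set V'"
      by (rule homeomorphic_maps_imp_homeomorphic_space)
    moreover have "z \<in> V'" using z O' by (simp add: V'_def)
    moreover have "p z \<in> Y" using pN(1)[OF z(1)] NY by blast
    ultimately show ?thesis unfolding mf_interior_def using o oV' by blast
  qed
  \<comment> \<open>Otherwise \<open>q\<close> after the inverse of the chart \<open>c\<close> would
    map an open set of the plane injectively onto a neighbourhood of \<open>z\<close> inside the
    half-plane, and this would contain the point \<open>z'\<close> below the edge.\<close>
  have boundary: "p z \<notin> mf_interior X Y" if z: "z \<in> V" "z $ 2 = 0" "p z \<in> fst c" for z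
  proof
    assume i: "p z \<in> mf_interior X Y"
    obtain T where T: "openin X T" "N = T \<inter> Y" using N(1) by (auto simp: openin_subtopology)
    define S where "S = mf_interior X Y \<inter> T"
    have oS: "openin X S" unfolding S_def using openin_mf_interior[OF YX] T by blast
    have "mf_interior X Y \<subseteq> Y" by (auto simp: mf_interior_def)
    then have SN: "S \<subseteq> N" using T by (auto simp: S_def)
    have zS: "p z \<in> S" using i pN(1)[OF z(1)] T by (auto simp: S_def)
    define D where "D = snd c ` (fst c \<inter> S)"
    have oD: "open D" unfolding D_def by (rule open_chart_image[OF c(1) oS])
    have Dr: "D \<subseteq> rng c" by (auto simp: D_def)
    have cD: "crd_inv c x \<in> S" "snd c (crd_inv c x) = x" if "x \<in> D" for x
      using that c(1) by (auto simp: D_def)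
    have "continuous_map (top_of_set D) (subtopology X N) (crd_inv c)"
      using continuous_map_from_subtopology_mono[OF continuous_map_crd_inv[OF c(1)] Dr] cD(1) SN
      by (auto simp: continuous_map_in_subtopology)
    from continuous_map_compose[OF this cq]
    have "continuous_on D (\<lambda>x. q (crd_inv c x))" by (simp add: o_def)
    moreover have "inj_on (\<lambda>x. q (crd_inv c x)) D"
    proof (rule inj_onI)
      fix x x' assume x: "x \<in> D" "x' \<in> D" "q (crd_inv c x) = q (crd_inv c x')"
      then have "crd_inv c x = crd_inv c x'" using qV(2) cD(1) SN by (metis subsetD)
      then show "x = x'" using cD(2) x by metis
    qed
    ultimately have o: "open ((\<lambda>x. q (crd_inv c x)) ` D)" by (rule invariance_of_domain[OF _ oD])
    have "snd c (p z) \<in> D" using zS z(3) by (auto simp: D_def)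
    moreover have "q (crd_inv c (snd c (p z))) = z" using pN(2)[OF z(1)] z(3) c(1) by simp
    ultimately have "z \<in> (\<lambda>x. q (crd_inv c x)) ` D" by (metis imageI)
    then obtain e where e: "0 < e" "cball z e \<subseteq> (\<lambda>x. q (crd_inv c x)) ` D"
      using o open_contains_cball by blast
    define z' where "z' = z - e *\<^sub>R axis 2 1"
    have "z' \<in> cball z e" using e by (simp add: z'_def dist_norm norm_axis_1)
    then obtain x where x: "x \<in> D" "z' = q (crd_inv c x)" using e by auto
    then have "z' \<in> V" using qV(1) cD(1) SN by (metis subsetD)
    then have "0 \<le> z' $ 2" using O' by (simp add: half_plane_def)
    then show False using z e by (simp add: z'_def axis_def)
  qed
  have qa: "q a \<in> V" "p (q a) = a" using qV N(2) by auto
  have qa2: "q a $ 2 = 0"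
    using interior[OF qa(1)] qa aY(2) O' by (auto simp: half_plane_def) (metis order_le_less)
  define S where "S = N \<inter> (fst c \<inter> W)"
  have "openin (subtopology X N) S"
    unfolding S_def using openin_dom[OF c(1)] W by (auto simp: openin_subtopology)
  then have oqS: "openin (top_of_set V) (q ` S)" by (rule oq)
  then obtain O'' where O'': "open O''" "q ` S = V \<inter> O''" by (auto simp: openin_open)
  have "q a \<in> O' \<inter> O''" using O'' O' qa N c W by (auto simp: S_def)
  then obtain s where s: "0 < s" "cball (q a) s \<subseteq> O' \<inter> O''"
    using O' O'' open_contains_cball by (metis open_Int)
  \<comment> \<open>The radius \<open>s\<close> keeps the scaled half-disc inside \<open>V\<close>
    and its image inside \<open>fst c \<inter> W\<close>.\<close>
  define k where "k w = p (q a + s *\<^sub>R w)" for w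
  have kq: "q a + s *\<^sub>R w \<in> V" "q a + s *\<^sub>R w \<in> q ` S" if w: "w \<in> half_disc" for w
  proof -
    have "s * norm w \<le> s * 1" using w s(1) by (intro mult_left_mono) (auto simp: half_disc_def)
    then have "q a + s *\<^sub>R w \<in> cball (q a) s" using s(1) by (simp add: dist_norm)
    then have "q a + s *\<^sub>R w \<in> O' \<inter> O''" using s(2) by blast
    moreover have "q a + s *\<^sub>R w \<in> half_plane" using w s(1) qa2 by (simp add: half_plane_def half_disc_def)
    ultimately show "q a + s *\<^sub>R w \<in> V" "q a + s *\<^sub>R w \<in> q ` S" using O' O'' by auto
  qed
  have kS: "k w \<in> S" if w: "w \<in> half_disc" for w
  proof -
    obtain x where "x \<in> S" "q a + s *\<^sub>R w = q x" using kq(2)[OF w] by auto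
    then show ?thesis using qV(2)[of x] by (simp add: k_def S_def)
  qed
  have "bdry_chart Y k"
    unfolding bdry_chart_def
  proof (intro conjI ballI allI impI)
    have "continuous_map (top_of_set half_disc) (top_of_set V) (\<lambda>w. q a + s *\<^sub>R w)"
      using kq(1) by (auto simp: continuous_map_in_subtopology intro!: continuous_intros)
    from continuous_map_compose[OF this cp]
    show "continuous_map (top_of_set half_disc) X k" by (simp add: o_def k_def[abs_def])
    show "inj_on k half_disc"
    proof (rule inj_onI)
      fix w w' assume w: "w \<in> half_disc" "w' \<in> half_disc" "k w = k w'"
      then have "q a + s *\<^sub>R w = q a + s *\<^sub>R w'" using pN(2)[OF kq(1)] unfolding k_def by metis
      then show "w = w'" using s(1) by simp
    qed
    show "k ` half_disc \<subseteq> Y" using kS NY by (auto simp: S_def)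
    show "k w \<in> mf_interior X Y \<longleftrightarrow> 0 < w $ 2" if w: "w \<in> half_disc" for w
    proof
      assume i: "k w \<in> mf_interior X Y"
      show "0 < w $ 2"
      proof (rule ccontr)
        assume "\<not> 0 < w $ 2"
        then have "w $ 2 = 0" using w by (simp add: half_disc_def)
        then have "(q a + s *\<^sub>R w) $ 2 = 0" using qa2 by simp
        then show False using boundary[OF kq(1)[OF w]] i kS[OF w] by (simp add: k_def S_def)
      qed
    next
      assume "0 < w $ 2"
      then show "k w \<in> mf_interior X Y"
        unfolding k_def using s(1) qa2 by (intro interior kq(1) w) simp
    qed
    fix \<rho> :: real assume \<rho>: "\<rho> \<le> 1"
    have "k ` {w \<in> half_disc. norm w < \<rho>} = p ` (V \<inter> ball (q a) (s * \<rho>))"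
    proof
      show "k ` {w \<in> half_disc. norm w < \<rho>} \<subseteq> p ` (V \<inter> ball (q a) (s * \<rho>))"
        using kq(1) s(1) by (auto simp: k_def dist_norm)
      show "p ` (V \<inter> ball (q a) (s * \<rho>)) \<subseteq> k ` {w \<in> half_disc. norm w < \<rho>}"
      proof
        fix x assume "x \<in> p ` (V \<inter> ball (q a) (s * \<rho>))"
        then obtain z where z: "z \<in> V" "dist (q a) z < s * \<rho>" "x = p z" by auto
        define w where "w = (1 / s) *\<^sub>R (z - q a)"
        have "norm w = norm (z - q a) / s" using s(1) by (simp add: w_def)
        then have "norm w < \<rho>" using z(2) s(1) by (simp add: dist_norm norm_minus_commute divide_less_eq mult.commute)
        moreover have "0 \<le> w $ 2" using z(1) O' s(1) qa2 by (simp add: w_def half_plane_def)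
        ultimately have "w \<in> half_disc" "norm w < \<rho>" using \<rho> by (auto simp: half_disc_def)
        moreover have "k w = x" using s(1) z by (simp add: k_def w_def)
        ultimately show "x \<in> k ` {w \<in> half_disc. norm w < \<rho>}" by blast
      qed
    qed
    moreover have "openin (subtopology X N) (p ` (V \<inter> ball (q a) (s * \<rho>)))"
      by (rule op) (auto simp: openin_open)
    ultimately obtain T1 where T1: "openin X T1" "k ` {w \<in> half_disc. norm w < \<rho>} = T1 \<inter> N"
      by (auto simp: openin_subtopology)
    obtain T2 where T2: "openin X T2" "N = T2 \<inter> Y" using N(1) by (auto simp: openin_subtopology)
    show "openin (subtopology X Y) (k ` {w \<in> half_disc. norm w < \<rho>})"
      unfolding openin_subtopology by (intro exI[of _ "T1 \<inter> T2"]) (use T1 T2 in auto)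
  qed
  moreover have "k 0 = a" using qa by (simp add: k_def)
  moreover have "k ` half_disc \<subseteq> fst c \<inter> W" using kS by (auto simp: S_def)
  ultimately show ?thesis by (rule that)
qed

lemma bdry_chart_inverse:
  assumes "bdry_chart Y k"
  shows "continuous_map (subtopology X (k ` half_disc)) (top_of_set half_disc) (inv_into half_disc k)"
proof -
  have k: "continuous_map (top_of_set half_disc) X k" "inj_on k half_disc"
    using assms by (auto simp: bdry_chart_def)
  have kX: "k ` half_disc \<subseteq> topspace X" using k(1) by (auto simp: continuous_map_def)
  have "homeomorphic_map (top_of_set half_disc) (subtopology X (k ` half_disc)) k"
  proof (rule continuous_imp_homeomorphic_map)
    show "compact_space (top_of_set half_disc)"
      using compact_half_disc by (simp add: compact_space_subtopology)
    show "Hausdorff_space (subtopology X (k ` half_disc))"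
      by (rule Hausdorff_space_subtopology[OF Hausdorff])
    show "continuous_map (top_of_set half_disc) (subtopology X (k ` half_disc)) k"
      using k(1) by (auto simp: continuous_map_in_subtopology)
  qed (use k kX in \<open>auto simp: topspace_subtopology\<close>)
  then obtain j where j: "homeomorphic_maps (top_of_set half_disc) (subtopology X (k ` half_disc)) k j"
    by (auto simp: homeomorphic_map_maps)
  have "continuous_map (subtopology X (k ` half_disc)) (top_of_set half_disc) j"
    using j by (simp add: homeomorphic_maps_def)
  moreover have "j x = inv_into half_disc k x" if x: "x \<in> topspace (subtopology X (k ` half_disc))" for x
  proof -
    obtain w where w: "w \<in> half_disc" "x = k w" using x by auto
    then show ?thesis using j k(2) by (simp add: homeomorphic_maps_def)
  qed
  ultimately show ?thesis by (rule continuous_map_eq)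
qed

lemma closedin_bdry_chart:
  assumes "bdry_chart Y k" "closed S"
  shows "closedin X (k ` (half_disc \<inter> S))"
proof -
  have "compactin (top_of_set half_disc) (half_disc \<inter> S)"
    using assms(2) compact_half_disc by (simp add: compactin_subtopology compact_Int_closed)
  then have "compactin X (k ` (half_disc \<inter> S))"
    by (rule image_compactin) (use assms(1) in \<open>simp add: bdry_chart_def\<close>)
  then show ?thesis by (rule compactin_imp_closedin[OF Hausdorff])
qed

text \<open>\<open>\<gamma>\<close> is cut at its first exit from the image of the half-disc of
  radius 1/2 and pulled back to a plane path \<open>Q0\<close>, to which
  \<open>fashoda_half_plane\<close> applies with \<open>R = 1/2\<close>. The start \<open>w0\<close>
  is either the origin, for a curve leaving the boundary point itself, or closer to the origin than
  all of \<open>P\<close>, for an interior path starting nearby.\<close>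

lemma crossing:
  assumes k: "bdry_chart Y k"
    and P: "path P" "\<And>t. t \<in> {0..1} \<Longrightarrow> P t \<in> half_disc \<and> norm (P t) < 1/2"
      "P 0 $ 2 = 0" "P 1 $ 2 = 0" "P 0 $ 1 * P 1 $ 1 < 0"
    and \<gamma>: "pathin (subtopology X Y) \<gamma>" "\<gamma> 0 = k w0" "\<gamma> 1 \<notin> k ` half_disc"
    and w0: "w0 \<in> half_disc" "\<And>t. t \<in> {0..1} \<Longrightarrow> w0 = 0 \<or> norm w0 < norm (P t)"
  obtains s t where "s \<in> {0..1}" "t \<in> {0..1}" "\<gamma> t = k (P s)"
proof -
  have kinj: "inj_on k half_disc" and kY: "k ` half_disc \<subseteq> Y"
    and ko: "openin (subtopology X Y) (k ` {w \<in> half_disc. norm w < 1/2})"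
    by (rule bdry_chartD[OF k], rule bdry_chartD[OF k], rule bdry_chartD(5)[OF k]) simp
  have cm: "continuous_map (top_of_set {0..1}) (subtopology X Y) \<gamma>" using \<gamma>(1) by (simp add: pathin_def)
  have cmX: "continuous_map (top_of_set {0..1}) X \<gamma>" using cm by (simp add: continuous_map_in_subtopology)
  define B where "B = k ` {w \<in> half_disc. norm w < 1/2}"
  define B' where "B' = k ` (half_disc \<inter> cball 0 (1/2))"
  have oB: "openin (subtopology X Y) B" using ko by (simp add: B_def)
  have cB': "closedin X B'" unfolding B'_def by (rule closedin_bdry_chart[OF k]) simp
  have BB': "B \<subseteq> B'" by (auto simp: B_def B'_def)
  have top: "\<gamma> t \<in> topspace (subtopology X Y)" if "t \<in> {0..1}" for t
    using cm that by (auto simp: continuous_map_def)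
  define T where "T = {t \<in> {0..1}. \<gamma> t \<in> topspace (subtopology X Y) - B}"
  have cT: "closed T"
  proof -
    have "closedin (top_of_set {0..1}) {t \<in> topspace (top_of_set {0..1}). \<gamma> t \<in> topspace (subtopology X Y) - B}"
      by (rule closedin_continuous_map_preimage[OF cm]) (use oB in blast)
    then show ?thesis using closedin_closed_trans[of "{0..1::real}"] by (simp add: T_def)
  qed
  have cC: "closed {t \<in> {0..1}. \<gamma> t \<in> B'}"
  proof -
    have "closedin (top_of_set {0..1}) {t \<in> topspace (top_of_set {0..1}). \<gamma> t \<in> B'}"
      by (rule closedin_continuous_map_preimage[OF cmX cB'])
    then show ?thesis using closedin_closed_trans[of "{0..1::real}"] by simp
  qed
  have "B \<subseteq> k ` half_disc" by (auto simp: B_def)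
  then have T1: "1 \<in> T" using \<gamma>(3) top by (auto simp: T_def)
  have bT: "bdd_below T" by (rule bdd_belowI[of _ 0]) (auto simp: T_def)
  define t1 where "t1 = Inf T"
  have t1T: "t1 \<in> T" unfolding t1_def using closed_contains_Inf[OF _ bT cT] T1 by blast
  have t1: "t1 \<in> {0..1}" using t1T by (auto simp: T_def)
  have before: "\<gamma> t \<in> B" if "0 \<le> t" "t < t1" for t
  proof (rule ccontr)
    assume "\<gamma> t \<notin> B"
    then have "t \<in> T" using that t1 top by (auto simp: T_def)
    then have "t1 \<le> t" unfolding t1_def using bT by (intro cInf_lower) auto
    then show False using that by simp
  qed
  have "norm (P 0) < 1/2" using P(2)[of 0] by simp
  then have "norm w0 < 1/2" using w0(2)[of 0] by auto
  then have "\<gamma> 0 \<in> B" using \<gamma>(2) w0(1) by (auto simp: B_def)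
  then have t1pos: "0 < t1" using t1 t1T by (cases "t1 = 0") (auto simp: T_def)
  have inB': "\<gamma> t \<in> B'" if "t \<in> {0..t1}" for t
  proof -
    have "{0..<t1} \<subseteq> {t \<in> {0..1}. \<gamma> t \<in> B'}" using before t1 BB' by auto
    then have "closure {0..<t1} \<subseteq> {t \<in> {0..1}. \<gamma> t \<in> B'}" using cC by (rule closure_minimal)
    then show ?thesis using that t1pos by auto
  qed
  define Q0 where "Q0 t = inv_into half_disc k (\<gamma> (t1 * t))" for t
  have t1t: "t1 * t \<in> {0..t1}" if "t \<in> {0..1}" for t
    using that t1 by (auto simp: mult_left_le)
  have t1t': "t1 * t \<in> {0..1}" if "t \<in> {0..1}" for t using t1t[OF that] t1 by auto
  have kQ0: "Q0 t \<in> half_disc \<and> norm (Q0 t) \<le> 1/2 \<and> k (Q0 t) = \<gamma> (t1 * t)" if t: "t \<in> {0..1}" for t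
  proof -
    obtain w where "w \<in> half_disc" "norm w \<le> 1/2" "\<gamma> (t1 * t) = k w"
      using inB'[OF t1t[OF t]] by (auto simp: B'_def)
    then show ?thesis using kinj by (simp add: Q0_def)
  qed
  have "path Q0"
  proof -
    have "continuous_map (top_of_set {0..1}) (top_of_set {0..1}) (\<lambda>t. t1 * t)"
      using t1t' by (auto simp: continuous_map_in_subtopology intro!: continuous_intros)
    from continuous_map_compose[OF this cmX]
    have "continuous_map (top_of_set {0..1}) X (\<lambda>t. \<gamma> (t1 * t))" by (simp add: o_def)
    moreover have "\<gamma> (t1 * t) \<in> k ` half_disc" if "t \<in> {0..1}" for t
      using inB'[OF t1t[OF that]] by (auto simp: B'_def)
    ultimately have "continuous_map (top_of_set {0..1}) (subtopology X (k ` half_disc)) (\<lambda>t. \<gamma> (t1 * t))"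
      by (auto simp: continuous_map_in_subtopology)
    from continuous_map_compose[OF this bdry_chart_inverse[OF k]]
    show ?thesis by (simp add: path_def o_def Q0_def[abs_def] continuous_map_in_subtopology)
  qed
  have Q00: "Q0 0 = w0" using \<gamma>(2) w0(1) kinj by (simp add: Q0_def)
  have Q01: "1/2 \<le> norm (Q0 1)"
  proof (rule ccontr)
    assume "\<not> 1/2 \<le> norm (Q0 1)"
    then have "Q0 1 \<in> {w \<in> half_disc. norm w < 1/2}" using kQ0[of 1] by simp
    then have "k (Q0 1) \<in> B" unfolding B_def by (rule imageI)
    then show False using kQ0[of 1] t1T by (auto simp: T_def)
  qed
  \<comment> \<open>Fashoda's theorem needs a start on the axis, so the vertical segment below
    \<open>w0\<close> is put in front. Its points have norm at most \<open>norm w0\<close>; hence it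
    can meet \<open>P\<close> only if \<open>w0\<close> is the origin.\<close>
  define w1 :: "real^2" where "w1 = vector [w0 $ 1, 0]"
  define Q where "Q = linepath w1 w0 +++ Q0"
  have seg: "0 \<le> z $ 2 \<and> norm z \<le> norm w0" if z: "z \<in> closed_segment w1 w0" for z
  proof -
    obtain u where u: "0 \<le> u" "u \<le> 1" "z = (1 - u) *\<^sub>R w1 + u *\<^sub>R w0" using z by (auto simp: in_segment)
    have z1: "z $ 1 = w0 $ 1" unfolding u(3) by (simp add: w1_def) (simp add: algebra_simps)
    have z2: "z $ 2 = u * w0 $ 2" unfolding u(3) by (simp add: w1_def)
    have w2: "0 \<le> w0 $ 2" using w0(1) by (simp add: half_disc_def)
    have "u * w0 $ 2 \<le> 1 * w0 $ 2" using u w2 by (intro mult_right_mono) auto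
    then have "(z $ 2)\<^sup>2 \<le> (w0 $ 2)\<^sup>2" using z2 u w2 by (intro power_mono) auto
    then have "norm z \<le> norm w0" by (simp add: norm_vec2 z1)
    moreover have "0 \<le> z $ 2" unfolding z2 using u(1) w2 by simp
    ultimately show ?thesis by blast
  qed
  have Qimg: "z \<in> closed_segment w1 w0 \<or> (\<exists>t\<in>{0..1}. z = Q0 t)" if "z \<in> path_image Q" for z
  proof -
    have "z \<in> path_image (linepath w1 w0) \<union> path_image Q0"
      using that path_image_join_subset[of "linepath w1 w0" Q0] unfolding Q_def by blast
    then show ?thesis by (auto simp: path_image_def[of Q0])
  qed
  obtain s t where st: "s \<in> {0..1}" "t \<in> {0..1}" "P s = Q t"
  proof (rule fashoda_half_plane[of P "1/2" Q])
    show "path Q" unfolding Q_def using \<open>path Q0\<close> Q00 by (simp add: pathstart_def)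
    show "0 \<le> P t $ 2 \<and> norm (P t) < 1/2" if "t \<in> {0..1}" for t
      using P(2)[OF that] by (simp add: half_disc_def)
    show "0 \<le> Q t $ 2 \<and> norm (Q t) \<le> 1" if t: "t \<in> {0..1}" for t
    proof -
      have "Q t \<in> path_image Q" using t by (auto simp: path_image_def)
      then consider "Q t \<in> closed_segment w1 w0" | u where "u \<in> {0..1}" "Q t = Q0 u" using Qimg by blast
      then show ?thesis
      proof cases
        case 1
        then show ?thesis using seg[OF 1] w0(1) by (simp add: half_disc_def)
      next
        case 2
        then show ?thesis using kQ0[of u] by (simp add: half_disc_def)
      qed
    qed
    have "Q 0 = w1" by (simp add: Q_def joinpaths_def linepath_def)
    moreover have "w1 = 0 \<or> w1 $ 2 = 0 \<and> \<bar>w1 $ 1\<bar> < \<bar>P 0 $ 1\<bar> \<and> \<bar>w1 $ 1\<bar> < \<bar>P 1 $ 1\<bar>"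
    proof (cases "w0 = 0")
      case True
      then show ?thesis by (simp add: w1_def vec2_eq_iff)
    next
      case False
      have "\<bar>w0 $ 1\<bar> < norm (P 0)" "\<bar>w0 $ 1\<bar> < norm (P 1)"
        using w0(2)[of 0] w0(2)[of 1] False component_le_norm_cart[of w0 1] by auto
      then show ?thesis using P(3,4) by (simp add: w1_def norm_vec2)
    qed
    ultimately show "Q 0 = 0 \<or> Q 0 $ 2 = 0 \<and> \<bar>Q 0 $ 1\<bar> < \<bar>P 0 $ 1\<bar> \<and> \<bar>Q 0 $ 1\<bar> < \<bar>P 1 $ 1\<bar>" by simp
    show "1/2 \<le> norm (Q 1)" using Q01 by (simp add: Q_def joinpaths_def)
  qed (use P in auto)
  have "Q t \<in> path_image Q" using st by (auto simp: path_image_def)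
  then consider "Q t \<in> closed_segment w1 w0" | u where "u \<in> {0..1}" "Q t = Q0 u" using Qimg by blast
  then show ?thesis
  proof cases
    case 1
    then have "norm (P s) \<le> norm w0" using seg st by simp
    then have z: "w0 = 0" using w0(2)[OF st(1)] by auto
    then have "P s = 0" using \<open>norm (P s) \<le> norm w0\<close> by simp
    then show ?thesis using that[of s 0] st \<gamma>(2) z by simp
  next
    case 2
    then show ?thesis using that[of s "t1 * u"] st kQ0[of u] t1t'[of u] by simp
  qed
qed

end

section \<open>The intrinsic metric\<close>

locale bordered_surface = surface X A g
  for X :: "'a topology" and A :: "'a chart set" and g :: "'a metric_components" +
  fixes Y :: "'a set"
  assumes submanifold: "C0_submanifold_bd X Y" and compact: "compactin X Y"
    and finite_rho: "\<And>x y. x \<in> Y \<Longrightarrow> y \<in> Y \<Longrightarrow> rho X A g Y x y < \<infinity>"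
begin

abbreviation U where "U \<equiv> mf_interior X Y"
abbreviation D where "D \<equiv> dist_in (mf_interior X Y)"
abbreviation \<rho> where "\<rho> \<equiv> rho X A g Y"

lemma Y_subset: "Y \<subseteq> topspace X"
  using submanifold by (simp add: C0_submanifold_bd_def)

lemma U_subset: "U \<subseteq> Y"
  by (auto simp: mf_interior_def)

lemma openin_U: "openin X U"
  by (rule openin_mf_interior[OF Y_subset])

lemma interior_dist_eq: "interior_dist X A g Y x y = D x y"
  by (simp add: interior_dist_def dist_in_def)

text \<open>Unfolds the filter of the lower limit into neighbourhoods. Afterwards the lower limit is
  accessed only through \<open>rho_lessD\<close>, \<open>rho_greaterD\<close> and
  \<open>rho_leI\<close>.\<close>

lemma eventually_rho_filter:
  assumes "x \<in> topspace X" "y \<in> topspace X"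
  shows "eventually P (inf (nhdsin X x \<times>\<^sub>F nhdsin X y) (principal (U \<times> U))) \<longleftrightarrow>
    (\<exists>Ox Oy. openin X Ox \<and> x \<in> Ox \<and> openin X Oy \<and> y \<in> Oy \<and> (\<forall>x'\<in>Ox \<inter> U. \<forall>y'\<in>Oy \<inter> U. P (x', y')))"
    (is "?L \<longleftrightarrow> ?R")
proof
  assume ?L
  then obtain Pf Pg where P: "eventually Pf (nhdsin X x)" "eventually Pg (nhdsin X y)"
    "\<And>a b. Pf a \<Longrightarrow> Pg b \<Longrightarrow> (a, b) \<in> U \<times> U \<longrightarrow> P (a, b)"
    unfolding eventually_inf_principal eventually_prod_filter by blast
  obtain Ox where Ox: "openin X Ox" "x \<in> Ox" "\<forall>a\<in>Ox. Pf a"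
    using P(1) assms(1) unfolding eventually_nhdsin by blast
  obtain Oy where Oy: "openin X Oy" "y \<in> Oy" "\<forall>a\<in>Oy. Pg a"
    using P(2) assms(2) unfolding eventually_nhdsin by blast
  show ?R using Ox Oy P(3) by blast
next
  assume ?R
  then obtain Ox Oy where O: "openin X Ox" "x \<in> Ox" "openin X Oy" "y \<in> Oy"
    "\<forall>x'\<in>Ox \<inter> U. \<forall>y'\<in>Oy \<inter> U. P (x', y')" by blast
  have "eventually (\<lambda>a. a \<in> Ox) (nhdsin X x)" "eventually (\<lambda>a. a \<in> Oy) (nhdsin X y)"
    unfolding eventually_nhdsin using O by blast+
  then show ?L
    unfolding eventually_inf_principal eventually_prod_filter using O(5) by blast
qed

lemma rho_lessD:
  assumes "\<rho> x y < c" "openin X Ox" "x \<in> Ox" "openin X Oy" "y \<in> Oy"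
  obtains x' y' where "x' \<in> Ox" "x' \<in> U" "y' \<in> Oy" "y' \<in> U" "D x' y' < c"
proof (rule ccontr)
  assume n: "\<not> thesis"
  have xy: "x \<in> topspace X" "y \<in> topspace X" using assms openin_subset by blast+
  have "\<forall>x'\<in>Ox \<inter> U. \<forall>y'\<in>Oy \<inter> U. c \<le> D x' y'"
    using n that by (meson IntD1 IntD2 not_less)
  then have "eventually (\<lambda>z. c \<le> (case z of (x', y') \<Rightarrow> interior_dist X A g Y x' y'))
      (inf (nhdsin X x \<times>\<^sub>F nhdsin X y) (principal (U \<times> U)))"
    unfolding eventually_rho_filter[OF xy] using assms(2-5) by (auto simp: interior_dist_eq)
  then have "c \<le> \<rho> x y" unfolding rho_def by (rule Liminf_bounded)
  then show False using assms(1) by simp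
qed

lemma rho_greaterD:
  assumes "c < \<rho> x y" "x \<in> topspace X" "y \<in> topspace X"
  obtains Ox Oy where "openin X Ox" "x \<in> Ox" "openin X Oy" "y \<in> Oy"
    "\<And>x' y'. x' \<in> Ox \<Longrightarrow> x' \<in> U \<Longrightarrow> y' \<in> Oy \<Longrightarrow> y' \<in> U \<Longrightarrow> c < D x' y'"
proof -
  have "eventually (\<lambda>z. c < (case z of (x', y') \<Rightarrow> interior_dist X A g Y x' y'))
      (inf (nhdsin X x \<times>\<^sub>F nhdsin X y) (principal (U \<times> U)))"
    using assms(1) unfolding rho_def by (rule less_LiminfD)
  then obtain Ox Oy where "openin X Ox" "x \<in> Ox" "openin X Oy" "y \<in> Oy"
    "\<forall>x'\<in>Ox \<inter> U. \<forall>y'\<in>Oy \<inter> U. c < D x' y'"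
    unfolding eventually_rho_filter[OF assms(2,3)] interior_dist_eq by auto
  then show ?thesis using that[of Ox Oy] by blast
qed

lemma rho_leI:
  assumes "x \<in> topspace X" "y \<in> topspace X"
    and "\<And>Ox Oy. openin X Ox \<Longrightarrow> x \<in> Ox \<Longrightarrow> openin X Oy \<Longrightarrow> y \<in> Oy \<Longrightarrow>
      \<exists>x' y'. x' \<in> Ox \<and> x' \<in> U \<and> y' \<in> Oy \<and> y' \<in> U \<and> D x' y' \<le> c"
  shows "\<rho> x y \<le> c"
proof (rule ccontr)
  assume "\<not> \<rho> x y \<le> c"
  then have "c < \<rho> x y" by simp
  then obtain Ox Oy where O: "openin X Ox" "x \<in> Ox" "openin X Oy" "y \<in> Oy"
    "\<And>x' y'. x' \<in> Ox \<Longrightarrow> x' \<in> U \<Longrightarrow> y' \<in> Oy \<Longrightarrow> y' \<in> U \<Longrightarrow> c < D x' y'"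
    using rho_greaterD assms(1,2) by metis
  from assms(3)[OF O(1-4)] O(5) show False by (meson leD)
qed

lemma rho_le_D: "x \<in> U \<Longrightarrow> y \<in> U \<Longrightarrow> \<rho> x y \<le> D x y"
  using U_subset Y_subset by (intro rho_leI) blast+

lemma rho_sym: "x \<in> Y \<Longrightarrow> y \<in> Y \<Longrightarrow> \<rho> x y = \<rho> y x"
proof -
  have "\<rho> x y \<le> \<rho> y x" if "x \<in> Y" "y \<in> Y" for x y
  proof (rule ccontr)
    assume "\<not> \<rho> x y \<le> \<rho> y x"
    then have "\<rho> y x < \<rho> x y" by simp
    moreover have "x \<in> topspace X" "y \<in> topspace X" using that Y_subset by auto
    ultimately obtain c where c: "\<rho> y x < c" "c < \<rho> x y" using dense by blast
    obtain Ox Oy where O: "openin X Ox" "x \<in> Ox" "openin X Oy" "y \<in> Oy"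
      "\<And>x' y'. x' \<in> Ox \<Longrightarrow> x' \<in> U \<Longrightarrow> y' \<in> Oy \<Longrightarrow> y' \<in> U \<Longrightarrow> c < D x' y'"
      using rho_greaterD[OF c(2) \<open>x \<in> topspace X\<close> \<open>y \<in> topspace X\<close>] by metis
    obtain y' x' where "y' \<in> Oy" "y' \<in> U" "x' \<in> Ox" "x' \<in> U" "D y' x' < c"
      using rho_lessD[OF c(1) O(3,4,1,2)] by metis
    then show False using O(5)[of x' y'] by (simp add: dist_in_sym[of U y' x'])
  qed
  then show "x \<in> Y \<Longrightarrow> y \<in> Y \<Longrightarrow> \<rho> x y = \<rho> y x" by (simp add: antisym)
qed

text \<open>Lower semicontinuity, automatic for a lower limit: a bound below
  \<open>\<rho> x y\<close> holds for \<open>D\<close> on neighbourhoods of \<open>x\<close> and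
  \<open>y\<close>, and these are also neighbourhoods of all points nearby.\<close>

lemma closedin_rho_le: "closedin (prod_topology X X) {z \<in> topspace X \<times> topspace X. \<rho> (fst z) (snd z) \<le> c}"
proof -
  have "openin (prod_topology X X) {z \<in> topspace X \<times> topspace X. c < \<rho> (fst z) (snd z)}"
  proof (subst openin_prod_topology_alt, intro allI impI)
    fix x y assume "(x, y) \<in> {z \<in> topspace X \<times> topspace X. c < \<rho> (fst z) (snd z)}"
    then have xy: "x \<in> topspace X" "y \<in> topspace X" "c < \<rho> x y" by auto
    obtain d where d: "c < d" "d < \<rho> x y" using xy(3) dense by blast
    obtain Ox Oy where O: "openin X Ox" "x \<in> Ox" "openin X Oy" "y \<in> Oy"
      "\<And>x' y'. x' \<in> Ox \<Longrightarrow> x' \<in> U \<Longrightarrow> y' \<in> Oy \<Longrightarrow> y' \<in> U \<Longrightarrow> d < D x' y'"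
      using rho_greaterD[OF d(2) xy(1,2)] by metis
    have "c < \<rho> u v" if uv: "u \<in> Ox" "v \<in> Oy" for u v
    proof (rule ccontr)
      assume "\<not> c < \<rho> u v"
      then have "\<rho> u v < d" using d(1) by simp
      then obtain x' y' where "x' \<in> Ox" "x' \<in> U" "y' \<in> Oy" "y' \<in> U" "D x' y' < d"
        using rho_lessD[OF _ O(1) uv(1) O(3) uv(2)] by metis
      then show False using O(5)[of x' y'] by simp
    qed
    then have "Ox \<times> Oy \<subseteq> {z \<in> topspace X \<times> topspace X. c < \<rho> (fst z) (snd z)}"
      using openin_subset[OF O(1)] openin_subset[OF O(3)] by auto
    then show "\<exists>Ua Va. openin X Ua \<and> openin X Va \<and> x \<in> Ua \<and> y \<in> Va \<and>
        Ua \<times> Va \<subseteq> {z \<in> topspace X \<times> topspace X. c < \<rho> (fst z) (snd z)}"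
      using O(1-4) by blast
  qed
  moreover have "topspace (prod_topology X X) - {z \<in> topspace X \<times> topspace X. \<rho> (fst z) (snd z) \<le> c}
     = {z \<in> topspace X \<times> topspace X. c < \<rho> (fst z) (snd z)}" by auto
  ultimately show ?thesis unfolding closedin_def by auto
qed

lemma bdry_chart_0:
  assumes k: "bdry_chart Y k" and O: "openin X O'" "k 0 \<in> O'" "0 < s"
  obtains w where "w \<in> half_disc" "0 < w $ 2" "norm w < s" "k w \<in> O'"
proof -
  have "openin (top_of_set half_disc) {w \<in> topspace (top_of_set half_disc). k w \<in> O'}"
    using bdry_chartD(1)[OF k] O(1) by (rule openin_continuous_map_preimage)
  then obtain T where T: "open T" "{w \<in> half_disc. k w \<in> O'} = half_disc \<inter> T"
    by (auto simp: openin_open)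
  have "0 \<in> half_disc" by (simp add: half_disc_def)
  then have "0 \<in> T" using T(2) O(2) by auto
  then obtain e where e: "0 < e" "ball 0 e \<subseteq> T" using T(1) openE by blast
  define r where "r = min (1/2) (min (e/2) (s/2))"
  have r: "0 < r" "r < 1" "r < e" "r < s" using e(1) O(3) by (auto simp: r_def)
  define w :: "real^2" where "w = vector [0, r]"
  have n: "norm w = r" using r by (simp add: w_def norm_vector_2)
  have hw: "w \<in> half_disc" using n r by (simp add: half_disc_def) (simp add: w_def)
  have "w \<in> T" using e(2) n r by (auto simp: subset_iff)
  then have "k w \<in> O'" using T(2) hw by blast
  then show ?thesis using that[of w] hw n r by (simp add: w_def)
qed

text \<open>Ensures that the filter defining \<open>rho\<close> is proper at boundary points, which
  are approached along the vertical radius of a half-disc chart.\<close>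

lemma U_dense:
  assumes y: "y \<in> Y" and O: "openin X O'" "y \<in> O'"
  obtains x where "x \<in> O'" "x \<in> U"
proof (cases "y \<in> U")
  case True
  then show ?thesis using that O by blast
next
  case False
  then have b: "y \<in> mf_boundary X Y" using y by (simp add: mf_boundary_def)
  obtain c where c: "c \<in> A" "y \<in> fst c" using chart_at y Y_subset by blast
  obtain k where k: "bdry_chart Y k" "k 0 = y" using bdry_chart_exists[OF submanifold b c O] by metis
  obtain w where "w \<in> half_disc" "0 < w $ 2" "k w \<in> O'"
    using bdry_chart_0[OF k(1) O(1)] O(2) k(2) by (metis zero_less_one)
  then show ?thesis using that bdry_chartD(4)[OF k(1)] by blast
qed

lemma rho_self: "y \<in> Y \<Longrightarrow> \<rho> y y = 0"
proof -
  assume y: "y \<in> Y"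
  then have t: "y \<in> topspace X" using Y_subset by blast
  have "\<rho> y y \<le> 0"
  proof (rule rho_leI[OF t t])
    fix Ox Oy assume O: "openin X Ox" "y \<in> Ox" "openin X Oy" "y \<in> Oy"
    have "openin X (Ox \<inter> Oy)" "y \<in> Ox \<inter> Oy" using O by auto
    then obtain x where "x \<in> Ox \<inter> Oy" "x \<in> U" using U_dense[OF y] by blast
    then show "\<exists>x' y'. x' \<in> Ox \<and> x' \<in> U \<and> y' \<in> Oy \<and> y' \<in> U \<and> D x' y' \<le> 0"
      using dist_in_self[OF openin_U] by (intro exI[of _ x]) auto
  qed
  then show ?thesis by simp
qed

text \<open>The bound for \<open>D\<close> is applied to interior points near \<open>x\<close> and
  \<open>y\<close>. Strictness is lost in the passage to \<open>y\<close>, hence the closed ball in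
  the conclusion.\<close>

lemma rho_escape:
  assumes c: "c \<in> A" and \<kappa>: "\<And>x v. x \<in> cball x0 R \<Longrightarrow> \<kappa> * norm v \<le> sqrt (qform c x v)" "0 < \<kappa>"
    and R: "cball x0 R \<subseteq> rng c" "r < R"
    and x: "x \<in> fst c" "snd c x \<in> ball x0 r" and y: "y \<in> topspace X"
    and lt: "\<rho> x y < ennreal (\<kappa> * (R - r))"
  shows "y \<in> fst c \<and> snd c y \<in> cball x0 R"
proof (rule ccontr)
  assume n: "\<not> ?thesis"
  define Ox where "Ox = {p \<in> fst c. snd c p \<in> ball x0 r}"
  define B' where "B' = {p \<in> fst c. snd c p \<in> cball x0 R}"
  have "openin X Ox" unfolding Ox_def by (rule openin_chart_preimage[OF c]) simp
  moreover have "x \<in> Ox" using x by (simp add: Ox_def)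
  moreover have "closedin X B'" unfolding B'_def by (rule closedin_chart_compact[OF c _ R(1)]) simp
  then have "openin X (topspace X - B')" by blast
  moreover have "y \<in> topspace X - B'" using n y by (simp add: B'_def)
  ultimately obtain x' y' where xy: "x' \<in> Ox" "y' \<in> topspace X - B'" "D x' y' < ennreal (\<kappa> * (R - r))"
    using rho_lessD[OF lt] by metis
  have "y' \<in> fst c \<and> snd c y' \<in> ball x0 R"
    by (rule dist_in_escape[OF c \<kappa> R _ _ xy(3)]) (use xy(1) in \<open>auto simp: Ox_def\<close>)
  then show False using xy(2) by (auto simp: B'_def less_imp_le)
qed

text \<open>\<open>crosscut_exists\<close> for the coordinate expression \<open>h\<close> of the
  boundary chart, pulled back to the half-disc. Points of the open arc are joined by subarcs, whose
  length is controlled by the radius of the circle. The number \<open>s\<close> is a gap between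
  crosscut and origin, so that points of smaller norm can serve as starting points in
  \<open>crossing\<close>.\<close>

lemma short_crosscut:
  assumes k: "bdry_chart Y k" and c: "c \<in> A" "k ` half_disc \<subseteq> fst c" and \<epsilon>: "0 < \<epsilon>"
    and O: "openin X O'" "k 0 \<in> O'"
  obtains P s where "path P" "\<And>t. t \<in> {0..1} \<Longrightarrow> P t \<in> half_disc \<and> norm (P t) < 1/2 \<and> s < norm (P t) \<and> k (P t) \<in> O'"
    "0 < s" "P 0 $ 2 = 0" "P 1 $ 2 = 0" "P 0 $ 1 * P 1 $ 1 < 0"
    "\<And>t. 0 < t \<Longrightarrow> t < 1 \<Longrightarrow> 0 < P t $ 2"
    "\<And>t u. 0 < t \<Longrightarrow> t < 1 \<Longrightarrow> 0 < u \<Longrightarrow> u < 1 \<Longrightarrow> D (k (P t)) (k (P u)) \<le> ennreal \<epsilon>"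
proof -
  define h where "h w = snd c (k w)" for w
  have kc: "k w \<in> fst c" if "w \<in> half_disc" for w using c(2) that by blast
  have kinv: "crd_inv c (h w) = k w" if "w \<in> half_disc" for w
    using kc[OF that] c(1) by (simp add: h_def)
  have "continuous_map (top_of_set half_disc) (subtopology X (fst c)) k"
    using bdry_chartD(1)[OF k] c(2) by (auto simp: continuous_map_in_subtopology)
  from continuous_map_compose[OF this continuous_map_chart[OF c(1)]]
  have conth: "continuous_on half_disc h" by (simp add: o_def h_def[abs_def])
  have injh: "inj_on h half_disc"
  proof (rule inj_onI)
    fix w w' assume w: "w \<in> half_disc" "w' \<in> half_disc" "h w = h w'"
    then have "k w = k w'" using kinv by metis
    then show "w = w'" using inj_onD[OF bdry_chartD(2)[OF k]] w by blast
  qed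
  have 0: "0 \<in> half_disc" by (simp add: half_disc_def)
  define V where "V = snd c ` (fst c \<inter> O')"
  have "open V" unfolding V_def by (rule open_chart_image[OF c(1) O(1)])
  moreover have "h 0 \<in> V" using kc[OF 0] O(2) by (auto simp: V_def h_def)
  ultimately obtain R where R: "0 < R" "cball (h 0) R \<subseteq> V" using open_contains_cball by blast
  define K where "K = cball (h 0) R"
  have K: "compact K" "K \<subseteq> rng c" "K \<noteq> {}" using R by (auto simp: K_def V_def)
  obtain C where C: "0 < C" "\<And>x v. x \<in> K \<Longrightarrow> sqrt (qform c x v) \<le> C * norm v"
    using qform_bounds[OF c(1) K] by metis
  obtain r0 where r0: "0 < r0" "\<And>w. w \<in> half_disc \<Longrightarrow> 1/2 \<le> norm w \<Longrightarrow> r0 \<le> dist (h 0) (h w)"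
  proof -
    define S where "S = half_disc \<inter> - ball 0 (1/2)"
    have "compact S" unfolding S_def by (intro compact_Int_closed compact_half_disc) auto
    then have "compact (h ` S)" by (intro compact_continuous_image continuous_on_subset[OF conth]) (auto simp: S_def)
    moreover have "h 0 \<notin> h ` S"
    proof
      assume "h 0 \<in> h ` S"
      then obtain w where w: "w \<in> S" "h 0 = h w" by auto
      then have "0 = w" using inj_onD[OF injh w(2) 0] by (auto simp: S_def)
      then show False using w(1) by (simp add: S_def)
    qed
    ultimately obtain d where d: "0 < d" "\<And>z. z \<in> h ` S \<Longrightarrow> d \<le> dist (h 0) z"
      using separate_point_closed[of "h ` S" "h 0"] compact_imp_closed by metis
    show ?thesis by (rule that[OF d(1)]) (auto simp: S_def intro!: d(2) imageI)
  qed
  \<comment> \<open>\<open>r0 / 2\<close> keeps the circle off the image of the part of norm at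
    least 1/2, \<open>R\<close> keeps it inside \<open>K\<close> and over \<open>O'\<close>, and the
    last term makes the length bound \<open>C * (2 * pi * (r + r))\<close> at most
    \<open>\<epsilon>\<close>.\<close>
  define r where "r = min (r0 / 2) (min R (\<epsilon> / (C * (2 * pi * 2))))"
  have q: "0 < C * (2 * pi * 2)" using C(1) by simp
  have "r \<le> \<epsilon> / (C * (2 * pi * 2))" unfolding r_def by simp
  then have "r * (C * (2 * pi * 2)) \<le> \<epsilon>" using pos_le_divide_eq[OF q] by blast
  then have r4: "C * (2 * pi * (r + r)) \<le> \<epsilon>" by (simp add: algebra_simps)
  have "0 < r" unfolding r_def using r0(1) R(1) \<epsilon> q by simp
  moreover have "r < r0" "r \<le> R" using r0(1) by (auto simp: r_def min_less_iff_disj)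
  ultimately have r: "0 < r" "r < r0" "r \<le> R" "C * (2 * pi * (r + r)) \<le> \<epsilon>" using r4 by auto
  have out: "r < dist (h 0) (h w)" if "w \<in> half_disc" "1/2 \<le> norm w" for w
    using r0(2)[OF that] r(2) by simp
  obtain \<alpha> \<beta> x y where cr: "\<alpha> < \<beta>" "\<beta> \<le> \<alpha> + 2 * pi" "x * y < 0" "\<bar>x\<bar> < 1/2" "\<bar>y\<bar> < 1/2"
    "circ (h 0) r \<alpha> = h (vector [x, 0])" "circ (h 0) r \<beta> = h (vector [y, 0])"
    "\<And>t. \<alpha> < t \<Longrightarrow> t < \<beta> \<Longrightarrow> \<exists>w. 0 < w $ 2 \<and> norm w < 1/2 \<and> circ (h 0) r t = h w"
    by (rule crosscut_exists[OF conth injh r(1)], erule (1) out, rule that)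
  obtain hi where hom: "homeomorphism half_disc (h ` half_disc) h hi"
    using homeomorphism_compact[OF compact_half_disc conth refl injh] by blast
  have hi: "hi (h w) = w" if "w \<in> half_disc" for w using homeomorphism_apply1[OF hom that] .
  define \<tau> where "\<tau> t = \<alpha> + (\<beta> - \<alpha>) * t" for t
  define P where "P t = hi (circ (h 0) r (\<tau> t))" for t
  have xy: "vector [x, 0] \<in> half_disc" "vector [y, 0] \<in> half_disc"
    "norm (vector [x, 0] :: real^2) < 1/2" "norm (vector [y, 0] :: real^2) < 1/2"
    using cr(4,5) by (auto simp: half_disc_def norm_vector_2)
  have \<tau>01: "\<tau> 0 = \<alpha>" "\<tau> 1 = \<beta>" by (simp_all add: \<tau>_def)
  have \<tau>in: "\<alpha> < \<tau> t \<and> \<tau> t < \<beta>" if "0 < t" "t < 1" for t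
  proof -
    define z where "z = (\<beta> - \<alpha>) * t"
    have "0 < z" "z < \<beta> - \<alpha>"
      using that cr(1) mult_strict_left_mono[of t 1 "\<beta> - \<alpha>"] by (simp_all add: z_def)
    then show ?thesis unfolding \<tau>_def z_def[symmetric] by simp
  qed
  have P0: "P 0 = vector [x, 0]" and P1: "P 1 = vector [y, 0]"
    using cr(6,7) hi xy by (simp_all add: P_def \<tau>01)
  have arc: "\<exists>w. w \<in> half_disc \<and> 0 < w $ 2 \<and> norm w < 1/2 \<and> circ (h 0) r t = h w" if t: "\<alpha> < t" "t < \<beta>" for t
  proof -
    obtain w where w: "0 < w $ 2" "norm w < 1/2" "circ (h 0) r t = h w" using cr(8)[OF t] by blast
    then show ?thesis by (intro exI[of _ w]) (simp add: half_disc_def)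
  qed
  have Pin: "P t \<in> half_disc \<and> 0 < P t $ 2 \<and> norm (P t) < 1/2 \<and> h (P t) = circ (h 0) r (\<tau> t)" if t: "0 < t" "t < 1" for t
  proof -
    obtain w where w: "w \<in> half_disc" "0 < w $ 2" "norm w < 1/2" "circ (h 0) r (\<tau> t) = h w"
      using arc \<tau>in[OF t] by blast
    then have "P t = w" using hi by (simp add: P_def)
    then show ?thesis using w by simp
  qed
  have Pall: "P t \<in> half_disc \<and> norm (P t) < 1/2 \<and> h (P t) = circ (h 0) r (\<tau> t)" if t: "t \<in> {0..1}" for t
  proof -
    consider "t = 0" | "t = 1" | "0 < t" "t < 1" using t by fastforce
    then show ?thesis
      by cases (use P0 P1 xy cr(6,7) \<tau>01 Pin[of t] in auto)
  qed
  obtain s where s: "0 < s" "\<And>w. w \<in> half_disc \<Longrightarrow> norm w \<le> s \<Longrightarrow> dist (h 0) (h w) < r"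
  proof -
    obtain d where d: "d > 0" "\<And>w. w \<in> half_disc \<Longrightarrow> dist w 0 < d \<Longrightarrow> dist (h w) (h 0) < r"
      using conth 0 r(1) unfolding continuous_on_iff by metis
    show ?thesis
    proof (rule that[of "d/2"])
      fix w assume w: "w \<in> half_disc" "norm w \<le> d/2"
      then have "dist w 0 < d" using d(1) by (auto simp: dist_norm)
      then show "dist (h 0) (h w) < r" using d(2)[OF w(1)] by (simp add: dist_commute)
    qed (use d(1) in auto)
  qed
  show ?thesis
  proof (rule that)
    have "continuous_on (h ` half_disc) hi" using hom by (simp add: homeomorphism_def)
    moreover have "continuous_on {0..1} (\<lambda>t. circ (h 0) r (\<tau> t))"
      unfolding \<tau>_def by (intro continuous_intros)
    moreover have "(\<lambda>t. circ (h 0) r (\<tau> t)) ` {0..1} \<subseteq> h ` half_disc"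
    proof
      fix z assume "z \<in> (\<lambda>t. circ (h 0) r (\<tau> t)) ` {0..1}"
      then obtain t where t: "t \<in> {0..1}" "z = circ (h 0) r (\<tau> t)" by auto
      then show "z \<in> h ` half_disc" using Pall[OF t(1)] by (metis imageI)
    qed
    ultimately show "path P" unfolding path_def P_def by (rule continuous_on_compose2)
    show "P t \<in> half_disc \<and> norm (P t) < 1/2 \<and> s < norm (P t) \<and> k (P t) \<in> O'" if t: "t \<in> {0..1}" for t
    proof -
      have d: "dist (h 0) (h (P t)) = r" using Pall[OF t] r(1) by simp
      then have "s < norm (P t)" using s(2)[of "P t"] Pall[OF t] by force
      moreover have "h (P t) \<in> V" using d r(3) R(2) by auto
      then have "k (P t) \<in> O'"
      proof -
        obtain p where p: "p \<in> fst c" "p \<in> O'" "h (P t) = snd c p" using \<open>h (P t) \<in> V\<close> by (auto simp: V_def)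
        then have "k (P t) = p" using kinv[of "P t"] Pall[OF t] c(1) by simp
        then show ?thesis using p by simp
      qed
      ultimately show ?thesis using Pall[OF t] by simp
    qed
    show "0 < s" by (rule s(1))
    show "P 0 $ 2 = 0" "P 1 $ 2 = 0" "P 0 $ 1 * P 1 $ 1 < 0" using P0 P1 cr(3) by simp_all
    show "0 < P t $ 2" if "0 < t" "t < 1" for t using Pin[OF that] by simp
    have *: "D (k (P t)) (k (P u)) \<le> ennreal \<epsilon>" if tu: "0 < t" "t \<le> u" "u < 1" for t u
    proof -
      let ?v = "r *\<^sub>R axis 1 1 :: real^2" and ?w = "r *\<^sub>R axis 2 1 :: real^2"
      let ?E = "ellipse_arc (h 0) ?v ?w (\<tau> t) (\<tau> u - \<tau> t)"
      have E: "?E z = circ (h 0) r (\<tau> t + (\<tau> u - \<tau> t) * z)" for z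
        by (simp add: ellipse_arc_def circ_def vec2_eq_iff axis_def)
      have tt: "\<alpha> < \<tau> t" "\<tau> u < \<beta>" "\<tau> t \<le> \<tau> u"
        using \<tau>in[of t] \<tau>in[of u] tu cr(1) by (auto simp: \<tau>_def mult_left_mono)
      have im: "?E z \<in> K \<and> crd_inv c (?E z) \<in> U" if z: "z \<in> {0..1}" for z
      proof -
        define y where "y = (\<tau> u - \<tau> t) * z"
        have "0 \<le> y" "y \<le> \<tau> u - \<tau> t"
          using z tt(3) mult_left_mono[of z 1 "\<tau> u - \<tau> t"] by (simp_all add: y_def)
        then have "\<alpha> < \<tau> t + y" "\<tau> t + y < \<beta>" using tt by linarith+
        then have "\<alpha> < \<tau> t + (\<tau> u - \<tau> t) * z" "\<tau> t + (\<tau> u - \<tau> t) * z < \<beta>"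
          unfolding y_def by blast+
        then obtain w where w: "w \<in> half_disc" "0 < w $ 2" "?E z = h w" using arc E by metis
        then have "crd_inv c (?E z) \<in> U" using kinv bdry_chartD(4)[OF k w(1)] by simp
        moreover have "?E z \<in> K" unfolding E K_def using r by simp
        ultimately show ?thesis by simp
      qed
      have "D (crd_inv c (?E 0)) (crd_inv c (?E 1)) \<le> ennreal (C * (\<bar>\<tau> u - \<tau> t\<bar> * (norm ?v + norm ?w)))"
        by (rule dist_in_ellipse_arc[OF c(1) C(2) less_imp_le[OF C(1)] K(2) openin_U im])
      also have "\<dots> \<le> ennreal \<epsilon>"
      proof (rule ennreal_leI)
        have "\<bar>\<tau> u - \<tau> t\<bar> \<le> 2 * pi" using tt cr(2) by auto
        then have "C * (\<bar>\<tau> u - \<tau> t\<bar> * (norm ?v + norm ?w)) \<le> C * (2 * pi * (r + r))"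
          using C(1) r(1) by (intro mult_left_mono mult_mono) (auto simp: norm_axis_1)
        then show "C * (\<bar>\<tau> u - \<tau> t\<bar> * (norm ?v + norm ?w)) \<le> \<epsilon>" using r(4) by linarith
      qed
      also have "crd_inv c (?E 0) = k (P t)" using Pin[of t] kinv[of "P t"] tu by (simp add: E)
      also have "crd_inv c (?E 1) = k (P u)" using Pin[of u] kinv[of "P u"] tu by (simp add: E)
      finally show ?thesis .
    qed
    show "D (k (P t)) (k (P u)) \<le> ennreal \<epsilon>" if "0 < t" "t < 1" "0 < u" "u < 1" for t u
      using *[of t u] *[of u t] that dist_in_sym by (cases "t \<le> u") auto
  qed
qed

end

section \<open>Triangle inequality and existence of shortest paths\<close>

context bordered_surface
begin

text \<open>Two points of a small coordinate ball are joined by their segment, which lies in the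
  ball by convexity; \<open>ellipse_arc\<close> with \<open>w = 0\<close> and angle
  \<open>pi\<close> runs along it from \<open>p\<close> to \<open>q\<close>.\<close>

lemma D_small:
  assumes y: "y \<in> U" and e: "0 < e"
  obtains O' where "openin X O'" "y \<in> O'" "\<And>p q. p \<in> O' \<Longrightarrow> q \<in> O' \<Longrightarrow> D p q \<le> ennreal e"
proof -
  have "y \<in> topspace X" using y U_subset Y_subset by blast
  then obtain c where c: "c \<in> A" "y \<in> fst c" by (rule chart_at)
  define V where "V = snd c ` (fst c \<inter> U)"
  have "open V" unfolding V_def by (rule open_chart_image[OF c(1) openin_U])
  moreover have "snd c y \<in> V" using c y by (auto simp: V_def)
  ultimately obtain R where R: "0 < R" "cball (snd c y) R \<subseteq> V" using open_contains_cball by blast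
  define K where "K = cball (snd c y) R"
  have K: "compact K" "K \<subseteq> rng c" "K \<noteq> {}" using R by (auto simp: K_def V_def)
  have KU: "crd_inv c x \<in> U" if x: "x \<in> K" for x
  proof -
    obtain p where "p \<in> fst c" "p \<in> U" "x = snd c p" using x R(2) by (auto simp: K_def V_def)
    then show ?thesis using c(1) by simp
  qed
  obtain C where C: "0 < C" "\<And>x v. x \<in> K \<Longrightarrow> sqrt (qform c x v) \<le> C * norm v"
    using qform_bounds[OF c(1) K] by metis
  define \<delta> where "\<delta> = min R (e / (C * pi))"
  have \<delta>: "0 < \<delta>" "\<delta> \<le> R" using R(1) e C(1) by (auto simp: \<delta>_def)
  have "\<delta> \<le> e / (C * pi)" by (simp add: \<delta>_def)
  then have \<delta>e: "\<delta> * (C * pi) \<le> e" using pos_le_divide_eq[of "C * pi" \<delta> e] C(1) by simp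
  show ?thesis
  proof (rule that)
    show "openin X {p \<in> fst c. snd c p \<in> ball (snd c y) \<delta>}" by (rule openin_chart_preimage[OF c(1)]) simp
    show "y \<in> {p \<in> fst c. snd c p \<in> ball (snd c y) \<delta>}" using c \<delta> by simp
    fix p q assume pq: "p \<in> {p \<in> fst c. snd c p \<in> ball (snd c y) \<delta>}" "q \<in> {p \<in> fst c. snd c p \<in> ball (snd c y) \<delta>}"
    define v m where "v = (1/2) *\<^sub>R (snd c p - snd c q)" and "m = (1/2) *\<^sub>R (snd c p + snd c q)"
    let ?E = "ellipse_arc m v 0 0 pi"
    have E: "?E t = ((1 + cos (pi * t)) / 2) *\<^sub>R snd c p + ((1 - cos (pi * t)) / 2) *\<^sub>R snd c q" for t
      by (simp add: ellipse_arc_def v_def m_def vec2_eq_iff field_simps)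
    have im: "?E t \<in> K \<and> crd_inv c (?E t) \<in> U" for t
    proof -
      have "?E t \<in> ball (snd c y) \<delta>"
        unfolding E using pq cos_ge_minus_one[of "pi * t"] cos_le_one[of "pi * t"]
        by (intro convexD[OF convex_ball]) (auto simp: field_simps simp del: cos_ge_minus_one cos_le_one)
      then have "?E t \<in> K" using \<delta>(2) by (simp add: K_def)
      then show ?thesis using KU by simp
    qed
    have E0: "?E 0 = snd c p" "?E 1 = snd c q" by (simp_all add: E)
    have "D (crd_inv c (?E 0)) (crd_inv c (?E 1)) \<le> ennreal (C * (\<bar>pi\<bar> * (norm v + norm (0::real^2))))"
      by (rule dist_in_ellipse_arc[OF c(1) C(2) less_imp_le[OF C(1)] K(2) openin_U im])
    also have "\<dots> \<le> ennreal e"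
    proof (rule ennreal_leI)
      have "dist (snd c p) (snd c q) \<le> dist (snd c p) (snd c y) + dist (snd c y) (snd c q)" by (rule dist_triangle)
      also have "\<dots> \<le> 2 * \<delta>" using pq by (auto simp: dist_commute)
      finally have "norm v \<le> \<delta>" by (simp add: v_def dist_norm)
      then have "norm v * (C * pi) \<le> \<delta> * (C * pi)" using C(1) by (intro mult_right_mono) auto
      then show "C * (\<bar>pi\<bar> * (norm v + norm (0::real^2))) \<le> e" using \<delta>e by (simp add: mult_ac)
    qed
    finally show "D p q \<le> ennreal e" using pq c(1) unfolding E0 by simp
  qed
qed

lemma pathin_Y:
  assumes "smooth_path X A \<gamma>" "\<gamma> ` {0..1} \<subseteq> U"
  shows "pathin (subtopology X Y) \<gamma>"
  unfolding pathin_def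
proof (rule continuous_map_into_subtopology)
  show "continuous_map (top_of_set {0..1}) X \<gamma>" using assms(1) unfolding smooth_path_def pathin_def by blast
  have "\<gamma> ` {0..1} \<subseteq> Y" using assms(2) U_subset by blast
  then show "\<gamma> \<in> topspace (top_of_set {0..1}) \<rightarrow> Y" by auto
qed

text \<open>In dimension two the paths arriving at and leaving from a boundary point both have to cross
  the same short crosscut around this point.\<close>

lemma rho_triangle:
  assumes x: "x \<in> Y" and y: "y \<in> Y" and z: "z \<in> Y"
  shows "\<rho> x z \<le> \<rho> x y + \<rho> y z"
proof (rule ennreal_le_epsilon)
  fix e :: real assume fin: "\<rho> x y + \<rho> y z < top" and e: "0 < e"
  have e3: "d < d + ennreal (e/3)" if "d < top" for d
    using that e by (cases d rule: ennreal_cases) (auto simp: ennreal_plus[symmetric] ennreal_less_iff simp del: ennreal_plus)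
  have fxy: "\<rho> x y < \<rho> x y + ennreal (e/3)"
    by (rule e3) (use finite_rho[OF x y] in simp)
  have fyz: "\<rho> y z < \<rho> y z + ennreal (e/3)"
    by (rule e3) (use finite_rho[OF y z] in simp)
  have sum: "\<rho> x y + ennreal (e/3) + ennreal (e/3) + (\<rho> y z + ennreal (e/3)) = \<rho> x y + \<rho> y z + ennreal e"
  proof -
    have "ennreal (e/3 + e/3 + e/3) = ennreal (e/3 + e/3) + ennreal (e/3)"
      by (rule ennreal_plus) (use e in auto)
    moreover have "ennreal (e/3 + e/3) = ennreal (e/3) + ennreal (e/3)"
      by (rule ennreal_plus) (use e in auto)
    moreover have "e/3 + e/3 + e/3 = e" by simp
    ultimately have "ennreal (e/3) + ennreal (e/3) + ennreal (e/3) = ennreal e" by metis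
    moreover have "a + c + c + (b + c) = a + b + (c + c + c)" for a b c :: ennreal
      by (simp only: add_ac)
    ultimately show ?thesis by metis
  qed
  have top: "x \<in> topspace X" "y \<in> topspace X" "z \<in> topspace X" using x y z Y_subset by auto
  show "\<rho> x z \<le> \<rho> x y + \<rho> y z + ennreal e"
  \<comment> \<open>The trivial cases are split off because the neighbourhood \<open>W\<close> of
    \<open>y\<close> below has to exclude \<open>x\<close> and \<open>z\<close>.\<close>
  proof (cases "x = y \<or> z = y")
    case True
    then show ?thesis
      using rho_self[OF y] by (auto simp: add_increasing add_increasing2 add.assoc)
  next
    case False
    \<comment> \<open>The error is split into thirds: one for each of the two paths ending near
      \<open>y\<close>, and one for the connection from \<open>u\<close> to
      \<open>v\<close>.\<close>
    have *: "\<rho> x z \<le> \<rho> x y + \<rho> y z + ennreal e"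
      if conn: "\<And>Ox Oz. openin X Ox \<Longrightarrow> x \<in> Ox \<Longrightarrow> openin X Oz \<Longrightarrow> z \<in> Oz \<Longrightarrow>
        \<exists>x' z' u v. x' \<in> Ox \<and> x' \<in> U \<and> z' \<in> Oz \<and> z' \<in> U \<and> D x' u \<le> \<rho> x y + ennreal (e/3) \<and>
          D u v \<le> ennreal (e/3) \<and> D v z' \<le> \<rho> y z + ennreal (e/3)"
    proof (rule rho_leI[OF top(1,3)])
      fix Ox Oz assume O: "openin X Ox" "x \<in> Ox" "openin X Oz" "z \<in> Oz"
      obtain x' z' u v where w: "x' \<in> Ox" "x' \<in> U" "z' \<in> Oz" "z' \<in> U" "D x' u \<le> \<rho> x y + ennreal (e/3)"
        "D u v \<le> ennreal (e/3)" "D v z' \<le> \<rho> y z + ennreal (e/3)" using conn[OF O] by blast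
      have "D x' z' \<le> D x' u + D u v + D v z'"
        by (rule order_trans[OF dist_in_triangle[of U x' z' v] add_right_mono[OF dist_in_triangle[of U x' v u]]])
      also have "\<dots> \<le> \<rho> x y + ennreal (e/3) + ennreal (e/3) + (\<rho> y z + ennreal (e/3))"
        using w by (intro add_mono)
      finally have "D x' z' \<le> \<rho> x y + \<rho> y z + ennreal e" unfolding sum .
      then show "\<exists>x' z'. x' \<in> Ox \<and> x' \<in> U \<and> z' \<in> Oz \<and> z' \<in> U \<and> D x' z' \<le> \<rho> x y + \<rho> y z + ennreal e"
        using w by blast
    qed
    show ?thesis
    proof (cases "y \<in> U")
      case True
      obtain Oy where Oy: "openin X Oy" "y \<in> Oy" "\<And>p q. p \<in> Oy \<Longrightarrow> q \<in> Oy \<Longrightarrow> D p q \<le> ennreal (e/3)"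
        using D_small[OF True, of "e/3"] e by (metis divide_pos_pos zero_less_numeral)
      show ?thesis
      proof (rule *)
        fix Ox Oz assume O: "openin X Ox" "x \<in> Ox" "openin X Oz" "z \<in> Oz"
        obtain x' u where 1: "x' \<in> Ox" "x' \<in> U" "u \<in> Oy" "D x' u < \<rho> x y + ennreal (e/3)"
          using rho_lessD[OF fxy O(1,2) Oy(1,2)] by metis
        obtain v z' where 2: "v \<in> Oy" "z' \<in> Oz" "z' \<in> U" "D v z' < \<rho> y z + ennreal (e/3)"
          using rho_lessD[OF fyz Oy(1,2) O(3,4)] by metis
        show "\<exists>x' z' u v. x' \<in> Ox \<and> x' \<in> U \<and> z' \<in> Oz \<and> z' \<in> U \<and> D x' u \<le> \<rho> x y + ennreal (e/3) \<and>
            D u v \<le> ennreal (e/3) \<and> D v z' \<le> \<rho> y z + ennreal (e/3)"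
          using 1 2 Oy(3)[OF 1(3) 2(1)] less_imp_le by metis
      qed
    next
      case False
      then have b: "y \<in> mf_boundary X Y" using y by (simp add: mf_boundary_def)
      obtain c where c: "c \<in> A" "y \<in> fst c" using chart_at top(2) by blast
      define W where "W = topspace X - {x, z}"
      have W: "openin X W" "y \<in> W"
        using Hausdorff top \<open>\<not> (x = y \<or> z = y)\<close> unfolding W_def
        by (auto intro!: openin_diff closedin_Hausdorff_finite)
      obtain k where k: "bdry_chart Y k" "k 0 = y" "k ` half_disc \<subseteq> fst c \<inter> W"
        using bdry_chart_exists[OF submanifold b c W] by metis
      have kc: "k ` half_disc \<subseteq> fst c" using k(3) by blast
      have e3': "0 < e/3" using e by simp
      obtain P s where P: "path P"
        "\<And>t. t \<in> {0..1} \<Longrightarrow> P t \<in> half_disc \<and> norm (P t) < 1/2 \<and> s < norm (P t) \<and> k (P t) \<in> topspace X"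
        "0 < s" "P 0 $ 2 = 0" "P 1 $ 2 = 0" "P 0 $ 1 * P 1 $ 1 < 0"
        "\<And>t. 0 < t \<Longrightarrow> t < 1 \<Longrightarrow> 0 < P t $ 2"
        "\<And>t u. 0 < t \<Longrightarrow> t < 1 \<Longrightarrow> 0 < u \<Longrightarrow> u < 1 \<Longrightarrow> D (k (P t)) (k (P u)) \<le> ennreal (e/3)"
        using short_crosscut[OF k(1) c(1) kc e3' openin_topspace] k(2) top(2) by metis
      have s1: "s \<le> 1" using P(2)[of 0] by simp
      obtain Oy where Oy: "openin X Oy" "k ` {w \<in> half_disc. norm w < s} = Oy \<inter> Y"
        using bdry_chartD(5)[OF k(1) s1] by (auto simp: openin_subtopology)
      have "0 \<in> {w \<in> half_disc. norm w < s}" using P(3) by (simp add: half_disc_def)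
      then have yOy: "y \<in> Oy" using Oy(2) k(2) by (metis IntD1 imageI)
      define H where "H = k ` half_disc"
      have "closedin X H" unfolding H_def using closedin_bdry_chart[OF k(1), of UNIV] by simp
      then have oH: "openin X (topspace X - H)" by blast
      have xzH: "x \<in> topspace X - H" "z \<in> topspace X - H" using k(3) top by (auto simp: H_def W_def)
      \<comment> \<open>A nearly shortest path from \<open>q\<close> near \<open>y\<close> to
        \<open>p\<close> outside the chart meets the crosscut. Being interior, it does so at an
        inner parameter of \<open>P\<close>, where the short connections are available; the rest of
        it is no longer than the whole.\<close>
      have hit: "\<exists>t. 0 < t \<and> t < 1 \<and> D p (k (P t)) \<le> L" if p: "p \<in> topspace X - H" "p \<in> U" and q: "q \<in> Oy" "q \<in> U" and L: "D q p < L" for p q L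
      proof -
        obtain w0 where w0: "w0 \<in> half_disc" "norm w0 < s" "q = k w0"
        proof -
          have "q \<in> k ` {w \<in> half_disc. norm w < s}" unfolding Oy(2) using q U_subset by blast
          then show ?thesis using that by blast
        qed
        obtain \<gamma> where g: "smooth_path X A \<gamma>" "\<gamma> ` {0..1} \<subseteq> U" "\<gamma> 0 = q" "\<gamma> 1 = p" "ennreal (path_len A g \<gamma>) < L"
          by (rule dist_in_lessE[OF L])
        obtain s' t where st: "s' \<in> {0..1}" "t \<in> {0..1}" "\<gamma> t = k (P s')"
        proof (rule crossing[OF k(1) P(1) _ P(4-6) pathin_Y[OF g(1,2)]])
          show "P t \<in> half_disc \<and> norm (P t) < 1/2" if "t \<in> {0..1}" for t using P(2)[OF that] by simp
          show "\<gamma> 0 = k w0" using g w0 by simp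
          show "\<gamma> 1 \<notin> k ` half_disc" using g p by (simp add: H_def)
          show "w0 = 0 \<or> norm w0 < norm (P t)" if "t \<in> {0..1}" for t using P(2)[OF that] w0(2) by simp
        qed (use w0 in auto)
        have "\<gamma> t \<in> U" using g(2) st(2) by blast
        then have "k (P s') \<in> U" using st(3) by simp
        then have "0 < P s' $ 2" using bdry_chartD(4)[OF k(1)] P(2)[OF st(1)] by blast
        then have "s' \<noteq> 0" "s' \<noteq> 1" using P(4,5) by auto
        then have s': "0 < s'" "s' < 1" using st(1) by auto
        have "D (\<gamma> t) (\<gamma> 1) \<le> ennreal (integral {t..1} (speed A g \<gamma>))"
          using st(2) by (intro dist_in_subpath[OF openin_U g(1,2)]) auto
        also have "\<dots> \<le> ennreal (path_len A g \<gamma>)"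
          unfolding path_len_def using st(2) speed_nonneg[OF g(1)]
          by (intro ennreal_leI integral_subset_le speed_integrable[OF g(1)]) auto
        finally have "D (\<gamma> t) (\<gamma> 1) \<le> L" using g(5) by simp
        then have "D p (k (P s')) \<le> L" using g(4) st(3) dist_in_sym[of U p "k (P s')"] by simp
        then show ?thesis using s' by blast
      qed
      show ?thesis
      proof (rule *)
        fix Ox Oz assume O: "openin X Ox" "x \<in> Ox" "openin X Oz" "z \<in> Oz"
        have O': "openin X (Ox \<inter> (topspace X - H))" "x \<in> Ox \<inter> (topspace X - H)"
          "openin X (Oz \<inter> (topspace X - H))" "z \<in> Oz \<inter> (topspace X - H)"
          using O oH xzH by auto
        obtain x' q where 1: "x' \<in> Ox \<inter> (topspace X - H)" "x' \<in> U" "q \<in> Oy" "q \<in> U" "D x' q < \<rho> x y + ennreal (e/3)"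
          by (rule rho_lessD[OF fxy O'(1,2) Oy(1) yOy])
        obtain q' z' where 2: "q' \<in> Oy" "q' \<in> U" "z' \<in> Oz \<inter> (topspace X - H)" "z' \<in> U" "D q' z' < \<rho> y z + ennreal (e/3)"
          by (rule rho_lessD[OF fyz Oy(1) yOy O'(3,4)])
        obtain t where t: "0 < t" "t < 1" "D x' (k (P t)) \<le> \<rho> x y + ennreal (e/3)"
        proof -
          have "\<exists>t. 0 < t \<and> t < 1 \<and> D x' (k (P t)) \<le> \<rho> x y + ennreal (e/3)"
            by (rule hit[of x' q]) (use 1 dist_in_sym[of U q x'] in simp_all)
          then show ?thesis using that by blast
        qed
        obtain u where u: "0 < u" "u < 1" "D z' (k (P u)) \<le> \<rho> y z + ennreal (e/3)"
        proof -
          have "\<exists>t. 0 < t \<and> t < 1 \<and> D z' (k (P t)) \<le> \<rho> y z + ennreal (e/3)"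
            by (rule hit[of z' q']) (use 2 in simp_all)
          then show ?thesis using that by blast
        qed
        have "D (k (P u)) z' \<le> \<rho> y z + ennreal (e/3)" using u(3) dist_in_sym[of U z'] by simp
        then show "\<exists>x' z' u v. x' \<in> Ox \<and> x' \<in> U \<and> z' \<in> Oz \<and> z' \<in> U \<and> D x' u \<le> \<rho> x y + ennreal (e/3) \<and>
            D u v \<le> ennreal (e/3) \<and> D v z' \<le> \<rho> y z + ennreal (e/3)"
          using 1 2 t(3) P(8)[OF t(1,2) u(1,2)] by blast
      qed
    qed
  qed
qed

section \<open>The real-valued metric and its geodesics\<close>

definition d where "d x y = enn2real (\<rho> x y)"

lemma rho_d: "x \<in> Y \<Longrightarrow> y \<in> Y \<Longrightarrow> \<rho> x y = ennreal (d x y)"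
  using finite_rho[of x y] by (simp add: d_def)

lemma d_nonneg [simp]: "0 \<le> d x y"
  by (simp add: d_def)

lemma d_sym: "x \<in> Y \<Longrightarrow> y \<in> Y \<Longrightarrow> d x y = d y x"
  by (simp add: d_def rho_sym)

lemma d_triangle: "x \<in> Y \<Longrightarrow> y \<in> Y \<Longrightarrow> z \<in> Y \<Longrightarrow> d x z \<le> d x y + d y z"
  using rho_triangle[of x y z] by (simp add: rho_d ennreal_plus[symmetric] del: ennreal_plus)

text \<open>The radius \<open>e\<close> serves all base points \<open>b\<close> in \<open>N\<close>
  at once, because \<open>rho_escape\<close> is applied with half the coordinate radius as margin.
  This uniformity matters in \<open>boundary_triple\<close>, where \<open>b\<close> is found only
  after \<open>e\<close>.\<close>

lemma rho_nbhd:
  assumes a: "a \<in> Y" and O: "openin X O'" "a \<in> O'"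
  obtains N e where "openin X N" "a \<in> N" "0 < e" "\<And>b y. b \<in> N \<Longrightarrow> y \<in> Y \<Longrightarrow> \<rho> b y < ennreal e \<Longrightarrow> y \<in> O'"
proof -
  have "a \<in> topspace X" using a Y_subset by blast
  then obtain c where c: "c \<in> A" "a \<in> fst c" by (rule chart_at)
  define V where "V = snd c ` (fst c \<inter> O')"
  have "open V" unfolding V_def by (rule open_chart_image[OF c(1) O(1)])
  moreover have "snd c a \<in> V" using c O by (auto simp: V_def)
  ultimately obtain R where R: "0 < R" "cball (snd c a) R \<subseteq> V" using open_contains_cball by blast
  define K where "K = cball (snd c a) R"
  have K: "compact K" "K \<subseteq> rng c" "K \<noteq> {}" using R by (auto simp: K_def V_def)
  obtain \<kappa> where \<kappa>: "0 < \<kappa>" "\<And>x v. x \<in> cball (snd c a) R \<Longrightarrow> \<kappa> * norm v \<le> sqrt (qform c x v)"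
    using qform_bounds[OF c(1) K] unfolding K_def by metis
  have R2: "R / 2 < R" using R(1) by simp
  show ?thesis
  proof (rule that)
    show "openin X {p \<in> fst c. snd c p \<in> ball (snd c a) (R/2)}" by (rule openin_chart_preimage[OF c(1)]) simp
    show "a \<in> {p \<in> fst c. snd c p \<in> ball (snd c a) (R/2)}" using c R by simp
    show "0 < \<kappa> * (R - R/2)" using \<kappa> R by simp
    fix b y assume b: "b \<in> {p \<in> fst c. snd c p \<in> ball (snd c a) (R/2)}" and y: "y \<in> Y"
      and lt: "\<rho> b y < ennreal (\<kappa> * (R - R/2))"
    have "y \<in> fst c \<and> snd c y \<in> cball (snd c a) R"
      by (rule rho_escape[OF c(1) \<kappa>(2,1) K(2)[unfolded K_def] R2 _ _ _ lt]) (use b y Y_subset in auto)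
    then have y: "y \<in> fst c" "snd c y \<in> V" using R(2) by auto
    obtain p where p: "p \<in> fst c" "p \<in> O'" "snd c y = snd c p" using y(2) by (auto simp: V_def)
    then show "y \<in> O'" using inj_onD[OF inj_chart[OF c(1)] p(3) y(1) p(1)] by simp
  qed
qed

lemma d_pos: "x \<in> Y \<Longrightarrow> y \<in> Y \<Longrightarrow> x \<noteq> y \<Longrightarrow> 0 < d x y"
proof (rule ccontr)
  assume xy: "x \<in> Y" "y \<in> Y" "x \<noteq> y" and "\<not> 0 < d x y"
  then have "d x y = 0" using d_nonneg[of x y] by simp
  then have 0: "\<rho> x y = 0" using rho_d[OF xy(1,2)] by simp
  have "openin X (topspace X - {y})"
    using Hausdorff xy Y_subset by (intro openin_diff closedin_Hausdorff_singleton) auto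
  moreover have "x \<in> topspace X - {y}" using xy Y_subset by auto
  ultimately obtain N e where "x \<in> N" "0 < e" "\<And>b y'. b \<in> N \<Longrightarrow> y' \<in> Y \<Longrightarrow> \<rho> b y' < ennreal e \<Longrightarrow> y' \<in> topspace X - {y}"
    using rho_nbhd[OF xy(1)] by metis
  then have "y \<in> topspace X - {y}" using xy(2) 0 by (metis ennreal_less_zero_iff)
  then show False by simp
qed

text \<open>By \<open>rho_nbhd\<close> a small value of \<open>d\<close> implies nearness in the
  topology of \<open>X\<close>; a function with a Lipschitz bound for \<open>d\<close> is therefore
  a path.\<close>

lemma pathin_lipschitz:
  assumes m: "\<And>t. t \<in> {0..1} \<Longrightarrow> m t \<in> Y"
    and lip: "\<And>s t. 0 \<le> s \<Longrightarrow> s \<le> t \<Longrightarrow> t \<le> 1 \<Longrightarrow> d (m s) (m t) \<le> (t - s) * l"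
  shows "pathin (subtopology X Y) m"
proof -
  have "openin (top_of_set {0..1}) {t \<in> {0..1}. m t \<in> O'}" if O: "openin X O'" for O'
    unfolding openin_euclidean_subtopology_iff
  proof (intro conjI ballI)
    fix t assume "t \<in> {t \<in> {0..1}. m t \<in> O'}"
    then have t: "t \<in> {0..1}" "m t \<in> O'" by auto
    obtain N e where N: "m t \<in> N" "0 < e" "\<And>b y. b \<in> N \<Longrightarrow> y \<in> Y \<Longrightarrow> \<rho> b y < ennreal e \<Longrightarrow> y \<in> O'"
      using rho_nbhd[OF m[OF t(1)] O t(2)] by metis
    \<comment> \<open>The sign of \<open>l\<close> is not prescribed;
      \<open>\<bar>l\<bar> + 1\<close> is a positive upper bound in any case.\<close>
    define \<epsilon> where "\<epsilon> = e / (\<bar>l\<bar> + 1)"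
    have \<epsilon>: "0 < \<epsilon>" using N(2) by (simp add: \<epsilon>_def)
    have "m t' \<in> O'" if t': "t' \<in> {0..1}" "dist t' t < \<epsilon>" for t'
    proof -
      have "d (m t) (m t') \<le> \<bar>t' - t\<bar> * l"
      proof (cases "t \<le> t'")
        case True
        then show ?thesis using lip[of t t'] t t' by simp
      next
        case False
        then show ?thesis using lip[of t' t] t t' d_sym[OF m m] by auto
      qed
      also have "\<dots> \<le> \<bar>t' - t\<bar> * (\<bar>l\<bar> + 1)" by (intro mult_left_mono) auto
      also have "\<dots> < \<epsilon> * (\<bar>l\<bar> + 1)"
        using t'(2) by (intro mult_strict_right_mono) (auto simp: dist_real_def)
      also have "\<dots> = e" by (simp add: \<epsilon>_def)
      finally have "\<rho> (m t) (m t') < ennreal e" using m t t' by (simp add: rho_d ennreal_less_iff)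
      then show ?thesis using N(3)[OF N(1) m[OF t'(1)]] by simp
    qed
    then show "\<exists>e>0. \<forall>x'\<in>{0..1}. dist x' t < e \<longrightarrow> x' \<in> {t \<in> {0..1}. m t \<in> O'}"
      using \<epsilon> by blast
  qed auto
  then have "continuous_map (top_of_set {0..1}) X m"
    using m Y_subset unfolding continuous_map_def by auto
  then show ?thesis using m unfolding pathin_def continuous_map_in_subtopology by auto
qed

text \<open>The lower semicontinuity of \<open>\<rho>\<close> replaces equicontinuity: nearly shortest interior paths have
  a cluster point in the compact product space of all functions from \<open>[0,1]\<close> to \<open>Y\<close>.\<close>

lemma geodesic_exists:
  assumes x: "x \<in> Y" and y: "y \<in> Y"
  obtains m where "pathin (subtopology X Y) m" "m 0 = x" "m 1 = y" "\<And>t. t \<in> {0..1} \<Longrightarrow> m t \<in> Y"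
    "\<And>s t. 0 \<le> s \<Longrightarrow> s \<le> t \<Longrightarrow> t \<le> 1 \<Longrightarrow> d (m s) (m t) = (t - s) * d x y"
proof -
  define l where "l = d x y"
  define Z where "Z = product_topology (\<lambda>_::real. subtopology X Y) {0..1}"
  have tY: "topspace (subtopology X Y) = Y" using Y_subset by (simp add: topspace_subtopology inf.absorb2)
  have tZ: "topspace Z = PiE {0..1} (\<lambda>_. Y)" by (simp only: Z_def topspace_product_topology tY)
  have cZ: "compact_space Z"
    unfolding Z_def using compact by (simp add: compact_space_product_topology compact_space_subtopology)
  have proj: "continuous_map Z X (\<lambda>m. m t)" if "t \<in> {0..1}" for t
    using continuous_map_product_projection[OF that, of "\<lambda>_. subtopology X Y"]
    by (simp add: Z_def continuous_map_in_subtopology)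
  \<comment> \<open>Functions with ends near \<open>x\<close> and \<open>y\<close> and Lipschitz
    constant \<open>l + e\<close>. Closures of the neighbourhoods and the non-strict bounds make the
    set closed in \<open>Z\<close>; a nearly shortest interior path, parametrized proportionally to
    length, belongs to it.\<close>
  define K where "K Ox Oy e = {m \<in> topspace Z. m 0 \<in> X closure_of Ox \<and> m 1 \<in> X closure_of Oy \<and>
     (\<forall>s t. 0 \<le> s \<and> s \<le> t \<and> t \<le> 1 \<longrightarrow> \<rho> (m s) (m t) \<le> ennreal ((t - s) * (l + e)))}" for Ox Oy and e :: real
  define I where "I Ox Oy e \<longleftrightarrow> openin X Ox \<and> x \<in> Ox \<and> openin X Oy \<and> y \<in> Oy \<and> 0 < e" for Ox Oy and e :: real
  have clK: "closedin Z (K Ox Oy e)" for Ox Oy e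
  proof -
    define S where "S = {(s::real, t). 0 \<le> s \<and> s \<le> t \<and> t \<le> 1}"
    define F where "F z = {m \<in> topspace Z. (m (fst z), m (snd z)) \<in>
      {z' \<in> topspace X \<times> topspace X. \<rho> (fst z') (snd z') \<le> ennreal ((snd z - fst z) * (l + e))}}" for z
    have cF: "closedin Z (F z)" if z: "z \<in> S" for z
      unfolding F_def
    proof (rule closedin_continuous_map_preimage[OF _ closedin_rho_le])
      show "continuous_map Z (prod_topology X X) (\<lambda>m. (m (fst z), m (snd z)))"
        by (intro continuous_map_pairedI proj) (use z in \<open>auto simp: S_def\<close>)
    qed
    have c0: "closedin Z {m \<in> topspace Z. m 0 \<in> X closure_of Ox}" "closedin Z {m \<in> topspace Z. m 1 \<in> X closure_of Oy}"
      by (rule closedin_continuous_map_preimage[OF proj]; simp)+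
    have "(0, 0) \<in> S" by (simp add: S_def)
    then have cI: "closedin Z (\<Inter>z\<in>S. F z)" using cF by (intro closedin_INT) auto
    have mX: "m t \<in> topspace X" if "m \<in> topspace Z" "t \<in> {0..1}" for m t
      using that proj by (auto simp: continuous_map_def)
    have "K Ox Oy e = {m \<in> topspace Z. m 0 \<in> X closure_of Ox} \<inter> {m \<in> topspace Z. m 1 \<in> X closure_of Oy} \<inter> (\<Inter>z\<in>S. F z)"
      (is "_ = ?R")
    proof
      show "K Ox Oy e \<subseteq> ?R"
      proof
        fix m assume m: "m \<in> K Ox Oy e"
        have "m \<in> F z" if "z \<in> S" for z
          using m that mX[of m "fst z"] mX[of m "snd z"] by (auto simp: K_def F_def S_def)
        then show "m \<in> ?R" using m by (simp add: K_def)
      qed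
      show "?R \<subseteq> K Ox Oy e"
      proof
        fix m assume m: "m \<in> ?R"
        have "\<rho> (m s) (m t) \<le> ennreal ((t - s) * (l + e))" if "0 \<le> s \<and> s \<le> t \<and> t \<le> 1" for s t
        proof -
          have "(s, t) \<in> S" using that by (simp add: S_def)
          then have "m \<in> F (s, t)" using m by blast
          then show ?thesis by (simp add: F_def)
        qed
        then show "m \<in> K Ox Oy e" using m by (simp add: K_def)
      qed
    qed
    then show ?thesis using c0 cI by (simp add: closedin_Int)
  qed
  have neK: "K Ox Oy e \<noteq> {}" if I: "I Ox Oy e" for Ox Oy e
  proof -
    have e: "0 < e" using I by (simp add: I_def)
    have lt: "\<rho> x y < ennreal (l + e)" using rho_d[OF x y] e by (simp add: l_def ennreal_less_iff)
    obtain x' y' where xy: "x' \<in> Ox" "x' \<in> U" "y' \<in> Oy" "y' \<in> U" "D x' y' < ennreal (l + e)"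
      using rho_lessD[OF lt] I unfolding I_def by metis
    obtain \<gamma> where g: "smooth_path X A \<gamma>" "\<gamma> ` {0..1} \<subseteq> U" "\<gamma> 0 = x'" "\<gamma> 1 = y'" "ennreal (path_len A g \<gamma>) < ennreal (l + e)"
      by (rule dist_in_lessE[OF xy(5)])
    have len: "path_len A g \<gamma> \<le> l + e"
      using g(5) path_len_nonneg[OF g(1)] by (simp add: ennreal_less_iff)
    obtain m :: "real \<Rightarrow> 'a" where m: "m 0 = \<gamma> 0" "m 1 = \<gamma> 1" "m ` {0..1} \<subseteq> U"
      "\<And>s t. 0 \<le> s \<Longrightarrow> s \<le> t \<Longrightarrow> t \<le> 1 \<Longrightarrow> D (m s) (m t) \<le> ennreal ((t - s) * path_len A g \<gamma>)"
      using length_parametrization[OF openin_U g(1,2)] by metis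
    define m' where "m' = restrict m {0..1}"
    have "m' \<in> topspace Z" unfolding tZ m'_def using m(3) U_subset by auto
    moreover have "m' 0 \<in> X closure_of Ox"
      using closure_of_subset[of Ox X] openin_subset[of X Ox] I xy(1) m(1) g(3) by (auto simp: m'_def I_def)
    moreover have "m' 1 \<in> X closure_of Oy"
      using closure_of_subset[of Oy X] openin_subset[of X Oy] I xy(3) m(2) g(4) by (auto simp: m'_def I_def)
    moreover have "\<rho> (m' s) (m' t) \<le> ennreal ((t - s) * (l + e))" if st: "0 \<le> s \<and> s \<le> t \<and> t \<le> 1" for s t
    proof -
      have "s \<in> {0..1}" "t \<in> {0..1}" using st by auto
      then have ms: "m s \<in> U" "m t \<in> U" "m' s = m s" "m' t = m t" using m(3) by (auto simp: m'_def)
      have "\<rho> (m' s) (m' t) \<le> D (m s) (m t)" using rho_le_D ms by simp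
      also have "\<dots> \<le> ennreal ((t - s) * path_len A g \<gamma>)" using m(4) st by blast
      also have "\<dots> \<le> ennreal ((t - s) * (l + e))" using st len by (intro ennreal_leI mult_left_mono) auto
      finally show ?thesis .
    qed
    ultimately have "m' \<in> K Ox Oy e" by (simp add: K_def)
    then show ?thesis by blast
  qed
  define \<U> where "\<U> = {K Ox Oy e | Ox Oy e. I Ox Oy e}"
  \<comment> \<open>Smaller neighbourhoods and smaller \<open>e\<close> give a smaller
    \<open>K\<close>, so finitely many of these sets contain a common one, which is nonempty: the
    finite intersection property.\<close>
  have dir: "\<exists>Ox Oy e. I Ox Oy e \<and> K Ox Oy e \<subseteq> \<Inter>\<F>" if "finite \<F>" "\<F> \<subseteq> \<U>" for \<F>
    using that
  proof (induction \<F> rule: finite_induct)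
    case empty
    have "I (topspace X) (topspace X) 1" using x y Y_subset by (auto simp: I_def)
    then show ?case by auto
  next
    case (insert k \<F>)
    then obtain Ox Oy e where 1: "I Ox Oy e" "K Ox Oy e \<subseteq> \<Inter>\<F>" by blast
    obtain Ox' Oy' e' where 2: "I Ox' Oy' e'" "k = K Ox' Oy' e'" using insert.prems by (auto simp: \<U>_def)
    have mono: "K (Oa \<inter> Ob) (Oc \<inter> Od) (min p q) \<subseteq> K Oa Oc p" "K (Oa \<inter> Ob) (Oc \<inter> Od) (min p q) \<subseteq> K Ob Od q"
      for Oa Ob Oc Od and p q :: real
    proof -
      have le: "ennreal ((t - s) * (l + min p q)) \<le> ennreal ((t - s) * (l + p))"
        "ennreal ((t - s) * (l + min p q)) \<le> ennreal ((t - s) * (l + q))" if "s \<le> t" for s t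
        using that by (auto intro!: ennreal_leI mult_left_mono)
      have cl: "X closure_of (Oa \<inter> Ob) \<subseteq> X closure_of Oa" "X closure_of (Oa \<inter> Ob) \<subseteq> X closure_of Ob"
        "X closure_of (Oc \<inter> Od) \<subseteq> X closure_of Oc" "X closure_of (Oc \<inter> Od) \<subseteq> X closure_of Od"
        by (simp_all add: closure_of_mono)
      show "K (Oa \<inter> Ob) (Oc \<inter> Od) (min p q) \<subseteq> K Oa Oc p"
      proof
        fix m assume m: "m \<in> K (Oa \<inter> Ob) (Oc \<inter> Od) (min p q)"
        have "\<rho> (m s) (m t) \<le> ennreal ((t - s) * (l + p))" if "0 \<le> s \<and> s \<le> t \<and> t \<le> 1" for s t
        proof -
          have "\<rho> (m s) (m t) \<le> ennreal ((t - s) * (l + min p q))" using m that unfolding K_def by blast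
          also have "\<dots> \<le> ennreal ((t - s) * (l + p))" using that by (intro le(1)) simp
          finally show ?thesis .
        qed
        then show "m \<in> K Oa Oc p" using m cl unfolding K_def by blast
      qed
      show "K (Oa \<inter> Ob) (Oc \<inter> Od) (min p q) \<subseteq> K Ob Od q"
      proof
        fix m assume m: "m \<in> K (Oa \<inter> Ob) (Oc \<inter> Od) (min p q)"
        have "\<rho> (m s) (m t) \<le> ennreal ((t - s) * (l + q))" if "0 \<le> s \<and> s \<le> t \<and> t \<le> 1" for s t
        proof -
          have "\<rho> (m s) (m t) \<le> ennreal ((t - s) * (l + min p q))" using m that unfolding K_def by blast
          also have "\<dots> \<le> ennreal ((t - s) * (l + q))" using that by (intro le(2)) simp
          finally show ?thesis .
        qed
        then show "m \<in> K Ob Od q" using m cl unfolding K_def by blast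
      qed
    qed
    have "I (Ox \<inter> Ox') (Oy \<inter> Oy') (min e e')" using 1 2 by (auto simp: I_def)
    moreover have "K (Ox \<inter> Ox') (Oy \<inter> Oy') (min e e') \<subseteq> \<Inter>(insert k \<F>)"
      using mono[of Ox Ox' Oy Oy' e e'] 1(2) 2(2) by blast
    ultimately show ?case by blast
  qed
  have "\<forall>C\<in>\<U>. closedin Z C" using clK by (auto simp: \<U>_def)
  moreover have "\<forall>\<F>. finite \<F> \<and> \<F> \<subseteq> \<U> \<longrightarrow> \<Inter>\<F> \<noteq> {}" using dir neK by (metis subset_empty)
  ultimately have "\<Inter>\<U> \<noteq> {}" using cZ unfolding compact_space_fip by blast
  then obtain m where mU: "m \<in> \<Inter>\<U>" by blast
  have m: "m \<in> K Ox Oy e" if "I Ox Oy e" for Ox Oy e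
    using mU that unfolding \<U>_def by blast
  have "I (topspace X) (topspace X) 1" using x y Y_subset by (auto simp: I_def)
  then have "m \<in> topspace Z" using m by (auto simp: K_def)
  then have mY: "m t \<in> Y" if "t \<in> {0..1}" for t using that unfolding tZ by auto
  \<comment> \<open>A point in the closures of all neighbourhoods of another point equals it in a
    Hausdorff space; this pins down the ends of the cluster point \<open>m\<close>.\<close>
  have eqI: "a = b" if ab: "a \<in> topspace X" "b \<in> topspace X" "\<And>Oa. openin X Oa \<Longrightarrow> a \<in> Oa \<Longrightarrow> b \<in> X closure_of Oa" for a b
  proof (rule ccontr)
    assume "a \<noteq> b"
    then obtain S T where "openin X S" "openin X T" "a \<in> S" "b \<in> T" "disjnt S T"
      using Hausdorff ab(1,2) unfolding Hausdorff_space_def by blast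
    then show False using ab(3)[of S] unfolding in_closure_of disjnt_def by blast
  qed
  have m0: "m 0 = x"
  proof (rule eqI[symmetric])
    fix Oa assume "openin X Oa" "x \<in> Oa"
    then have "I Oa (topspace X) 1" using y Y_subset by (auto simp: I_def)
    then show "m 0 \<in> X closure_of Oa" using m by (auto simp: K_def)
  qed (use x mY[of 0] Y_subset in auto)
  have m1: "m 1 = y"
  proof (rule eqI[symmetric])
    fix Oa assume "openin X Oa" "y \<in> Oa"
    then have "I (topspace X) Oa 1" using x Y_subset by (auto simp: I_def)
    then show "m 1 \<in> X closure_of Oa" using m by (auto simp: K_def)
  qed (use y mY[of 1] Y_subset in auto)
  have lip: "d (m s) (m t) \<le> (t - s) * l" if st: "0 \<le> s" "s \<le> t" "t \<le> 1" for s t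
  proof (rule field_le_epsilon)
    fix e :: real assume e: "0 < e"
    then have "I (topspace X) (topspace X) e" using x y Y_subset by (auto simp: I_def)
    then have "\<rho> (m s) (m t) \<le> ennreal ((t - s) * (l + e))" using m st by (auto simp: K_def)
    moreover have "0 \<le> (t - s) * (l + e)" using st e by (simp add: l_def)
    ultimately have "d (m s) (m t) \<le> (t - s) * (l + e)" using mY st by (simp add: rho_d)
    also have "\<dots> = (t - s) * l + (t - s) * e" by (simp add: algebra_simps)
    also have "(t - s) * e \<le> 1 * e" using st e by (intro mult_right_mono) auto
    finally show "d (m s) (m t) \<le> (t - s) * l + e" by simp
  qed
  show ?thesis
  proof (rule that[OF pathin_lipschitz[OF mY lip] m0 m1 mY])
    fix s t :: real assume st: "0 \<le> s" "s \<le> t" "t \<le> 1"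
    have Y: "m s \<in> Y" "m t \<in> Y" using mY st by auto
    \<comment> \<open>The Lipschitz bounds of the three parts add up to exactly \<open>l\<close>, so
      by the triangle inequality none of them can be strict.\<close>
    have "l \<le> d x (m s) + d (m s) (m t) + d (m t) y"
      using d_triangle[OF x Y(1) y] d_triangle[OF Y y] unfolding l_def by linarith
    moreover have "d x (m s) \<le> s * l" using lip[of 0 s] st m0 by simp
    moreover have "d (m t) y \<le> (1 - t) * l" using lip[of t 1] st m1 by simp
    ultimately have "(t - s) * l \<le> d (m s) (m t)" by (simp add: algebra_simps)
    then show "d (m s) (m t) = (t - s) * d x y" using lip[OF st] unfolding l_def by simp
  qed auto
qed

end

section \<open>Boundary triples\<close>

context bordered_surface
begin

text \<open>Equality in the triangle inequality makes the concatenation of two geodesics shortest: a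
  shortcut between points of the two halves would push \<open>d b c\<close> below
  \<open>d b a + d a c\<close>.\<close>

lemma shortest_path_join:
  assumes abc: "b \<in> Y" "a \<in> Y" "c \<in> Y" "b \<noteq> a" "a \<noteq> c" "b \<noteq> c"
    and add: "d b c = d b a + d a c"
  obtains \<gamma> where "shortest_path X A g Y b c \<gamma>" "\<gamma> (1/2) = a"
proof -
  obtain m1 where m1: "pathin (subtopology X Y) m1" "m1 0 = b" "m1 1 = a" "\<And>t. t \<in> {0..1} \<Longrightarrow> m1 t \<in> Y"
    "\<And>s t. 0 \<le> s \<Longrightarrow> s \<le> t \<Longrightarrow> t \<le> 1 \<Longrightarrow> d (m1 s) (m1 t) = (t - s) * d b a"
    using geodesic_exists[OF abc(1,2)] by metis
  obtain m2 where m2: "pathin (subtopology X Y) m2" "m2 0 = a" "m2 1 = c" "\<And>t. t \<in> {0..1} \<Longrightarrow> m2 t \<in> Y"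
    "\<And>s t. 0 \<le> s \<Longrightarrow> s \<le> t \<Longrightarrow> t \<le> 1 \<Longrightarrow> d (m2 s) (m2 t) = (t - s) * d a c"
    using geodesic_exists[OF abc(2,3)] by metis
  define \<gamma> where "\<gamma> t = (if t \<le> 1/2 then m1 (2 * t) else m2 (2 * t - 1))" for t :: real
  \<comment> \<open>The distance from \<open>b\<close> along the concatenation, with slope
    \<open>2 * d b a\<close> on the first half and \<open>2 * d a c\<close> on the second; both
    slopes are positive because the points are distinct.\<close>
  define \<phi> where "\<phi> t = 2 * d b a * min t (1/2) + 2 * d a c * max (t - 1/2) 0" for t :: real
  have pos: "0 < d b a" "0 < d a c" using d_pos abc by auto
  have pg: "pathin (subtopology X Y) \<gamma>"
    unfolding pathin_def \<gamma>_def
  proof (rule continuous_map_cases_le)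
    have "continuous_map (subtopology (top_of_set {0..1}) {x \<in> topspace (top_of_set {0..1}). x \<le> 1 / 2}) (top_of_set {0..1}) (\<lambda>t::real. 2 * t)"
      by (auto simp: continuous_map_in_subtopology subtopology_subtopology intro!: continuous_intros)
    from continuous_map_compose[OF this m1(1)[unfolded pathin_def]]
    show "continuous_map (subtopology (top_of_set {0..1}) {x \<in> topspace (top_of_set {0..1}). x \<le> 1 / 2}) (subtopology X Y) (\<lambda>t. m1 (2 * t))"
      by (simp add: o_def)
    have "continuous_map (subtopology (top_of_set {0..1}) {x \<in> topspace (top_of_set {0..1}). 1 / 2 \<le> x}) (top_of_set {0..1}) (\<lambda>t::real. 2 * t - 1)"
      by (auto simp: continuous_map_in_subtopology subtopology_subtopology intro!: continuous_intros)
    from continuous_map_compose[OF this m2(1)[unfolded pathin_def]]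
    show "continuous_map (subtopology (top_of_set {0..1}) {x \<in> topspace (top_of_set {0..1}). 1 / 2 \<le> x}) (subtopology X Y) (\<lambda>t. m2 (2 * t - 1))"
      by (simp add: o_def)
    show "m1 (2 * x) = m2 (2 * x - 1)" if "x = 1/2" for x
      unfolding that using m1(3) m2(2) by simp
  qed auto
  have \<gamma>Y: "\<gamma> t \<in> Y" if "t \<in> {0..1}" for t
    using that m1(4)[of "2 * t"] m2(4)[of "2 * t - 1"] by (auto simp: \<gamma>_def)
  have dist: "d (\<gamma> s) (\<gamma> t) = \<phi> t - \<phi> s" if st: "0 \<le> s" "s \<le> t" "t \<le> 1" for s t
  proof -
    consider "t \<le> 1/2" | "1/2 < s" | "s \<le> 1/2" "1/2 < t" by linarith
    then show ?thesis
    proof cases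
      case 1
      then show ?thesis
        using m1(5)[of "2 * s" "2 * t"] st by (simp add: \<gamma>_def \<phi>_def algebra_simps)
    next
      case 2
      then show ?thesis
        using m2(5)[of "2 * s - 1" "2 * t - 1"] st by (simp add: \<gamma>_def \<phi>_def algebra_simps)
    next
      case 3
      have Y: "m1 (2 * s) \<in> Y" "m2 (2 * t - 1) \<in> Y" using m1(4)[of "2 * s"] m2(4)[of "2 * t - 1"] 3 st by auto
      have g: "\<gamma> s = m1 (2 * s)" "\<gamma> t = m2 (2 * t - 1)" using 3 by (simp_all add: \<gamma>_def)
      have p: "\<phi> t - \<phi> s = (1 - 2 * s) * d b a + (2 * t - 1) * d a c"
        using 3 by (simp add: \<phi>_def algebra_simps)
      have q: "d b (m1 (2 * s)) = (2 * s - 0) * d b a" "d (m1 (2 * s)) a = (1 - 2 * s) * d b a"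
        "d a (m2 (2 * t - 1)) = (2 * t - 1 - 0) * d a c" "d (m2 (2 * t - 1)) c = (1 - (2 * t - 1)) * d a c"
        using m1(5)[of 0 "2 * s"] m1(5)[of "2 * s" 1] m2(5)[of 0 "2 * t - 1"] m2(5)[of "2 * t - 1" 1] m1(2,3) m2(2,3) 3 st
        by auto
      have "d (\<gamma> s) (\<gamma> t) \<le> \<phi> t - \<phi> s"
        using d_triangle[OF Y(1) abc(2) Y(2)] unfolding g p q by simp
      moreover have "d b c \<le> d b (m1 (2 * s)) + d (m1 (2 * s)) (m2 (2 * t - 1)) + d (m2 (2 * t - 1)) c"
        using d_triangle[OF abc(1) Y(1) abc(3)] d_triangle[OF Y abc(3)] by linarith
      then have "\<phi> t - \<phi> s \<le> d (\<gamma> s) (\<gamma> t)"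
        unfolding g p q add by (simp add: algebra_simps)
      ultimately show ?thesis by simp
    qed
  qed
  have mono: "\<phi> s < \<phi> t" if "s < t" for s t
  proof -
    have "min s (1/2) \<le> min t (1/2)" "max (s - 1/2) 0 \<le> max (t - 1/2) 0"
      "min s (1/2) < min t (1/2) \<or> max (s - 1/2) 0 < max (t - 1/2) 0" using that by auto
    then have "2 * d b a * min s (1/2) \<le> 2 * d b a * min t (1/2)"
      "2 * d a c * max (s - 1/2) 0 \<le> 2 * d a c * max (t - 1/2) 0"
      "2 * d b a * min s (1/2) < 2 * d b a * min t (1/2) \<or> 2 * d a c * max (s - 1/2) 0 < 2 * d a c * max (t - 1/2) 0"
      using pos by (auto intro!: mult_left_mono)
    then show ?thesis unfolding \<phi>_def by linarith
  qed
  have "shortest_path X A g Y b c \<gamma>"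
    unfolding shortest_path_def
  proof (intro conjI exI[of _ \<phi>] allI impI)
    show "strict_mono_on {0..1} \<phi>" using mono by (auto simp: strict_mono_on_def)
    show "continuous_on {0..1} \<phi>" unfolding \<phi>_def by (intro continuous_intros)
    show "\<gamma> 0 = b" "\<gamma> 1 = c" "\<phi> 0 = 0" using m1(2) m2(3) by (simp_all add: \<gamma>_def \<phi>_def)
    show "\<rho> (\<gamma> s) (\<gamma> t) = ennreal (\<phi> t - \<phi> s)" if st: "0 \<le> s \<and> s \<le> t \<and> t \<le> 1" for s t
      using rho_d[OF \<gamma>Y \<gamma>Y, of s t] dist[of s t] st by simp
  qed (use abc pg in auto)
  moreover have "\<gamma> (1/2) = a" using m1(3) by (simp add: \<gamma>_def)
  ultimately show ?thesis by (rule that)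
qed

lemma shortest_path_additive:
  assumes "shortest_path X A g Y \<alpha> \<beta> \<gamma>" "0 \<le> s" "s \<le> t" "t \<le> u" "u \<le> 1"
  shows "d (\<gamma> s) (\<gamma> u) = d (\<gamma> s) (\<gamma> t) + d (\<gamma> t) (\<gamma> u)"
proof -
  obtain \<phi> :: "real \<Rightarrow> real" where \<phi>: "strict_mono_on {0..1} \<phi>"
    "\<And>s t. 0 \<le> s \<and> s \<le> t \<and> t \<le> 1 \<Longrightarrow> \<rho> (\<gamma> s) (\<gamma> t) = ennreal (\<phi> t - \<phi> s)"
    using assms(1) unfolding shortest_path_def by blast
  have "d (\<gamma> s) (\<gamma> t) = \<phi> t - \<phi> s" if "0 \<le> s" "s \<le> t" "t \<le> 1" for s t
  proof -
    have "\<phi> s \<le> \<phi> t"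
      using \<phi>(1) that by (cases "s = t") (auto simp: strict_mono_on_def intro: less_imp_le)
    then show ?thesis using \<phi>(2)[of s t] that by (simp add: d_def)
  qed
  then show ?thesis using assms by simp
qed

lemma boundary_triple:
  assumes \<gamma>: "pathin (subtopology X Y) \<gamma>" and t0: "0 < t0" "t0 < 1" "\<gamma> t0 \<in> mf_boundary X Y"
    and ne: "\<gamma> 0 \<noteq> \<gamma> t0" "\<gamma> 1 \<noteq> \<gamma> t0"
    and additive: "\<And>s t u. 0 \<le> s \<Longrightarrow> s \<le> t \<Longrightarrow> t \<le> u \<Longrightarrow> u \<le> 1 \<Longrightarrow>
      d (\<gamma> s) (\<gamma> u) = d (\<gamma> s) (\<gamma> t) + d (\<gamma> t) (\<gamma> u)"
  obtains b c where "b \<in> mf_boundary X Y" "c \<in> mf_boundary X Y" "b \<noteq> \<gamma> t0" "c \<noteq> \<gamma> t0" "b \<noteq> c"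
    "d b c = d b (\<gamma> t0) + d (\<gamma> t0) c"
proof -
  define a where "a = \<gamma> t0"
  have aB: "a \<in> mf_boundary X Y" using t0(3) by (simp add: a_def)
  have aY: "a \<in> Y" using aB by (simp add: mf_boundary_def)
  have cm: "continuous_map (top_of_set {0..1}) (subtopology X Y) \<gamma>" using \<gamma> by (simp add: pathin_def)
  have \<gamma>Y: "\<gamma> t \<in> Y" if "t \<in> {0..1}" for t
    using cm that by (auto simp: continuous_map_in_subtopology)
  have aX: "a \<in> topspace X" using aY Y_subset by blast
  obtain c0 where c0: "c0 \<in> A" "a \<in> fst c0" using chart_at[OF aX] by blast
  have \<gamma>01: "\<gamma> 0 \<in> topspace X" "\<gamma> 1 \<in> topspace X" using \<gamma>Y[of 0] \<gamma>Y[of 1] Y_subset by auto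
  \<comment> \<open>Removing the ends of \<open>\<gamma>\<close> forces both halves of
    \<open>\<gamma>\<close> to leave the chart, as \<open>crossing\<close> requires.\<close>
  define W where "W = topspace X - {\<gamma> 0, \<gamma> 1}"
  have "closedin X {\<gamma> 0, \<gamma> 1}" using Hausdorff \<gamma>01 by (intro closedin_Hausdorff_finite) auto
  then have W: "openin X W" "a \<in> W" using aX ne by (auto simp: W_def a_def)
  obtain k where k: "bdry_chart Y k" "k 0 = a" "k ` half_disc \<subseteq> fst c0 \<inter> W"
    using bdry_chart_exists[OF submanifold aB c0 W] by metis
  have kc: "k ` half_disc \<subseteq> fst c0" and kW: "k ` half_disc \<subseteq> W" using k(3) by blast+
  have kinj: "inj_on k half_disc" and kY: "k ` half_disc \<subseteq> Y" using bdry_chartD[OF k(1)] by blast+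
  have h1: "(1/2::real) \<le> 1" by simp
  obtain O1 where O1: "openin X O1" "k ` {w \<in> half_disc. norm w < 1/2} = O1 \<inter> Y"
    using bdry_chartD(5)[OF k(1) h1] unfolding openin_subtopology by blast
  have z: "0 \<in> half_disc" by (simp add: half_disc_def)
  have "k 0 \<in> k ` {w \<in> half_disc. norm w < 1/2}" by (rule imageI) (simp add: z)
  then have aO1: "a \<in> O1" using O1(2) k(2) by blast
  \<comment> \<open>Fixed before the crosscut is chosen: its ends will lie in \<open>N\<close>, and
    points of \<open>Y\<close> closer than \<open>e\<close> to such an end stay in the image of the
    half-disc of radius 1/2. This confines the geodesic between the ends.\<close>
  obtain N e where N: "openin X N" "a \<in> N" "0 < e" "\<And>b y. b \<in> N \<Longrightarrow> y \<in> Y \<Longrightarrow> \<rho> b y < ennreal e \<Longrightarrow> y \<in> O1"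
    using rho_nbhd[OF aY O1(1) aO1] by metis
  have e2: "0 < e/2" using N(3) by simp
  have kN: "k 0 \<in> N" using N(2) k(2) by simp
  obtain P s where P: "path P"
    "\<And>t. t \<in> {0..1} \<Longrightarrow> P t \<in> half_disc \<and> norm (P t) < 1/2 \<and> s < norm (P t) \<and> k (P t) \<in> N"
    "0 < s" "P 0 $ 2 = 0" "P 1 $ 2 = 0" "P 0 $ 1 * P 1 $ 1 < 0"
    "\<And>t. 0 < t \<Longrightarrow> t < 1 \<Longrightarrow> 0 < P t $ 2"
    "\<And>t u. 0 < t \<Longrightarrow> t < 1 \<Longrightarrow> 0 < u \<Longrightarrow> u < 1 \<Longrightarrow> D (k (P t)) (k (P u)) \<le> ennreal (e/2)"
    by (rule short_crosscut[OF k(1) c0(1) kc e2 N(1) kN]) (rule that)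
  define b c where "b = k (P 0)" and "c = k (P 1)"
  have PD: "P 0 \<in> half_disc" "P 1 \<in> half_disc" using P(2)[of 0] P(2)[of 1] by auto
  have bcY: "b \<in> Y" "c \<in> Y" using kY PD by (auto simp: b_def c_def)
  have bcB: "b \<in> mf_boundary X Y" "c \<in> mf_boundary X Y"
    using bcY bdry_chartD(4)[OF k(1) PD(1)] bdry_chartD(4)[OF k(1) PD(2)] P(4,5)
    by (auto simp: mf_boundary_def b_def c_def)
  have P01: "P 0 \<noteq> 0" "P 1 \<noteq> 0" "P 0 \<noteq> P 1" using P(6) by (auto simp: mult_less_0_iff)
  have ba: "b \<noteq> a" using inj_onD[OF kinj _ PD(1) z] P01(1) k(2) by (auto simp: b_def)
  have ca: "c \<noteq> a" using inj_onD[OF kinj _ PD(2) z] P01(2) k(2) by (auto simp: c_def)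
  have bc: "b \<noteq> c" using inj_onD[OF kinj _ PD] P01(3) by (auto simp: b_def c_def)
  have contkP: "continuous_map (top_of_set {0..1}) X (\<lambda>t. k (P t))"
  proof -
    have "continuous_map (top_of_set {0..1}) (top_of_set half_disc) P"
      using P(1,2) by (auto simp: path_def continuous_map_in_subtopology)
    from continuous_map_compose[OF this bdry_chartD(1)[OF k(1)]] show ?thesis by (simp add: o_def)
  qed
  \<comment> \<open>The estimate for the open arc does not cover its ends \<open>b\<close> and
    \<open>c\<close>, which are boundary points; they are limits of points of the arc, which
    suffices for the lower limit \<open>\<rho>\<close>.\<close>
  have near: "\<exists>t. 0 < t \<and> t < 1 \<and> k (P t) \<in> O'" if O: "openin X O'" and t: "t \<in> {0, 1}" "k (P t) \<in> O'" for O' t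
  proof -
    have "openin (top_of_set {0..1}) {t \<in> topspace (top_of_set {0..1}). k (P t) \<in> O'}"
      by (rule openin_continuous_map_preimage[OF contkP O])
    then obtain T where T: "open T" "{t \<in> {0..1}. k (P t) \<in> O'} = {0..1} \<inter> T" by (auto simp: openin_open)
    have "t \<in> {0..1}" using t(1) by auto
    then have "t \<in> T" using T(2) t(2) by blast
    then obtain \<epsilon> where \<epsilon>: "0 < \<epsilon>" "ball t \<epsilon> \<subseteq> T" using T(1) openE by blast
    define u where "u = (if t = 0 then min (\<epsilon>/2) (1/2) else 1 - min (\<epsilon>/2) (1/2))"
    have u: "0 < u" "u < 1" "dist t u < \<epsilon>" using \<epsilon>(1) t(1) by (auto simp: u_def dist_real_def min_def)
    then have "u \<in> {0..1} \<inter> T" using subsetD[OF \<epsilon>(2), of u] by simp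
    then have "k (P u) \<in> O'" using T(2) by blast
    then show ?thesis using u by blast
  qed
  have "\<rho> b c \<le> ennreal (e/2)"
  proof (rule rho_leI)
    fix Ox Oy assume O: "openin X Ox" "b \<in> Ox" "openin X Oy" "c \<in> Oy"
    obtain t where t: "0 < t" "t < 1" "k (P t) \<in> Ox" using near[OF O(1), of 0] O(2) by (auto simp: b_def)
    obtain u where u: "0 < u" "u < 1" "k (P u) \<in> Oy" using near[OF O(3), of 1] O(4) by (auto simp: c_def)
    have "k (P t) \<in> U" "k (P u) \<in> U"
      using bdry_chartD(4)[OF k(1)] P(2)[of t] P(2)[of u] P(7) t u by auto
    then show "\<exists>x' y'. x' \<in> Ox \<and> x' \<in> U \<and> y' \<in> Oy \<and> y' \<in> U \<and> D x' y' \<le> ennreal (e/2)"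
      using t u P(8)[OF t(1,2) u(1,2)] by blast
  qed (use bcY Y_subset in auto)
  then have dbc: "d b c \<le> e/2" using rho_d[OF bcY] e2 by simp
  obtain \<delta> where \<delta>: "pathin (subtopology X Y) \<delta>" "\<delta> 0 = b" "\<delta> 1 = c" "\<And>t. t \<in> {0..1} \<Longrightarrow> \<delta> t \<in> Y"
    "\<And>s t. 0 \<le> s \<Longrightarrow> s \<le> t \<Longrightarrow> t \<le> 1 \<Longrightarrow> d (\<delta> s) (\<delta> t) = (t - s) * d b c"
    using geodesic_exists[OF bcY] by metis
  have \<delta>in: "\<delta> t \<in> k ` {w \<in> half_disc. norm w < 1/2}" if t: "t \<in> {0..1}" for t
  proof -
    have "d b (\<delta> t) = t * d b c" using \<delta>(5)[of 0 t] \<delta>(2) t by simp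
    also have "\<dots> \<le> 1 * d b c" using t by (intro mult_right_mono) auto
    finally have "d b (\<delta> t) < e" using dbc e2 by simp
    then have "\<rho> b (\<delta> t) < ennreal e" using rho_d[OF bcY(1) \<delta>(4)[OF t]] by (simp add: ennreal_less_iff)
    moreover have "b \<in> N" using P(2)[of 0] by (simp add: b_def)
    ultimately have "\<delta> t \<in> O1" using N(4) \<delta>(4)[OF t] by blast
    then show ?thesis using O1(2) \<delta>(4)[OF t] by blast
  qed
  define Q where "Q t = inv_into half_disc k (\<delta> t)" for t
  have Q: "Q t \<in> half_disc \<and> norm (Q t) < 1/2 \<and> k (Q t) = \<delta> t" if t: "t \<in> {0..1}" for t
  proof -
    obtain w where "w \<in> half_disc" "norm w < 1/2" "\<delta> t = k w" using \<delta>in[OF t] by auto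
    then show ?thesis using kinj by (simp add: Q_def)
  qed
  have Q01: "Q 0 = P 0" "Q 1 = P 1"
    using kinj PD \<delta>(2,3) by (simp_all add: Q_def b_def c_def)
  have pQ: "path Q"
  proof -
    have "\<delta> t \<in> k ` half_disc" if t: "t \<in> {0..1}" for t using \<delta>in[OF t] by blast
    then have "continuous_map (top_of_set {0..1}) (subtopology X (k ` half_disc)) \<delta>"
      using \<delta>(1) unfolding pathin_def by (auto simp: continuous_map_in_subtopology)
    from continuous_map_compose[OF this bdry_chart_inverse[OF k(1)]]
    show ?thesis by (simp add: path_def o_def Q_def[abs_def] continuous_map_in_subtopology)
  qed
  \<comment> \<open>\<open>v = 0\<close> and \<open>v = 1\<close> give the two halves of
    \<open>\<gamma>\<close>, both traversed away from \<open>\<gamma> t0\<close>, so the start is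
    the centre of the half-disc. The path to be crossed is not the crosscut but the pulled back
    geodesic \<open>Q\<close> with the same ends.\<close>
  have cross: "\<exists>s t. s \<in> {0..1} \<and> t \<in> {0..1} \<and> \<gamma> (t0 + (v - t0) * t) = \<delta> s" if v: "v \<in> {0, 1}" for v
  proof -
    have im: "t0 + (v - t0) * t \<in> {0..1}" if t: "t \<in> {0..1}" for t
    proof -
      have "t0 + (v - t0) * t = (1 - t) * t0 + t * v" by (simp add: algebra_simps)
      moreover have "(1 - t) * t0 \<le> (1 - t) * 1" "0 \<le> (1 - t) * t0" using t t0 by (auto intro!: mult_left_mono simp del: mult_1_right)
      moreover have "0 \<le> t * v" "t * v \<le> t" using v t by auto
      ultimately show ?thesis by simp
    qed
    have "continuous_map (top_of_set {0..1}) (top_of_set {0..1}) (\<lambda>t. t0 + (v - t0) * t)"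
      using im by (auto simp: continuous_map_in_subtopology intro!: continuous_intros)
    from continuous_map_compose[OF this cm]
    have p: "pathin (subtopology X Y) (\<lambda>t. \<gamma> (t0 + (v - t0) * t))" by (simp add: pathin_def o_def)
    have e1: "\<gamma> v \<notin> k ` half_disc" using kW v by (auto simp: W_def)
    obtain s t where "s \<in> {0..1}" "t \<in> {0..1}" "\<gamma> (t0 + (v - t0) * t) = k (Q s)"
    proof (rule crossing[OF k(1) pQ _ _ _ _ p])
      show "Q t \<in> half_disc \<and> norm (Q t) < 1/2" if "t \<in> {0..1}" for t using Q[OF that] by simp
      show "Q 0 $ 2 = 0" "Q 1 $ 2 = 0" "Q 0 $ 1 * Q 1 $ 1 < 0" using Q01 P(4-6) by simp_all
      show "\<gamma> (t0 + (v - t0) * 0) = k 0" using k(2) by (simp add: a_def)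
      show "\<gamma> (t0 + (v - t0) * 1) \<notin> k ` half_disc" using e1 by simp
    qed (use z in auto)
    then show ?thesis using Q by metis
  qed
  obtain s1 t1 where 1: "s1 \<in> {0..1}" "t1 \<in> {0..1}" "\<gamma> (t0 + (0 - t0) * t1) = \<delta> s1" using cross[of 0] by auto
  obtain s2 t2 where 2: "s2 \<in> {0..1}" "t2 \<in> {0..1}" "\<gamma> (t0 + (1 - t0) * t2) = \<delta> s2" using cross[of 1] by auto
  define u v where "u = t0 + (0 - t0) * t1" and "v = t0 + (1 - t0) * t2"
  have u: "0 \<le> u" "u \<le> t0"
  proof -
    have "t0 * t1 \<le> t0 * 1" "0 \<le> t0 * t1" using 1(2) t0 by (auto intro!: mult_left_mono simp del: mult_1_right)
    then show "0 \<le> u" "u \<le> t0" by (simp_all add: u_def)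
  qed
  have v: "t0 \<le> v" "v \<le> 1"
  proof -
    have "(1 - t0) * t2 \<le> (1 - t0) * 1" "0 \<le> (1 - t0) * t2" using 2(2) t0 by (auto intro!: mult_left_mono simp del: mult_1_right)
    then show "t0 \<le> v" "v \<le> 1" by (simp_all add: v_def)
  qed
  define p q where "p = \<delta> s1" and "q = \<delta> s2"
  have pq: "\<gamma> u = p" "\<gamma> v = q" using 1(3) 2(3) by (simp_all add: u_def v_def p_def q_def)
  have pqY: "p \<in> Y" "q \<in> Y" using \<delta>(4) 1 2 by (auto simp: p_def q_def)
  have mid: "d p q = d p a + d a q"
    using additive[OF u v] pq by (simp add: a_def)
  have \<delta>add: "d b c = d b (\<delta> s) + d (\<delta> s) (\<delta> t) + d (\<delta> t) c" if "0 \<le> s" "s \<le> t" "t \<le> 1" for s t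
    using \<delta>(5)[of 0 s] \<delta>(5)[of s t] \<delta>(5)[of t 1] \<delta>(2,3) that by (simp add: algebra_simps)
  \<comment> \<open>The geodesic may meet the two halves of \<open>\<gamma>\<close> in either order.
    In both cases its part between the crossings has the same length \<open>d p a + d a q\<close> as
    the way through \<open>a\<close>.\<close>
  have "d b a + d a c \<le> d b c"
  proof (cases "s1 \<le> s2")
    case True
    have "d b c = d b p + d p q + d q c" using \<delta>add[of s1 s2] True 1 2 by (simp add: p_def q_def)
    then show ?thesis
      using d_triangle[OF bcY(1) pqY(1) aY] d_triangle[OF aY pqY(2) bcY(2)] mid by linarith
  next
    case False
    have "d b c = d b q + d q p + d p c" using \<delta>add[of s2 s1] False 1 2 by (simp add: p_def q_def)
    then show ?thesis
      using d_triangle[OF bcY(1) pqY(2) aY] d_triangle[OF aY pqY(1) bcY(2)] mid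
        d_sym[OF pqY] d_sym[OF pqY(1) aY] d_sym[OF aY pqY(2)] by linarith
  qed
  then have "d b c = d b a + d a c" using d_triangle[OF bcY(1) aY bcY(2)] by linarith
  then show ?thesis using that[OF bcB _ _ bc] ba ca by (simp add: a_def)
qed

end

theorem theorem3p1:
  fixes X :: "'a topology" and A :: "'a chart set" and g :: "'a metric_components"
    and Y1 Y2 :: "'a set" and f :: "'a \<Rightarrow> 'a"
  assumes "riemannian_surface X A g"
    and "connected_space X"
    and "C0_submanifold_bd X Y1" and "compactin X Y1" and "connectedin X Y1"
    and "mf_boundary X Y1 \<noteq> {}"
    and "\<And>x y. x \<in> Y1 \<Longrightarrow> y \<in> Y1 \<Longrightarrow> rho X A g Y1 x y < \<infinity>"
    and "strictly_convex X A g Y1"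
    and "C0_submanifold_bd X Y2" and "compactin X Y2" and "connectedin X Y2"
    and "mf_boundary X Y2 \<noteq> {}"
    and "\<And>x y. x \<in> Y2 \<Longrightarrow> y \<in> Y2 \<Longrightarrow> rho X A g Y2 x y < \<infinity>"
    and "bij_betw f (mf_boundary X Y1) (mf_boundary X Y2)"
    and "\<And>x y. x \<in> mf_boundary X Y1 \<Longrightarrow> y \<in> mf_boundary X Y1 \<Longrightarrow>
           rho X A g Y2 (f x) (f y) = rho X A g Y1 x y"
  shows "strictly_convex X A g Y2"
proof -
  interpret Y1: bordered_surface X A g Y1
    by unfold_locales (use assms in auto)
  interpret Y2: bordered_surface X A g Y2
    by unfold_locales (use assms in auto)
  have iso: "Y2.d (f x) (f y) = Y1.d x y" if "x \<in> mf_boundary X Y1" "y \<in> mf_boundary X Y1" for x y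
    using assms(15)[OF that] by (simp add: Y1.d_def Y2.d_def)
  have bY: "mf_boundary X Y1 \<subseteq> Y1" by (auto simp: mf_boundary_def)
  show ?thesis
    unfolding strictly_convex_def
  proof (intro ballI allI impI subsetI)
    fix \<alpha> \<beta> \<gamma> x
    assume sp: "shortest_path X A g Y2 \<alpha> \<beta> \<gamma>" and "x \<in> \<gamma> ` {0<..<1}"
    then obtain t0 where t0: "0 < t0" "t0 < 1" "x = \<gamma> t0" by auto
    show "x \<in> mf_interior X Y2"
    proof (rule ccontr)
      assume n: "x \<notin> mf_interior X Y2"
      have p: "pathin (subtopology X Y2) \<gamma>" using sp by (simp add: shortest_path_def)
      have \<gamma>Y: "\<gamma> t \<in> Y2" if "t \<in> {0..1}" for t
        using p that unfolding pathin_def by (auto simp: continuous_map_in_subtopology)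
      have a: "\<gamma> t0 \<in> mf_boundary X Y2" using n t0 \<gamma>Y[of t0] by (simp add: mf_boundary_def)
      obtain \<phi> :: "real \<Rightarrow> real" where \<phi>: "strict_mono_on {0..1} \<phi>"
        "\<And>s t. 0 \<le> s \<and> s \<le> t \<and> t \<le> 1 \<Longrightarrow> rho X A g Y2 (\<gamma> s) (\<gamma> t) = ennreal (\<phi> t - \<phi> s)"
        using sp unfolding shortest_path_def by blast
      \<comment> \<open>Strict monotonicity of \<open>\<phi>\<close> makes \<open>\<gamma>\<close>
        injective, so the boundary point differs from both ends of \<open>\<gamma>\<close>.\<close>
      have ne: "\<gamma> s \<noteq> \<gamma> t" if "0 \<le> s" "s < t" "t \<le> 1" for s t
      proof
        assume "\<gamma> s = \<gamma> t"
        then have "ennreal (\<phi> t - \<phi> s) = 0"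
          using \<phi>(2)[of s t] Y2.rho_self[OF \<gamma>Y, of t] that by simp
        moreover have "\<phi> s < \<phi> t" using \<phi>(1) that by (simp add: strict_mono_on_def)
        ultimately show False by simp
      qed
      obtain b c where bc: "b \<in> mf_boundary X Y2" "c \<in> mf_boundary X Y2" "b \<noteq> \<gamma> t0" "c \<noteq> \<gamma> t0" "b \<noteq> c"
        "Y2.d b c = Y2.d b (\<gamma> t0) + Y2.d (\<gamma> t0) c"
      proof (rule Y2.boundary_triple[OF p t0(1,2) a])
        show "\<gamma> 0 \<noteq> \<gamma> t0" using ne[of 0 t0] t0 by simp
        show "\<gamma> 1 \<noteq> \<gamma> t0" using ne[of t0 1] t0 by fastforce
      qed (use Y2.shortest_path_additive[OF sp] in blast)+
      have im: "f ` mf_boundary X Y1 = mf_boundary X Y2" using assms(14) by (simp add: bij_betw_def)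
      obtain a' where a': "a' \<in> mf_boundary X Y1" "\<gamma> t0 = f a'" using a im by (metis imageE)
      obtain b' where b': "b' \<in> mf_boundary X Y1" "b = f b'" using bc(1) im by (metis imageE)
      obtain c' where c': "c' \<in> mf_boundary X Y1" "c = f c'" using bc(2) im by (metis imageE)
      \<comment> \<open>Only distances between boundary points occur in the equality, so the
        isometry carries it back to \<open>Y1\<close>.\<close>
      have "Y1.d b' c' = Y1.d b' a' + Y1.d a' c'"
        using bc(6) iso a' b' c' by simp
      moreover have "b' \<noteq> a'" "a' \<noteq> c'" "b' \<noteq> c'" using bc a' b' c' by auto
      moreover have "b' \<in> Y1" "a' \<in> Y1" "c' \<in> Y1" using bY a' b' c' by auto
      ultimately obtain \<eta> where \<eta>: "shortest_path X A g Y1 b' c' \<eta>" "\<eta> (1/2) = a'"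
        using Y1.shortest_path_join[of b' a' c'] by metis
      have "\<eta> ` {0<..<1} \<subseteq> mf_interior X Y1"
        using assms(8) \<eta>(1) \<open>b' \<in> Y1\<close> \<open>c' \<in> Y1\<close> unfolding strictly_convex_def by blast
      moreover have "\<eta> (1/2) \<in> \<eta> ` {0<..<1}" by (rule imageI) simp
      ultimately show False using \<eta>(2) a'(1) by (auto simp: mf_boundary_def)
    qed
  qed
qed

end
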